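(* Let $(\mathfrak g,\{\ell_n\})$ be a finite dimensional $L_\infty$-algebra with associated homological vector field $Q$ on the formal pointed graded manifold $(\mathfrak g[1],0)$, let $\{q_n:\wedge^n\mathfrak g\to\mathbb k\}_{n\ge1}$ be a family of maps with $|q_n|=-n$, and let $f$ be the associated degree zero function in the ideal of $0$ in $\mathcal O_{\mathfrak g[1]}$. Then $(\mathfrak g,\{\ell_n\},\{q_n\})$ is a unimodular $L_\infty$-algebra if and only if the volume form $\rho_f=e^f\Delta_x$ is $Q$-invariant, i.e. $L_Q(\rho_f)=0$. Thus a unimodular $L_\infty$-algebra structure on $\mathfrak g$ is the same as a pair $(Q,\rho_f)$ consisting of a homological vector field $Q$ vanishing at $0$ and a $Q$-invariant volume form $\rho_f$, with $f$ a degree zero function in the ideal of $0$.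
   Context: $\mathbb k$ is a field of characteristic zero; differentials have degree $+1$; Koszul sign rule throughout. $\mathfrak g[1]^i=\mathfrak g^{i+1}$, $s:\mathfrak g[1]\to\mathfrak g$ is the degree $1$ identification, $\mathfrak g[1]$ carries the differential $d_{\mathfrak g[1]}=-s^{-1}ds$, $[n]=\{1,\dots,n\}$. Unimodular $L_\infty$-algebras. A unimodular $L_\infty$-algebra is a finite dimensional dg vector space $(\mathfrak g,d)$ with graded skew-symmetric maps $\ell_n:\wedge^n\mathfrak g\to\mathfrak g$ ($n\ge2$, degree $2-n$) and $q_n:\wedge^n\mathfrak g\to\mathbb k$ ($n\ge1$, degree $-n$) satisfying $$\partial\ell_n=\sum_{I\sqcup J=[n],\,1\le|I|\le n-2}(-1)^{\sigma_{I,J}+|I||J|}\ell_{|I|+1}(\mathrm{id}\otimes\cdots\otimes\mathrm{id}\otimes\ell_{|J|})\sigma_{I,J},$$ $$\partial q_n=\sum_{I\sqcup J=[n],\,0\le|I|\le n-2}(-1)^{\sigma_{I,J}+|I||J|}q_{|I|+1}(\mathrm{id}\otimes\cdots\otimes\mathrm{id}\otimes\ell_{|J|})\sigma_{I,J}+\mathrm{tr}_{n+1}\ell_{n+1},$$ where $\partial$ is the differential induced by $d$ on spaces of multilinear maps, $\sigma_{I,J}$ is the permutation mapping $1,\dots,|I|$ increasingly onto $I$ and the rest increasingly onto $J$, with sign $(-1)^{\sigma_{I,J}}$, and $(\mathrm{tr}_{n+1}\ell_{n+1})(x_1,\dots,x_n)$ is the graded trace of $\ell_{n+1}(x_1,\dots,x_n,-)$.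 The $\ell_n$ together with $d$ satisfying the first family of equations form an $L_\infty$-algebra. Formal geometry. $\mathcal O_{\mathfrak g[1]}=\prod_{n\ge0}\odot^n\mathfrak g[1]^*$ is the ring of functions on the formal graded pointed manifold $(\mathfrak g[1],0)$; the ideal of $0$ is $\prod_{n\ge1}$. $\mathcal T_{\mathfrak g[1]}=\mathrm{Der}\,\mathcal O_{\mathfrak g[1]}$ is the space of vector fields. A vector field $Q$ of degree $1$ with $Q^2=0$ and $Q|_0=0$ (no constant term) is called homological. With $\tilde\ell_n=s^{-1}\ell_ns^{\otimes n}$ for $n\ge2$ and $\tilde\ell_1=d_{\mathfrak g[1]}$, let $D$ be the coderivation of the cofree cocommutative coalgebra $\odot^{\ge1}\mathfrak g[1]$ with components $\tilde\ell_n$; the associated vector field $Q$ is the derivation dual to $D$: $Q(\varphi)=(-1)^{|\varphi|}\varphi\circ D$ for $\varphi$ in the ideal of $0$, viewed as a functional on $\odot^{\ge1}\mathfrak g[1]$. This gives a bijection between $L_\infty$-structures on $\mathfrak g$ (the differential being encoded by the linear part) and homological vector fields vanishing at $0$. The maps $\tilde q_n=q_ns^{\otimes n}$ assemble into a degree zero functional on $\odot^{\ge1}\mathfrak g[1]$, i.e. a degree zero function $f$ in the ideal of $0$. Volume forms. A basis of $\mathfrak g$ determines linear coordinates $\{x^\alpha\}$ on $\mathfrak g[1]$ (the dual basis of $\mathfrak g[1]^*$), with $\mathcal O_{\mathfrak g[1]}\cong\mathbb k[[x^\alpha]]$ and $\mathcal T_{\mathfrak g[1]}$ free with basis $\partial_\alpha=\partial/\partial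 x^\alpha$. The Berezinian $\mathrm{Ber}\,\mathcal T_{\mathfrak g[1]}$ is the free rank one $\mathcal O_{\mathfrak g[1]}$-module in which every basis of $\mathcal T_{\mathfrak g[1]}$ determines a basis element, those of different bases being related by the Berezinian (superdeterminant) of the change of basis. Its basis elements are called volume forms; $\Delta_x$ is the constant volume form determined by the coordinates $x^\alpha$. The action $L_V(\rho)$ of $V\in\mathcal T_{\mathfrak g[1]}$ on $\rho\in\mathrm{Ber}\,\mathcal T_{\mathfrak g[1]}$ is determined by: $L_V(g\rho)=V(g)\rho+(-1)^{|V||g|}gL_V(\rho)$; $L_{gV}(\rho)=(-1)^{|g||V|}L_V(g\rho)$; $L_{\partial_\alpha}(\Delta_x)=0$ for all $\alpha$. *)

theory Defs
  imports Complex_Main "HOL-Combinatorics.Permutations" "HOL-Library.Function_Algebras"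
begin

section \<open>Graded vector spaces and multilinear maps\<close>

record ('k, 'v) gvs =
  smul :: "'k \<Rightarrow> 'v \<Rightarrow> 'v"
  gr :: "int \<Rightarrow> 'v set"

definition decomposition :: "('k, 'v::ab_group_add) gvs \<Rightarrow> 'v \<Rightarrow> (int \<Rightarrow> 'v) \<Rightarrow> bool" where
  "decomposition g v c \<longleftrightarrow>
     (\<forall>i. c i \<in> gr g i) \<and> finite {i. c i \<noteq> 0} \<and> v = (\<Sum>i | c i \<noteq> 0. c i)"

definition graded_space :: "('k::field_char_0, 'v::ab_group_add) gvs \<Rightarrow> bool" where
  "graded_space g \<longleftrightarrow> vector_space (smul g) \<and> (\<forall>i. module.subspace (smul g) (gr g i)) \<and>
     (\<forall>v. \<exists>!c. decomposition g v c)"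

definition component :: "('k, 'v::ab_group_add) gvs \<Rightarrow> int \<Rightarrow> 'v \<Rightarrow> 'v" where
  "component g i v = (THE c. decomposition g v c) i"

definition homogeneous_basis :: "('k::field_char_0, 'v::ab_group_add) gvs \<Rightarrow> 'v list \<Rightarrow> bool" where
  "homogeneous_basis g es \<longleftrightarrow> distinct es \<and> \<not> module.dependent (smul g) (set es) \<and>
     module.span (smul g) (set es) = UNIV \<and> (\<forall>e \<in> set es. \<exists>i. e \<in> gr g i)"

definition hdeg :: "('k, 'v) gvs \<Rightarrow> 'v \<Rightarrow> int" where
  "hdeg g v = (THE i. v \<in> gr g i)"

definition ground :: "('k::field_char_0, 'k) gvs" where
  "ground = \<lparr>smul = (*), gr = (\<lambda>i. if i = 0 then UNIV else {0})\<rparr>"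

text \<open>The suspension \<open>g[1]\<close> has the same underlying vectors, so the degree \<open>1\<close> map \<open>s\<close> is the
  identity on vectors and is visible only through degrees and Koszul signs.\<close>

definition shift1 :: "('k, 'v) gvs \<Rightarrow> ('k, 'v) gvs" where
  "shift1 g = \<lparr>smul = smul g, gr = (\<lambda>i. gr g (i + 1))\<rparr>"

definition ksgn :: "int \<Rightarrow> 'k::ring_1" where
  "ksgn n = (if even n then 1 else - 1)"

text \<open>A list \<open>xs\<close> of homogeneous vectors whose degrees are listed in \<open>ds\<close>.\<close>

definition homog :: "('k, 'v) gvs \<Rightarrow> int list \<Rightarrow> 'v list \<Rightarrow> bool" where
  "homog g ds xs \<longleftrightarrow> list_all2 (\<lambda>i x. x \<in> gr g i) ds xs"

text \<open>A family of maps \<open>F\<^sub>n\<close> in \<open>n\<close> arguments, one for every \<open>n\<close>, is encoded as a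
  single function \<open>F\<close> on lists; \<open>F\<^sub>n\<close> is its restriction to lists of length \<open>n\<close>.\<close>

definition multilinear ::
  "('k::field_char_0, 'v::ab_group_add) gvs \<Rightarrow> ('k, 'w::ab_group_add) gvs \<Rightarrow> ('v list \<Rightarrow> 'w) \<Rightarrow> bool" where
  "multilinear g h F \<longleftrightarrow>
     (\<forall>xs i. i < length xs \<longrightarrow> Vector_Spaces.linear (smul g) (smul h) (\<lambda>x. F (xs[i := x])))"

definition gskew ::
  "('k::field_char_0, 'v) gvs \<Rightarrow> ('k, 'w::ab_group_add) gvs \<Rightarrow> ('v list \<Rightarrow> 'w) \<Rightarrow> bool" where
  "gskew g h F \<longleftrightarrow> (\<forall>us ws x y a b. x \<in> gr g a \<longrightarrow> y \<in> gr g b \<longrightarrow>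
     F (us @ [x, y] @ ws) = - smul h (ksgn (a * b)) (F (us @ [y, x] @ ws)))"

definition gsym ::
  "('k::field_char_0, 'v) gvs \<Rightarrow> ('k, 'w) gvs \<Rightarrow> ('v list \<Rightarrow> 'w) \<Rightarrow> bool" where
  "gsym g h F \<longleftrightarrow> (\<forall>us ws x y a b. x \<in> gr g a \<longrightarrow> y \<in> gr g b \<longrightarrow>
     F (us @ [x, y] @ ws) = smul h (ksgn (a * b)) (F (us @ [y, x] @ ws)))"

definition of_degree ::
  "('k, 'v) gvs \<Rightarrow> ('k, 'w) gvs \<Rightarrow> (nat \<Rightarrow> int) \<Rightarrow> ('v list \<Rightarrow> 'w) \<Rightarrow> bool" where
  "of_degree g h r F \<longleftrightarrow>
     (\<forall>ds xs. homog g ds xs \<longrightarrow> F xs \<in> gr h (sum_list ds + r (length xs)))"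

text \<open>Formulas with Koszul signs are written for homogeneous arguments; this extends such a
  formula \<open>\<Phi> ds xs\<close>, multilinear in \<open>xs\<close> for fixed degrees \<open>ds\<close>, to arbitrary arguments.\<close>

definition hext ::
  "('k, 'v::ab_group_add) gvs \<Rightarrow> (int list \<Rightarrow> 'v list \<Rightarrow> 'w::comm_monoid_add) \<Rightarrow> 'v list \<Rightarrow> 'w" where
  "hext g \<Phi> xs =
     (\<Sum>ds | length ds = length xs \<and> (\<forall>i < length xs. component g (ds ! i) (xs ! i) \<noteq> 0).
        \<Phi> ds (map2 (component g) ds xs))"

text \<open>\<open>unshuffle I J\<close> is \<open>\<sigma>\<^sub>I\<^sub>,\<^sub>J\<close>, with \<open>[n]\<close> replaced by \<open>{..<n}\<close>; a permutation acts by
  sending \<open>x\<^sub>0 \<otimes> x\<^sub>1 \<otimes> \<dots>\<close> to \<open>x\<^sub>\<sigma>\<^sub>(\<^sub>0\<^sub>) \<otimes> x\<^sub>\<sigma>\<^sub>(\<^sub>1\<^sub>) \<otimes> \<dots>\<close> times \<open>koszul \<sigma> ds\<close>.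
  The subword \<open>x\<^sub>I\<close> is \<open>nths xs I\<close>.\<close>

definition unshuffle :: "nat set \<Rightarrow> nat set \<Rightarrow> nat \<Rightarrow> nat" where
  "unshuffle I J k =
     (if k < card I + card J then (sorted_list_of_set I @ sorted_list_of_set J) ! k else k)"

definition koszul :: "(nat \<Rightarrow> nat) \<Rightarrow> int list \<Rightarrow> 'k::comm_ring_1" where
  "koszul \<sigma> ds =
     (\<Prod>(a, b) \<in> {(a, b). a < b \<and> b < length ds \<and> \<sigma> b < \<sigma> a}. ksgn (ds ! \<sigma> a * ds ! \<sigma> b))"


section \<open>Unimodular L-infinity algebras\<close>

text \<open>\<open>\<partial>F = d\<^sub>h F - (-1)\<^sup>r F d\<close> for \<open>F\<close> of degree \<open>r\<close>, at homogeneous arguments.\<close>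

definition hom_diff ::
  "('k::field_char_0, 'w::ab_group_add) gvs \<Rightarrow> ('v \<Rightarrow> 'v) \<Rightarrow> ('w \<Rightarrow> 'w) \<Rightarrow> int \<Rightarrow>
   ('v list \<Rightarrow> 'w) \<Rightarrow> int list \<Rightarrow> 'v list \<Rightarrow> 'w" where
  "hom_diff h d dh r F ds xs =
     dh (F xs) - smul h (ksgn r)
       (\<Sum>i < length xs. smul h (ksgn (sum_list (take i ds))) (F (xs[i := d (xs ! i)])))"

text \<open>The summand of index \<open>I \<squnion> J\<close> of the quadratic expressions. The last sign comes from moving
  the inner \<open>\<ell>\<close>, of degree \<open>2 - card J\<close>, past \<open>x\<^sub>I\<close>.\<close>

definition quad_term ::
  "('k::field_char_0, 'w) gvs \<Rightarrow> ('v list \<Rightarrow> 'w) \<Rightarrow> ('v list \<Rightarrow> 'v) \<Rightarrow>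
   int list \<Rightarrow> 'v list \<Rightarrow> nat set \<Rightarrow> 'w" where
  "quad_term h F l ds xs I =
     (let J = {..<length xs} - I; \<sigma> = unshuffle I J in
      smul h (of_int (sign \<sigma>) * ksgn (int (card I * card J)) * koszul \<sigma> ds *
              ksgn ((2 - int (card J)) * sum_list (nths ds I)))
        (F (nths xs I @ [l (nths xs J)])))"

definition gtrace ::
  "('k::field_char_0, 'v::ab_group_add) gvs \<Rightarrow> 'v list \<Rightarrow> ('v \<Rightarrow> 'v) \<Rightarrow> 'k" where
  "gtrace g es A =
     (\<Sum>e \<in> set es. ksgn (hdeg g e) * module.representation (smul g) (set es) (A e) e)"

definition skew_family ::
  "('k::field_char_0, 'v::ab_group_add) gvs \<Rightarrow> ('k, 'w::ab_group_add) gvs \<Rightarrow> (nat \<Rightarrow> int) \<Rightarrow>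
   ('v list \<Rightarrow> 'w) \<Rightarrow> bool" where
  "skew_family g h r F \<longleftrightarrow> multilinear g h F \<and> gskew g h F \<and> of_degree g h r F"

definition dg_space ::
  "('k::field_char_0, 'v::ab_group_add) gvs \<Rightarrow> ('v \<Rightarrow> 'v) \<Rightarrow> bool" where
  "dg_space g d \<longleftrightarrow> graded_space g \<and> Vector_Spaces.linear (smul g) (smul g) d \<and>
     (\<forall>i. d ` gr g i \<subseteq> gr g (i + 1)) \<and> (\<forall>x. d (d x) = 0)"

definition L_infinity ::
  "('k::field_char_0, 'v::ab_group_add) gvs \<Rightarrow> ('v \<Rightarrow> 'v) \<Rightarrow> ('v list \<Rightarrow> 'v) \<Rightarrow> bool" where
  "L_infinity g d l \<longleftrightarrow> dg_space g d \<and>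
     (\<forall>xs. length xs < 2 \<longrightarrow> l xs = 0) \<and>
     skew_family g g (\<lambda>n. 2 - int n) l \<and>
     (\<forall>ds xs. homog g ds xs \<longrightarrow> length xs \<ge> 2 \<longrightarrow>
        hom_diff g d d (2 - int (length xs)) l ds xs =
        (\<Sum>I | I \<subseteq> {..<length xs} \<and> 1 \<le> card I \<and> card I + 2 \<le> length xs.
           quad_term g l l ds xs I))"

definition q_family ::
  "('k::field_char_0, 'v::ab_group_add) gvs \<Rightarrow> ('v list \<Rightarrow> 'k) \<Rightarrow> bool" where
  "q_family g q \<longleftrightarrow> q [] = 0 \<and> skew_family g ground (\<lambda>n. - int n) q"

text \<open>\<open>es\<close> is a homogeneous basis, used only to compute the (basis independent) graded trace.\<close>

definition unimodular_L_infinity ::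
  "('k::field_char_0, 'v::ab_group_add) gvs \<Rightarrow> 'v list \<Rightarrow>
   ('v \<Rightarrow> 'v) \<Rightarrow> ('v list \<Rightarrow> 'v) \<Rightarrow> ('v list \<Rightarrow> 'k) \<Rightarrow> bool" where
  "unimodular_L_infinity g es d l q \<longleftrightarrow> L_infinity g d l \<and> q_family g q \<and>
     (\<forall>ds xs. homog g ds xs \<longrightarrow> length xs \<ge> 1 \<longrightarrow>
        hom_diff ground d (\<lambda>_. 0) (- int (length xs)) q ds xs =
        (\<Sum>I | I \<subseteq> {..<length xs} \<and> card I + 2 \<le> length xs. quad_term ground q l ds xs I)
        + gtrace g es (\<lambda>y. l (xs @ [y])))"


section \<open>Functions and vector fields on a formal graded pointed manifold\<close>

text \<open>In this section \<open>X\<close> plays the role of \<open>g[1]\<close>. An element of \<open>\<Prod>\<^sub>n \<odot>\<^sup>n X\<^sup>*\<close> is given as a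
  functional on the symmetric coalgebra of \<open>X\<close>, that is, by graded symmetric multilinear
  functionals; its value at \<open>[]\<close> is the constant term. The product is dual to the coproduct,
  with \<open>(\<phi> \<otimes> \<psi>)(v \<otimes> w) = (-1)\<^bsup>|\<psi>||v|\<^esup> \<phi>(v) \<psi>(w)\<close>; only \<open>|\<psi>| = -|w|\<close> contributes.\<close>

type_synonym ('k, 'v) fn = "'v list \<Rightarrow> 'k"

type_synonym ('k, 'v) vf = "('k, 'v) fn \<Rightarrow> ('k, 'v) fn"

definition fns :: "('k::field_char_0, 'v::ab_group_add) gvs \<Rightarrow> ('k, 'v) fn set" where
  "fns X = {\<phi>. multilinear X ground \<phi> \<and> gsym X ground \<phi>}"

definition fns_deg :: "('k::field_char_0, 'v::ab_group_add) gvs \<Rightarrow> int \<Rightarrow> ('k, 'v) fn set" where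
  "fns_deg X i = {\<phi> \<in> fns X. of_degree X ground (\<lambda>_. i) \<phi>}"

definition ideal0 :: "('k::field_char_0, 'v::ab_group_add) gvs \<Rightarrow> ('k, 'v) fn set" where
  "ideal0 X = {\<phi> \<in> fns X. \<phi> [] = 0}"

definition fone :: "('k::field_char_0, 'v) fn" where
  "fone xs = (if xs = [] then 1 else 0)"

definition fscale :: "'k::field_char_0 \<Rightarrow> ('k, 'v) fn \<Rightarrow> ('k, 'v) fn" where
  "fscale c \<phi> xs = c * \<phi> xs"

definition fmul ::
  "('k::field_char_0, 'v::ab_group_add) gvs \<Rightarrow> ('k, 'v) fn \<Rightarrow> ('k, 'v) fn \<Rightarrow> ('k, 'v) fn" where
  "fmul X \<phi> \<psi> = hext X (\<lambda>ds xs.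
     \<Sum>I \<in> Pow {..<length xs}. let J = {..<length xs} - I in
       koszul (unshuffle I J) ds * ksgn (sum_list (nths ds I) * sum_list (nths ds J)) *
       \<phi> (nths xs I) * \<psi> (nths xs J))"

definition fpow ::
  "('k::field_char_0, 'v::ab_group_add) gvs \<Rightarrow> ('k, 'v) fn \<Rightarrow> nat \<Rightarrow> ('k, 'v) fn" where
  "fpow X \<phi> k = (fmul X \<phi> ^^ k) fone"

text \<open>For \<open>\<phi>\<close> in the ideal of \<open>0\<close>, its \<open>k\<close>-th power vanishes on words shorter than \<open>k\<close>, so the
  exponential series is finite at every word.\<close>

definition fexp ::
  "('k::field_char_0, 'v::ab_group_add) gvs \<Rightarrow> ('k, 'v) fn \<Rightarrow> ('k, 'v) fn" where
  "fexp X \<phi> xs = (\<Sum>k \<le> length xs. fpow X \<phi> k xs / fact k)"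

text \<open>Homogeneous derivations of degree \<open>j\<close>; the first clause only fixes the junk values outside
  the ring of functions, so that equality of derivations is equality of HOL functions.\<close>

definition vector_field ::
  "('k::field_char_0, 'v::ab_group_add) gvs \<Rightarrow> int \<Rightarrow> ('k, 'v) vf \<Rightarrow> bool" where
  "vector_field X j V \<longleftrightarrow>
     (\<forall>\<phi>. \<phi> \<notin> fns X \<longrightarrow> V \<phi> = 0) \<and>
     (\<forall>\<phi> \<in> fns X. V \<phi> \<in> fns X) \<and>
     (\<forall>\<phi> \<in> fns X. \<forall>\<psi> \<in> fns X. V (\<phi> + \<psi>) = V \<phi> + V \<psi>) \<and>
     (\<forall>c. \<forall>\<phi> \<in> fns X. V (fscale c \<phi>) = fscale c (V \<phi>)) \<and>
     (\<forall>i. \<forall>\<phi> \<in> fns_deg X i. V \<phi> \<in> fns_deg X (i + j)) \<and>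
     (\<forall>i. \<forall>\<phi> \<in> fns_deg X i. \<forall>\<psi> \<in> fns X.
        V (fmul X \<phi> \<psi>) = fmul X (V \<phi>) \<psi> + fscale (ksgn (i * j)) (fmul X \<phi> (V \<psi>)))"

definition vmul ::
  "('k::field_char_0, 'v::ab_group_add) gvs \<Rightarrow> ('k, 'v) fn \<Rightarrow> ('k, 'v) vf \<Rightarrow> ('k, 'v) vf" where
  "vmul X g V = (\<lambda>\<phi>. fmul X g (V \<phi>))"

definition homological ::
  "('k::field_char_0, 'v::ab_group_add) gvs \<Rightarrow> ('k, 'v) vf \<Rightarrow> bool" where
  "homological X Q \<longleftrightarrow> vector_field X 1 Q \<and> (\<forall>\<phi> \<in> fns X. Q (Q \<phi>) = 0) \<and>
     (\<forall>\<phi> \<in> fns X. Q \<phi> [] = 0)"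

definition coord ::
  "('k::field_char_0, 'v::ab_group_add) gvs \<Rightarrow> 'v list \<Rightarrow> nat \<Rightarrow> ('k, 'v) fn" where
  "coord X es i xs =
     (if length xs = 1 then module.representation (smul X) (set es) (hd xs) (es ! i) else 0)"

text \<open>\<open>\<partial>\<^sub>i\<close> has the degree of \<open>e\<^sub>i\<close>, and the coordinate \<open>x\<^sup>i\<close> has the opposite degree.\<close>

definition dcoord ::
  "('k::field_char_0, 'v::ab_group_add) gvs \<Rightarrow> 'v list \<Rightarrow> nat \<Rightarrow> ('k, 'v) vf" where
  "dcoord X es i = (THE V. vector_field X (hdeg X (es ! i)) V \<and>
     (\<forall>j < length es. V (coord X es j) = (if j = i then fone else 0)))"


section \<open>The vector field and the function associated with a family of brackets\<close>

text \<open>\<open>F s\<^bsup>\<otimes>n\<^esup>\<close> as a family of maps on \<open>g[1]\<close>: the factor \<open>s\<close> in position \<open>j\<close> has to pass the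
  arguments in the positions before \<open>j\<close>.\<close>

definition precomp_s ::
  "('k::field_char_0, 'v::ab_group_add) gvs \<Rightarrow> ('k, 'w::ab_group_add) gvs \<Rightarrow>
   ('v list \<Rightarrow> 'w) \<Rightarrow> 'v list \<Rightarrow> 'w" where
  "precomp_s g h F = hext (shift1 g) (\<lambda>ds xs.
     smul h (ksgn (\<Sum>j < length xs. sum_list (take j ds))) (F xs))"

definition tilde_l ::
  "('k::field_char_0, 'v::ab_group_add) gvs \<Rightarrow> ('v \<Rightarrow> 'v) \<Rightarrow> ('v list \<Rightarrow> 'v) \<Rightarrow> 'v list \<Rightarrow> 'v" where
  "tilde_l g d l xs = (if length xs = 1 then - d (hd xs) else precomp_s g g l xs)"

text \<open>\<open>\<phi> \<circ> D\<close>, where \<open>D\<close> is the coderivation with components \<open>lt\<close>, that is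
  \<open>D(x\<^sub>1 \<cdots> x\<^sub>n) = \<Sum> \<plusminus> lt(x\<^sub>J) x\<^sub>I\<close> over \<open>J \<squnion> I = [n]\<close> with \<open>J\<close> nonempty.\<close>

definition comp_coder ::
  "('k::field_char_0, 'v::ab_group_add) gvs \<Rightarrow> ('v list \<Rightarrow> 'v) \<Rightarrow> ('k, 'v) fn \<Rightarrow> ('k, 'v) fn" where
  "comp_coder X lt \<phi> = hext X (\<lambda>ds xs.
     \<Sum>J \<in> Pow {..<length xs} - {{}}. let I = {..<length xs} - J in
       koszul (unshuffle J I) ds * \<phi> (lt (nths xs J) # nths xs I))"

definition assoc_vf ::
  "('k::field_char_0, 'v::ab_group_add) gvs \<Rightarrow> ('v \<Rightarrow> 'v) \<Rightarrow> ('v list \<Rightarrow> 'v) \<Rightarrow> ('k, 'v) vf" where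
  "assoc_vf g d l = (THE Q. vector_field (shift1 g) 1 Q \<and>
     (\<forall>i. \<forall>\<phi> \<in> fns_deg (shift1 g) i \<inter> ideal0 (shift1 g).
        Q \<phi> = fscale (ksgn i) (comp_coder (shift1 g) (tilde_l g d l) \<phi>)))"

definition assoc_fn ::
  "('k::field_char_0, 'v::ab_group_add) gvs \<Rightarrow> ('v list \<Rightarrow> 'k) \<Rightarrow> ('k, 'v) fn" where
  "assoc_fn g q = precomp_s g ground q"


section \<open>The Berezinian module and the action of vector fields\<close>

text \<open>Bases of the module of vector fields. Bases are homogeneous and indexed so that \<open>b i\<close> has
  the degree of \<open>\<partial>\<^sub>i\<close>; in particular rows and columns of a change of basis have the same parities.\<close>

definition frame ::
  "('k::field_char_0, 'v::ab_group_add) gvs \<Rightarrow> 'v list \<Rightarrow> (nat \<Rightarrow> ('k, 'v) vf) \<Rightarrow> bool" where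
  "frame X es b \<longleftrightarrow>
     (\<forall>i < length es. vector_field X (hdeg X (es ! i)) (b i)) \<and>
     (\<forall>j V. vector_field X j V \<longrightarrow>
        (\<exists>!g. (\<forall>i < length es. g i \<in> fns_deg X (j - hdeg X (es ! i))) \<and>
              (\<forall>i \<ge> length es. g i = 0) \<and>
              V = (\<Sum>i < length es. vmul X (g i) (b i))))"

definition change_of_frame ::
  "('k::field_char_0, 'v::ab_group_add) gvs \<Rightarrow> 'v list \<Rightarrow> (nat \<Rightarrow> ('k, 'v) vf) \<Rightarrow>
   (nat \<Rightarrow> ('k, 'v) vf) \<Rightarrow> (nat \<Rightarrow> nat \<Rightarrow> ('k, 'v) fn) \<Rightarrow> bool" where
  "change_of_frame X es b b' A \<longleftrightarrow>
     (\<forall>i < length es. \<forall>j < length es. A i j \<in> fns_deg X (hdeg X (es ! i) - hdeg X (es ! j))) \<and>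
     (\<forall>i < length es. b' i = (\<Sum>j < length es. vmul X (A i j) (b j)))"

definition fmat_mul ::
  "('k::field_char_0, 'v::ab_group_add) gvs \<Rightarrow> nat set \<Rightarrow> (nat \<Rightarrow> nat \<Rightarrow> ('k, 'v) fn) \<Rightarrow>
   (nat \<Rightarrow> nat \<Rightarrow> ('k, 'v) fn) \<Rightarrow> nat \<Rightarrow> nat \<Rightarrow> ('k, 'v) fn" where
  "fmat_mul X S A B i j = (\<Sum>k \<in> S. fmul X (A i k) (B k j))"

definition fdet ::
  "('k::field_char_0, 'v::ab_group_add) gvs \<Rightarrow> nat set \<Rightarrow> (nat \<Rightarrow> nat \<Rightarrow> ('k, 'v) fn) \<Rightarrow>
   ('k, 'v) fn" where
  "fdet X S A = (\<Sum>\<pi> | \<pi> permutes S.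
     fscale (of_int (sign \<pi>)) (foldr (\<lambda>i. fmul X (A i (\<pi> i))) (sorted_list_of_set S) fone))"

definition fmat_inv ::
  "('k::field_char_0, 'v::ab_group_add) gvs \<Rightarrow> nat set \<Rightarrow> (nat \<Rightarrow> nat \<Rightarrow> ('k, 'v) fn) \<Rightarrow>
   nat \<Rightarrow> nat \<Rightarrow> ('k, 'v) fn" where
  "fmat_inv X S A = (SOME B. \<forall>i \<in> S. \<forall>j \<in> S. B i j \<in> fns X \<and>
     fmat_mul X S A B i j = (if i = j then fone else 0) \<and>
     fmat_mul X S B A i j = (if i = j then fone else 0))"

definition finv ::
  "('k::field_char_0, 'v::ab_group_add) gvs \<Rightarrow> ('k, 'v) fn \<Rightarrow> ('k, 'v) fn" where
  "finv X u = (THE w. w \<in> fns X \<and> fmul X u w = fone)"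

text \<open>\<open>Ber A = det (A\<^sub>0\<^sub>0 - A\<^sub>0\<^sub>1 A\<^sub>1\<^sub>1\<^sup>-\<^sup>1 A\<^sub>1\<^sub>0) det(A\<^sub>1\<^sub>1)\<^sup>-\<^sup>1\<close>, where the index parity is that of \<open>\<partial>\<^sub>i\<close>.\<close>

definition sdet ::
  "('k::field_char_0, 'v::ab_group_add) gvs \<Rightarrow> 'v list \<Rightarrow> (nat \<Rightarrow> nat \<Rightarrow> ('k, 'v) fn) \<Rightarrow>
   ('k, 'v) fn" where
  "sdet X es A =
     (let E = {i. i < length es \<and> even (hdeg X (es ! i))};
          U = {i. i < length es \<and> odd (hdeg X (es ! i))}
      in fmul X
           (fdet X E (\<lambda>i j. A i j - fmat_mul X U A (fmat_mul X U (fmat_inv X U A) A) i j))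
           (finv X (fdet X U A)))"

text \<open>\<open>M\<close> with scalar action \<open>act\<close> is a module over the ring of functions, \<open>vol b\<close> is the basis
  element determined by the basis \<open>b\<close> of vector fields. This characterises the Berezinian module
  up to unique isomorphism.\<close>

definition berezinian_module ::
  "('k::field_char_0, 'v::ab_group_add) gvs \<Rightarrow> 'v list \<Rightarrow> 'm::ab_group_add set \<Rightarrow>
   (('k, 'v) fn \<Rightarrow> 'm \<Rightarrow> 'm) \<Rightarrow> ((nat \<Rightarrow> ('k, 'v) vf) \<Rightarrow> 'm) \<Rightarrow> bool" where
  "berezinian_module X es M act vol \<longleftrightarrow>
     0 \<in> M \<and> (\<forall>\<rho> \<in> M. \<forall>\<tau> \<in> M. \<rho> - \<tau> \<in> M) \<and>
     (\<forall>g \<in> fns X. \<forall>\<rho> \<in> M. act g \<rho> \<in> M) \<and>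
     (\<forall>\<rho> \<in> M. act fone \<rho> = \<rho>) \<and>
     (\<forall>g \<in> fns X. \<forall>h \<in> fns X. \<forall>\<rho> \<in> M. act (fmul X g h) \<rho> = act g (act h \<rho>)) \<and>
     (\<forall>g \<in> fns X. \<forall>h \<in> fns X. \<forall>\<rho> \<in> M. act (g + h) \<rho> = act g \<rho> + act h \<rho>) \<and>
     (\<forall>g \<in> fns X. \<forall>\<rho> \<in> M. \<forall>\<tau> \<in> M. act g (\<rho> + \<tau>) = act g \<rho> + act g \<tau>) \<and>
     (\<forall>b. frame X es b \<longrightarrow> vol b \<in> M \<and> (\<forall>\<rho> \<in> M. \<exists>!g. g \<in> fns X \<and> \<rho> = act g (vol b))) \<and>
     (\<forall>b b' A. frame X es b \<longrightarrow> frame X es b' \<longrightarrow> change_of_frame X es b b' A \<longrightarrow>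
        vol b' = act (sdet X es A) (vol b))"

definition const_vol ::
  "('k::field_char_0, 'v::ab_group_add) gvs \<Rightarrow> 'v list \<Rightarrow> ((nat \<Rightarrow> ('k, 'v) vf) \<Rightarrow> 'm) \<Rightarrow> 'm" where
  "const_vol X es vol = vol (dcoord X es)"

text \<open>The characterising properties of the action of vector fields; the first three clauses say
  that it is an additive action.\<close>

definition lie_action ::
  "('k::field_char_0, 'v::ab_group_add) gvs \<Rightarrow> 'v list \<Rightarrow> 'm::ab_group_add set \<Rightarrow>
   (('k, 'v) fn \<Rightarrow> 'm \<Rightarrow> 'm) \<Rightarrow> ((nat \<Rightarrow> ('k, 'v) vf) \<Rightarrow> 'm) \<Rightarrow> (('k, 'v) vf \<Rightarrow> 'm \<Rightarrow> 'm) \<Rightarrow> bool" where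
  "lie_action X es M act vol L \<longleftrightarrow>
     (\<forall>j V. vector_field X j V \<longrightarrow> (\<forall>\<rho> \<in> M. L V \<rho> \<in> M)) \<and>
     (\<forall>j V. vector_field X j V \<longrightarrow> (\<forall>\<rho> \<in> M. \<forall>\<tau> \<in> M. L V (\<rho> + \<tau>) = L V \<rho> + L V \<tau>)) \<and>
     (\<forall>j V W. vector_field X j V \<longrightarrow> vector_field X j W \<longrightarrow>
        (\<forall>\<rho> \<in> M. L (V + W) \<rho> = L V \<rho> + L W \<rho>)) \<and>
     (\<forall>i j V. vector_field X j V \<longrightarrow> (\<forall>g \<in> fns_deg X i. \<forall>\<rho> \<in> M.
        L V (act g \<rho>) = act (V g) \<rho> + act (fscale (ksgn (i * j)) g) (L V \<rho>))) \<and>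
     (\<forall>i j V. vector_field X j V \<longrightarrow> (\<forall>g \<in> fns_deg X i. \<forall>\<rho> \<in> M.
        L (vmul X g V) \<rho> = act (fscale (ksgn (i * j)) fone) (L V (act g \<rho>)))) \<and>
     (\<forall>i < length es. L (dcoord X es i) (const_vol X es vol) = 0)"

definition exp_vol ::
  "('k::field_char_0, 'v::ab_group_add) gvs \<Rightarrow> 'v list \<Rightarrow> (('k, 'v) fn \<Rightarrow> 'm \<Rightarrow> 'm) \<Rightarrow>
   ((nat \<Rightarrow> ('k, 'v) vf) \<Rightarrow> 'm) \<Rightarrow> ('k, 'v) fn \<Rightarrow> 'm" where
  "exp_vol X es act vol f = act (fexp X f) (const_vol X es vol)"

end

theory Submission
  imports Defs
begin

text \<open>Write \<open>X = g[1]\<close> with a homogeneous basis \<open>e\<^sub>a\<close> and coordinates \<open>x\<^sup>a\<close>. A vector field of degree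
\<open>1\<close> is \<open>Q = \<Sum>\<^sub>a Q\<^sup>a \<partial>\<^sub>a\<close> with \<open>Q\<^sup>a = Q(x\<^sup>a)\<close>. The three rules for the action on volume forms give
\<open>L\<^sub>Q(\<Delta>) = (\<Sum>\<^sub>a \<partial>\<^sub>a Q\<^sup>a) \<Delta>\<close>, and since \<open>f\<close> has degree \<open>0\<close> the chain rule \<open>Q(e\<^sup>f) = e\<^sup>f Q(f)\<close> turns this into
\<open>L\<^sub>Q(e\<^sup>f \<Delta>) = e\<^sup>f (Q f + \<Sum>\<^sub>a \<partial>\<^sub>a Q\<^sup>a) \<Delta>\<close>. The form \<open>\<Delta>\<close> is a basis of its module and \<open>e\<^sup>f\<close> is not a zero
divisor, so invariance of \<open>\<rho>\<^sub>f\<close> means \<open>Q f + \<Sum>\<^sub>a \<partial>\<^sub>a Q\<^sup>a = 0\<close> (\<open>L_exp_vol_zero_iff\<close>).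

At a word \<open>x\<^sub>1 \<dots> x\<^sub>n\<close> the function \<open>Q f\<close> is the sum over the splittings \<open>I \<squnion> J = [n]\<close> of the terms
\<open>\<plusminus> f(x\<^sub>I, lt(x\<^sub>J))\<close>, where \<open>lt\<close> are the shifted brackets, and \<open>\<Sum>\<^sub>a \<partial>\<^sub>a Q\<^sup>a\<close> is the supertrace of
\<open>lt(x\<^sub>1, \<dots>, x\<^sub>n, -)\<close>. Undoing the shift changes every splitting term, and the trace, by one and the
same nonzero sign. When \<open>-d\<close> serves as the bracket with one argument, the splittings with \<open>|J| = 1\<close>
add up to \<open>-\<partial>q\<^sub>n\<close>, so that \<open>Q f + \<Sum>\<^sub>a \<partial>\<^sub>a Q\<^sup>a\<close> vanishes at all words exactly when the equations of a
unimodular structure hold (\<open>unimodular_term\<close>, \<open>unimodular_iff\<close>). The same computation with the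
functions \<open>Q\<^sup>b\<close> in place of \<open>f\<close> identifies \<open>Q\<^sup>2 = 0\<close> with the equations of an L-infinity algebra
(\<open>L_infinity_homological\<close>).

The bijection follows because nothing is lost on the way: a vector field is determined by its
values on the coordinates, those may be prescribed freely in the right degrees, the sign twist
by \<open>s\<^bsup>\<otimes>n\<^esup>\<close> is an involution, and \<open>e\<^sup>f\<close> determines \<open>f\<close> since \<open>\<partial>\<^sub>a e\<^sup>f = (\<partial>\<^sub>a f) e\<^sup>f\<close>.

Functions are multilinear, hence determined by their values on words in the basis. On such words
\<open>\<partial>\<^sub>a\<close> simply appends the letter \<open>e\<^sub>a\<close>, and the graded Leibniz rule for \<open>\<partial>\<^sub>a\<close> is a recursion that computes
the product along the last letter. Associativity, graded symmetry of products and the Euler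
identity all follow from it by induction on words. Vector fields are determined by their
values on the coordinates because, by the Euler identity, every function is a constant plus a
combination of coordinates whose coefficients are functions again (\<open>hadamard\<close>).\<close>

section \<open>Signs of unshuffles and of the shift\<close>

lemma ksgn_add: "ksgn (a + b) = ksgn a * (ksgn b :: 'k::ring_1)"
  by (auto simp: ksgn_def)

lemma ksgn_0 [simp]: "ksgn 0 = 1"
  by (simp add: ksgn_def)

lemma ksgn_1 [simp]: "ksgn 1 = - 1"
  by (simp add: ksgn_def)

lemma ksgn_cong: "(even a \<longleftrightarrow> even b) \<Longrightarrow> ksgn a = ksgn b"
  by (simp add: ksgn_def)

lemma ksgn_square [simp]: "ksgn a * ksgn a = (1 :: 'k::ring_1)"
  by (simp add: ksgn_def)

lemma ksgn_cancel [simp]: "ksgn a * (ksgn a * x) = (x :: 'k::ring_1)"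
  by (simp add: ksgn_def)

lemma ksgn_nonzero [simp]: "ksgn a \<noteq> (0 :: 'k::field_char_0)"
  by (simp add: ksgn_def)

lemma of_int_ksgn [simp]: "of_int (ksgn a) = (ksgn a :: 'k::ring_1)"
  by (simp add: ksgn_def)

text \<open>Every sign below is a product over pairs of positions that are separated by a splitting of the
positions into two blocks. A new last position contributes only a few factors, so sign identities
are proved by letting the word and one of its two blocks grow together.\<close>

lemma snoc_subset_induct [consumes 1, case_names Nil out into]:
  assumes "I \<subseteq> {..<length ds}"
    and "P [] {}"
    and "\<And>ds a I. I \<subseteq> {..<length ds} \<Longrightarrow> P ds I \<Longrightarrow> P (ds @ [a]) I"
    and "\<And>ds a I. I \<subseteq> {..<length ds} \<Longrightarrow> P ds I \<Longrightarrow> P (ds @ [a]) (insert (length ds) I)"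
  shows "P ds I"
  using assms(1)
proof (induction ds arbitrary: I rule: rev_induct)
  case Nil
  then show ?case using assms(2) by simp
next
  case (snoc a ds)
  show ?case
  proof (cases "length ds \<in> I")
    case True
    have "I - {length ds} \<subseteq> {..<length ds}" using snoc.prems by auto
    moreover have "I = insert (length ds) (I - {length ds})" using True by auto
    ultimately show ?thesis using assms(4)[of "I - {length ds}" ds a] snoc.IH by metis
  next
    case False
    then have "I \<subseteq> {..<length ds}" using snoc.prems by (auto simp: less_Suc_eq)
    then show ?thesis using assms(3) snoc.IH by blast
  qed
qed

lemma compl_out: "I \<subseteq> {..<n} \<Longrightarrow> {..<Suc n} - I = insert n ({..<n} - I)"
  by auto

lemma compl_into: "I \<subseteq> {..<n} \<Longrightarrow> {..<Suc n} - insert n I = {..<n} - I"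
  by auto

lemma nths_snoc_out:
  assumes "I \<subseteq> {..<length ds}" shows "nths (ds @ [a]) I = nths ds I"
proof -
  have "0 \<notin> {j. j + length ds \<in> I}" using assms by auto
  then show ?thesis by (simp add: nths_append)
qed

lemma nths_snoc_into:
  assumes "I \<subseteq> {..<length ds}" shows "nths (ds @ [a]) (insert (length ds) I) = nths ds I @ [a]"
proof -
  have "nths ds (insert (length ds) I) = nths ds I"
    by (auto simp: nths_def intro!: arg_cong[where f = "map fst"] filter_cong dest: set_zip_rightD)
  then show ?thesis by (simp add: nths_append)
qed

lemma length_nths_sub: "I \<subseteq> {..<length ds} \<Longrightarrow> length (nths ds I) = card I"
  by (auto simp: length_nths intro!: arg_cong[where f = card])

lemma sum_list_nths_compl:
  fixes ds :: "'a::comm_monoid_add list"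
  assumes "I \<subseteq> {..<length ds}"
  shows "sum_list (nths ds I) + sum_list (nths ds ({..<length ds} - I)) = sum_list ds"
  using assms
  by (induction rule: snoc_subset_induct)
    (simp_all add: compl_out compl_into nths_snoc_out nths_snoc_into add_ac)

lemma sum_Pow_Suc:
  "(\<Sum>I \<in> Pow {..<Suc n}. F I) = (\<Sum>I \<in> Pow {..<n}. F I) + (\<Sum>I \<in> Pow {..<n}. F (insert n I))"
proof -
  have 1: "Pow {..<Suc n} = Pow {..<n} \<union> insert n ` Pow {..<n}"
    by (simp add: lessThan_Suc Pow_insert)
  have 2: "Pow {..<n} \<inter> insert n ` Pow {..<n} = {}" by auto
  have 3: "inj_on (insert n) (Pow {..<n})"
    by (auto simp: inj_on_def insert_ident)
  show ?thesis unfolding 1 by (subst sum.union_disjoint) (use 2 3 in \<open>auto simp: sum.reindex\<close>)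
qed

lemma sum_Pow_compl: "(\<Sum>I \<in> Pow {..<n::nat}. F ({..<n} - I)) = (\<Sum>I \<in> Pow {..<n}. F I)"
  by (rule sum.reindex_bij_witness[where i = "\<lambda>I. {..<n} - I" and j = "\<lambda>I. {..<n} - I"])
    (auto simp: double_diff)

lemma unshuffle_list:
  assumes "I \<subseteq> {..<n}"
  shows "distinct (sorted_list_of_set I @ sorted_list_of_set ({..<n} - I))"
    and "set (sorted_list_of_set I @ sorted_list_of_set ({..<n} - I)) = {..<n}"
    and "card I + card ({..<n} - I) = n"
    and "length (sorted_list_of_set I @ sorted_list_of_set ({..<n} - I)) = n"
proof -
  have f: "finite I" using assms finite_subset by blast
  then show "distinct (sorted_list_of_set I @ sorted_list_of_set ({..<n} - I))"
    and "set (sorted_list_of_set I @ sorted_list_of_set ({..<n} - I)) = {..<n}"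
    using assms by auto
  show s: "card I + card ({..<n} - I) = n"
    using assms f card_mono[OF _ assms] by (simp add: card_Diff_subset)
  show "length (sorted_list_of_set I @ sorted_list_of_set ({..<n} - I)) = n"
    using s by simp
qed

text \<open>An unshuffle keeps the order inside each block, so its inversions are the pairs consisting of a
position in \<open>I\<close> and an earlier position outside \<open>I\<close>.\<close>

lemma koszul_unshuffle:
  fixes ds :: "int list"
  assumes I: "I \<subseteq> {..<length ds}"
  shows "koszul (unshuffle I ({..<length ds} - I)) ds =
    (\<Prod>(p, q) \<in> {(p, q). p \<in> I \<and> q \<in> {..<length ds} - I \<and> q < p}. ksgn (ds ! p * ds ! q) :: 'k::comm_ring_1)"
proof -
  let ?n = "length ds"
  let ?J = "{..<?n} - I"
  let ?A = "sorted_list_of_set I" and ?B = "sorted_list_of_set ?J"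
  let ?L = "?A @ ?B"
  note L = unshuffle_list[OF I]
  have f: "finite I" using I finite_subset by blast
  have lA: "length ?A = card I" by simp
  have u: "unshuffle I ?J k = ?L ! k" if "k < ?n" for k
    using that L(3) by (simp add: unshuffle_def)
  let ?S = "{(a, b). a < b \<and> b < ?n \<and> ?L ! b < ?L ! a}"
  let ?T = "{(p, q). p \<in> I \<and> q \<in> ?J \<and> q < p}"
  have sub: "a < card I \<and> card I \<le> b" if "a < b" "b < ?n" "?L ! b < ?L ! a" for a b
  proof (rule ccontr)
    assume "\<not> ?thesis"
    then consider "b < card I" | "card I \<le> a" using that by linarith
    then show False
    proof cases
      case 1
      then have "?A ! a \<le> ?A ! b" using that(1) by (intro sorted_nth_mono) auto
      then show False using that 1 by (simp add: nth_append)
    next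
      case 2
      then have "?B ! (a - card I) \<le> ?B ! (b - card I)" using that L(3)
        by (intro sorted_nth_mono) (auto simp: )
      then show False using that 2 by (simp add: nth_append)
    qed
  qed
  have "bij_betw (\<lambda>(a, b). (?L ! a, ?L ! b)) ?S ?T"
    unfolding bij_betw_def
  proof
    show "inj_on (\<lambda>(a, b). (?L ! a, ?L ! b)) ?S"
      using L(1,4) by (auto simp: inj_on_def nth_eq_iff_index_eq)
    show "(\<lambda>(a, b). (?L ! a, ?L ! b)) ` ?S = ?T"
    proof (intro equalityI subsetI)
      fix z assume "z \<in> (\<lambda>(a, b). (?L ! a, ?L ! b)) ` ?S"
      then obtain a b where z: "z = (?L ! a, ?L ! b)" and ab: "a < b" "b < ?n" "?L ! b < ?L ! a"
        by auto
      note s = sub[OF ab]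
      have "?L ! a \<in> set ?A" using s by (simp add: nth_append del: set_sorted_list_of_set sorted_list_of_set.set_sorted_key_list_of_set)
      moreover have "?L ! b \<in> set ?B"
      proof -
        have "b - card I < length ?B" using s ab(2) L(3) unfolding sorted_list_of_set.length_sorted_key_list_of_set by linarith
        from nth_mem[OF this] show ?thesis using s by (simp only: nth_append lA) simp
      qed
      ultimately show "z \<in> ?T" using z ab f by auto
    next
      fix z assume "z \<in> ?T"
      then obtain p q where z: "z = (p, q)" and pq: "p \<in> set ?A" "q \<in> set ?B" "q < p"
        using f by auto
      obtain a where a: "a < length ?A" "p = ?A ! a" using pq(1) by (metis in_set_conv_nth)
      obtain b where b: "b < length ?B" "q = ?B ! b" using pq(2) by (metis in_set_conv_nth)
      have "(a, card I + b) \<in> ?S" using a b pq(3) L(3) by (simp add: nth_append)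
      moreover have "z = (?L ! a, ?L ! (card I + b))" using a b z by (simp add: nth_append)
      ultimately show "z \<in> (\<lambda>(a, b). (?L ! a, ?L ! b)) ` ?S"
        by (metis (no_types, lifting) case_prod_conv image_eqI)
    qed
  qed
  from prod.reindex_bij_betw[OF this, of "\<lambda>(p, q). ksgn (ds ! p * ds ! q) :: 'k"]
  have "(\<Prod>(a, b) \<in> ?S. ksgn (ds ! (?L ! a) * ds ! (?L ! b)) :: 'k) =
    (\<Prod>(p, q) \<in> ?T. ksgn (ds ! p * ds ! q))"
    by (simp add: case_prod_unfold)
  moreover have "koszul (unshuffle I ?J) ds = (\<Prod>(a, b) \<in> ?S. ksgn (ds ! (?L ! a) * ds ! (?L ! b)) :: 'k)"
    unfolding koszul_def
    by (rule prod.cong) (auto simp: u)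
  ultimately show ?thesis by simp
qed

definition ukoszul :: "int list \<Rightarrow> nat set \<Rightarrow> 'k::comm_ring_1" where
  "ukoszul ds I = koszul (unshuffle I ({..<length ds} - I)) ds"

lemma ukoszul_Nil [simp]: "ukoszul [] I = 1"
  by (simp add: ukoszul_def koszul_def)

lemma ukoszul_out:
  assumes I: "I \<subseteq> {..<length ds}"
  shows "ukoszul (ds @ [a]) I = ukoszul ds I"
proof -
  have I': "I \<subseteq> {..<length (ds @ [a])}" using I by auto
  show ?thesis
    unfolding ukoszul_def koszul_unshuffle[OF I] koszul_unshuffle[OF I']
    by (rule prod.cong) (use I in \<open>auto simp: nth_append\<close>)
qed

lemma sum_list_nths: "sum_list (nths ds I) = (\<Sum>i | i < length ds \<and> i \<in> I. ds ! i :: int)"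
proof (induction ds rule: rev_induct)
  case (snoc a ds)
  have 1: "{i. i < length (ds @ [a]) \<and> i \<in> I} =
     {i. i < length ds \<and> i \<in> I} \<union> (if length ds \<in> I then {length ds} else {})"
    by (auto simp: less_Suc_eq)
  have "(\<Sum>i | i < length ds \<and> i \<in> I. (ds @ [a]) ! i) = (\<Sum>i | i < length ds \<and> i \<in> I. ds ! i)"
    by (rule sum.cong) (auto simp: nth_append)
  then show ?case unfolding 1 using snoc by (subst sum.union_disjoint) (auto simp: nths_append)
qed simp

lemma ksgn_sum: "finite A \<Longrightarrow> ksgn (\<Sum>x \<in> A. f x) = (\<Prod>x \<in> A. ksgn (f x) :: 'k::comm_ring_1)"
  by (induction rule: finite_induct) (simp_all add: ksgn_add)

text \<open>To join the first block, the new letter has to pass all letters of the second one.\<close>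

lemma ukoszul_into:
  assumes I: "I \<subseteq> {..<length ds}"
  shows "ukoszul (ds @ [a]) (insert (length ds) I) =
    ukoszul ds I * ksgn (a * sum_list (nths ds ({..<length ds} - I)))"
proof -
  let ?n = "length ds"
  let ?J = "{..<?n} - I"
  have I': "insert ?n I \<subseteq> {..<length (ds @ [a])}" using I by auto
  have eq: "{(p, q). p \<in> insert ?n I \<and> q \<in> {..<length (ds @ [a])} - insert ?n I \<and> q < p} =
     {(p, q). p \<in> I \<and> q \<in> ?J \<and> q < p} \<union> Pair ?n ` ?J"
    using I by auto
  have fin: "finite {(p, q). p \<in> I \<and> q \<in> ?J \<and> q < p}"
    by (rule finite_subset[of _ "{..<?n} \<times> {..<?n}"]) (use I in auto)
  have 1: "(\<Prod>(p, q) \<in> {(p, q). p \<in> I \<and> q \<in> ?J \<and> q < p}. ksgn ((ds @ [a]) ! p * (ds @ [a]) ! q) :: 'a) =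
     (\<Prod>(p, q) \<in> {(p, q). p \<in> I \<and> q \<in> ?J \<and> q < p}. ksgn (ds ! p * ds ! q))"
    by (rule prod.cong) (use I in \<open>auto simp: nth_append\<close>)
  have 2: "(\<Prod>(p, q) \<in> Pair ?n ` ?J. ksgn ((ds @ [a]) ! p * (ds @ [a]) ! q) :: 'a) =
     ksgn (a * sum_list (nths ds ?J))"
  proof -
    have "(\<Prod>(p, q) \<in> Pair ?n ` ?J. ksgn ((ds @ [a]) ! p * (ds @ [a]) ! q) :: 'a) =
       (\<Prod>q \<in> ?J. ksgn (a * ds ! q))"
      by (subst prod.reindex) (auto simp: inj_on_def nth_append intro!: prod.cong)
    also have "\<dots> = ksgn (\<Sum>q \<in> ?J. a * ds ! q)" by (simp add: ksgn_sum)
    also have "(\<Sum>q \<in> ?J. a * ds ! q) = a * sum_list (nths ds ?J)"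
      unfolding sum_list_nths sum_distrib_left by (rule sum.cong) auto
    finally show ?thesis .
  qed
  show ?thesis
    unfolding ukoszul_def koszul_unshuffle[OF I] koszul_unshuffle[OF I'] eq
    by (subst prod.union_disjoint) (use fin 1 2 I in auto)
qed

text \<open>Together, the two unshuffles of a splitting compare each letter of one block with each letter of
the other block exactly once.\<close>

lemma ukoszul_compl:
  assumes "I \<subseteq> {..<length ds}"
  shows "ukoszul ds ({..<length ds} - I) =
    ukoszul ds I * (ksgn (sum_list (nths ds I) * sum_list (nths ds ({..<length ds} - I))) :: 'k::comm_ring_1)"
  using assms
proof (induction rule: snoc_subset_induct)
  case (out ds a I)
  then show ?case
    by (simp add: compl_out nths_snoc_out nths_snoc_into ukoszul_out ukoszul_into double_diff
        ksgn_add distrib_left mult_ac)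
next
  case (into ds a I)
  then show ?case
    by (simp add: compl_into nths_snoc_out nths_snoc_into ukoszul_out ukoszul_into
        ksgn_add distrib_right mult_ac)
qed simp

text \<open>The cycle that carries a new last position over the second block to the end of the first one.\<close>

definition insert_cycle :: "nat \<Rightarrow> nat \<Rightarrow> nat \<Rightarrow> nat" where
  "insert_cycle m n k = (if k = m then m + n else if m < k \<and> k \<le> m + n then k - 1 else k)"

lemma insert_cycle_Suc: "insert_cycle m (Suc n) = transpose (m + n) (m + Suc n) \<circ> insert_cycle m n"
  by (auto simp: insert_cycle_def transpose_def fun_eq_iff)

lemma insert_cycle_sign: "permutation (insert_cycle m n) \<and> sign (insert_cycle m n) = (- 1) ^ n"
proof (induction n)
  case 0
  have "insert_cycle m 0 = id" by (auto simp: insert_cycle_def fun_eq_iff)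
  then show ?case by simp
next
  case (Suc n)
  then show ?case unfolding insert_cycle_Suc
    by (auto intro: permutation_compose simp: sign_compose sign_swap_id permutation_swap_id
        simp del: o_apply comp_apply)
qed

lemma unshuffle_out:
  assumes "I \<subseteq> {..<n}"
  shows "unshuffle I ({..<Suc n} - I) = unshuffle I ({..<n} - I)"
proof -
  note L = unshuffle_list[OF assms]
  have "sorted_list_of_set (insert n ({..<n} - I)) = sorted_list_of_set ({..<n} - I) @ [n]"
    by (subst sorted_list_of_set_insert_remove) (auto intro!: sorted_insort_is_snoc simp: less_imp_le)
  moreover have "card (insert n ({..<n} - I)) = Suc (card ({..<n} - I))" by simp
  ultimately show ?thesis using L(3,4)
    unfolding compl_out[OF assms] unshuffle_def
    by (fastforce simp: fun_eq_iff nth_append)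
qed

lemma unshuffle_into:
  assumes "I \<subseteq> {..<n}"
  shows "unshuffle (insert n I) ({..<Suc n} - insert n I) =
    unshuffle I ({..<n} - I) \<circ> insert_cycle (card I) (n - card I)"
proof
  fix k
  let ?J = "{..<n} - I"
  have f: "finite I" using assms finite_subset by blast
  note L = unshuffle_list[OF assms]
  have n: "n \<notin> I" using assms by auto
  have 1: "sorted_list_of_set (insert n I) = sorted_list_of_set I @ [n]"
    using assms f n
    by (subst sorted_list_of_set_insert_remove) (auto intro!: sorted_insort_is_snoc simp: less_imp_le)
  have 2: "card (insert n I) = Suc (card I)" using f n by simp
  have le: "card I \<le> n" using L(3) by linarith
  show "unshuffle (insert n I) ({..<Suc n} - insert n I) k =
    (unshuffle I ({..<n} - I) \<circ> insert_cycle (card I) (n - card I)) k"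
    using L(3) le
    unfolding compl_into[OF assms] unshuffle_def 1 2 o_def insert_cycle_def
    by (auto simp: nth_append nth_Cons split: nat.split) (auto intro!: arg_cong[where f = "(!) _"])
qed

lemma sign_unshuffle:
  assumes "I \<subseteq> {..<n}"
  shows "permutation (unshuffle I ({..<n} - I))"
    and "sign (unshuffle (insert n I) ({..<Suc n} - insert n I)) =
      sign (unshuffle I ({..<n} - I)) * (- 1) ^ card ({..<n} - I)"
proof -
  show p: "permutation (unshuffle I ({..<n} - I))"
    using assms
  proof (induction n arbitrary: I)
    case 0
    have "unshuffle {} {} = id" by (auto simp: unshuffle_def fun_eq_iff)
    then show ?case using 0 by simp
  next
    case (Suc n)
    show ?case
    proof (cases "n \<in> I")
      case True
      then have I: "I = insert n (I - {n})" "I - {n} \<subseteq> {..<n}" using Suc.prems by auto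
      show ?thesis
        apply (subst I(1)) apply (subst (2) I(1))
        unfolding unshuffle_into[OF I(2)]
        by (intro permutation_compose Suc.IH I(2)) (simp add: insert_cycle_sign)
    next
      case False
      then have I: "I \<subseteq> {..<n}" using Suc.prems by (auto simp: less_Suc_eq)
      show ?thesis unfolding unshuffle_out[OF I] by (rule Suc.IH[OF I])
    qed
  qed
  have "n - card I = card ({..<n} - I)" using unshuffle_list(3)[OF assms] by linarith
  then show "sign (unshuffle (insert n I) ({..<Suc n} - insert n I)) =
      sign (unshuffle I ({..<n} - I)) * (- 1) ^ card ({..<n} - I)"
    unfolding unshuffle_into[OF assms] using p insert_cycle_sign by (simp add: sign_compose)
qed

text \<open>The Koszul sign of \<open>s\<^bsup>\<otimes>n\<^esup>\<close> on arguments whose degrees in the shifted space are \<open>ds\<close>.\<close>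

definition decal :: "int list \<Rightarrow> 'k::ring_1" where
  "decal ds = ksgn (\<Sum>j < length ds. sum_list (take j ds))"

lemma decal_Nil [simp]: "decal [] = 1"
  by (simp add: decal_def)

lemma decal_snoc: "decal (ds @ [a]) = decal ds * (ksgn (sum_list ds) :: 'k::ring_1)"
  by (simp add: decal_def ksgn_add)

lemma decal_square [simp]: "decal ds * decal ds = (1 :: 'k::ring_1)"
  by (simp add: decal_def)

lemma decal_nonzero [simp]: "decal ds \<noteq> (0 :: 'k::field_char_0)"
  by (simp add: decal_def)

lemma decal_single [simp]: "decal [a] = 1"
  by (simp add: decal_def)

lemma minus_one_power_ksgn: "(- 1) ^ n = (ksgn (int n) :: 'k::ring_1)"
  by (simp add: ksgn_def)

lemma sum_list_map_Suc: "sum_list (map (\<lambda>a. a + 1) as) = sum_list as + int (length as)"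
  by (induction as) simp_all

text \<open>The left side is the coefficient of a quadratic term in the unshifted degrees \<open>a\<^sub>i + 1\<close>. An inversion
contributes the exponent \<open>(a\<^sub>p + 1)(a\<^sub>q + 1) + 1\<close>, which differs from the exponent \<open>a\<^sub>p a\<^sub>q\<close> in shifted
degrees by \<open>a\<^sub>p + a\<^sub>q\<close> modulo \<open>2\<close>; the remaining pairs are accounted for by moving the inner
bracket past the first block. Altogether the difference is the failure of \<open>decal\<close> to be
multiplicative along the splitting.\<close>

lemma decalage_sign:
  assumes "I \<subseteq> {..<length as}"
  shows "of_int (sign (unshuffle I ({..<length as} - I))) *
      ksgn (int (card I * card ({..<length as} - I))) * ukoszul (map (\<lambda>a. a + 1) as) I *
      ksgn ((2 - int (card ({..<length as} - I))) * sum_list (nths (map (\<lambda>a. a + 1) as) I)) =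
    (ukoszul as I * decal as * decal (nths as I) * decal (nths as ({..<length as} - I)) :: 'k::field_char_0)"
  using assms
proof (induction rule: snoc_subset_induct)
  case Nil
  have "unshuffle {} {} = id" by (auto simp: unshuffle_def fun_eq_iff)
  then show ?case by simp
next
  case (out as a I)
  let ?n = "length as"
  let ?J = "{..<?n} - I"
  let ?b = "\<lambda>a::int. a + 1"
  have fI: "finite I" using out(1) finite_subset by blast
  have I: "I \<subseteq> {..<length (map ?b as)}" using out(1) by simp
  have s: "sum_list as = sum_list (nths as I) + sum_list (nths as ?J)"
    using sum_list_nths_compl[OF out(1)] by simp
  have e: "ksgn (int (card I * card (insert ?n ?J))) *
      ksgn ((2 - int (card (insert ?n ?J))) * sum_list (nths (map ?b as) I)) =
    ksgn (int (card I * card ?J)) * ksgn ((2 - int (card ?J)) * sum_list (nths (map ?b as) I)) *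
      (ksgn (sum_list (nths as I)) :: 'k)"
    unfolding nths_map sum_list_map_Suc length_nths_sub[OF out(1)] ksgn_add[symmetric]
    by (rule ksgn_cong) (auto simp: algebra_simps)
  have "of_int (sign (unshuffle I ({..<length (as @ [a])} - I))) *
      ksgn (int (card I * card ({..<length (as @ [a])} - I))) * ukoszul (map ?b (as @ [a])) I *
      ksgn ((2 - int (card ({..<length (as @ [a])} - I))) * sum_list (nths (map ?b (as @ [a])) I)) =
    of_int (sign (unshuffle I ?J)) * ukoszul (map ?b as) I *
     (ksgn (int (card I * card (insert ?n ?J))) *
      ksgn ((2 - int (card (insert ?n ?J))) * sum_list (nths (map ?b as) I)) :: 'k)"
    using ukoszul_out[OF I] nths_snoc_out[OF I]
    by (simp add: compl_out[OF out(1)] unshuffle_out[OF out(1), unfolded compl_out[OF out(1)]] mult_ac del: card_insert_disjoint)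
  also have "\<dots> = (ukoszul as I * decal as * decal (nths as I) * decal (nths as ?J)) * ksgn (sum_list (nths as I))"
    unfolding e out(2)[symmetric] by (simp only: mult_ac)
  also have "\<dots> = ukoszul (as @ [a]) I * decal (as @ [a]) * decal (nths (as @ [a]) I) *
     decal (nths (as @ [a]) ({..<length (as @ [a])} - I))"
    using out(1)
    by (simp add: compl_out nths_snoc_out nths_snoc_into ukoszul_out decal_snoc s ksgn_add mult_ac)
  finally show ?case .
next
  case (into as a I)
  let ?n = "length as"
  let ?J = "{..<?n} - I"
  let ?b = "\<lambda>a::int. a + 1"
  have fI: "finite I" "?n \<notin> I" using into(1) finite_subset by blast+
  have I: "I \<subseteq> {..<length (map ?b as)}" using into(1) by simp
  have J: "?J \<subseteq> {..<length as}" by auto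
  have s: "sum_list as = sum_list (nths as I) + sum_list (nths as ?J)"
    using sum_list_nths_compl[OF into(1)] by simp
  have e: "of_int ((- 1) ^ card ?J) * ksgn (int (card (insert ?n I) * card ?J)) *
      ksgn ((a + 1) * sum_list (nths (map ?b as) ?J)) *
      ksgn ((2 - int (card ?J)) * sum_list (nths (map ?b as) I @ [a + 1])) =
    ksgn (int (card I * card ?J)) * ksgn ((2 - int (card ?J)) * sum_list (nths (map ?b as) I)) *
      (ksgn (a * sum_list (nths as ?J)) * ksgn (sum_list (nths as ?J)) :: 'k)"
    unfolding minus_one_power_ksgn of_int_ksgn nths_map sum_list.append sum_list_map_Suc length_nths_sub[OF into(1)]
      length_nths_sub[OF J] ksgn_add[symmetric] using fI
    by (intro ksgn_cong) (auto simp: algebra_simps)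
  have "of_int (sign (unshuffle (insert ?n I) ({..<length (as @ [a])} - insert ?n I))) *
      ksgn (int (card (insert ?n I) * card ({..<length (as @ [a])} - insert ?n I))) *
      ukoszul (map ?b (as @ [a])) (insert ?n I) *
      ksgn ((2 - int (card ({..<length (as @ [a])} - insert ?n I))) *
        sum_list (nths (map ?b (as @ [a])) (insert ?n I))) =
    of_int (sign (unshuffle I ?J)) * ukoszul (map ?b as) I *
     (of_int ((- 1) ^ card ?J) * ksgn (int (card (insert ?n I) * card ?J)) *
      ksgn ((a + 1) * sum_list (nths (map ?b as) ?J)) *
      ksgn ((2 - int (card ?J)) * sum_list (nths (map ?b as) I @ [a + 1])) :: 'k)"
    using ukoszul_into[OF I] nths_snoc_into[OF I]
    by (simp add: compl_into[OF into(1)] sign_unshuffle(2)[OF into(1), unfolded compl_into[OF into(1)]]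
        mult_ac del: card_insert_disjoint)
  also have "\<dots> = (ukoszul as I * decal as * decal (nths as I) * decal (nths as ?J)) *
      (ksgn (a * sum_list (nths as ?J)) * ksgn (sum_list (nths as ?J)))"
    unfolding e into(2)[symmetric] by (simp only: mult_ac)
  also have "\<dots> = ukoszul (as @ [a]) (insert ?n I) * decal (as @ [a]) * decal (nths (as @ [a]) (insert ?n I)) *
     decal (nths (as @ [a]) ({..<length (as @ [a])} - insert ?n I))"
    using into(1)
    by (simp add: compl_into nths_snoc_out nths_snoc_into ukoszul_into decal_snoc s ksgn_add mult_ac)
  finally show ?case .
qed

section \<open>Graded symmetric functions on words\<close>

definition wdeg :: "('v \<Rightarrow> int) \<Rightarrow> 'v list \<Rightarrow> int" where
  "wdeg dg w = sum_list (map dg w)"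

lemma wdeg_simps [simp]: "wdeg dg [] = 0" "wdeg dg (x # w) = dg x + wdeg dg w"
  "wdeg dg (u @ w) = wdeg dg u + wdeg dg w"
  by (simp_all add: wdeg_def)

text \<open>The product of functions at words in letters of known degree. Fixing the degree of each letter
makes the algebra of words independent of any linear structure.\<close>

definition wmul :: "('v \<Rightarrow> int) \<Rightarrow> ('k::field_char_0, 'v) fn \<Rightarrow> ('k, 'v) fn \<Rightarrow> ('k, 'v) fn" where
  "wmul dg \<phi> \<psi> w = (\<Sum>I \<in> Pow {..<length w}.
     ukoszul (map dg w) ({..<length w} - I) * \<phi> (nths w I) * \<psi> (nths w ({..<length w} - I)))"

text \<open>The left partial derivative with respect to \<open>x\<close>. The new letter is placed at the end:
when it belongs to the right factor of a product, it then has to pass the letters of the left factor,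
which is the sign of the left Leibniz rule.\<close>

definition pder :: "'v \<Rightarrow> ('v list \<Rightarrow> 'w) \<Rightarrow> 'v list \<Rightarrow> 'w" where
  "pder x \<phi> w = \<phi> (w @ [x])"

definition twist :: "('v \<Rightarrow> int) \<Rightarrow> 'v \<Rightarrow> ('k::field_char_0, 'v) fn \<Rightarrow> ('k, 'v) fn" where
  "twist dg x \<phi> w = ksgn (dg x * wdeg dg w) * \<phi> w"

lemma wmul_Nil [simp]: "wmul dg \<phi> \<psi> [] = \<phi> [] * \<psi> []"
  by (simp add: wmul_def)

text \<open>The Leibniz rule for \<open>pder x\<close>, according to which factor receives the last letter. It determines
the product recursively.\<close>

lemma wmul_snoc:
  fixes \<phi> \<psi> :: "('k::field_char_0, 'v) fn"
  shows "wmul dg \<phi> \<psi> (w @ [x]) = wmul dg (pder x \<phi>) \<psi> w + wmul dg (twist dg x \<phi>) (pder x \<psi>) w"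
proof -
  let ?n = "length w"
  have 1: "ukoszul (map dg (w @ [x])) ({..<Suc ?n} - I) * \<phi> (nths (w @ [x]) I) *
      \<psi> (nths (w @ [x]) ({..<Suc ?n} - I)) =
     ukoszul (map dg w) ({..<?n} - I) * twist dg x \<phi> (nths w I) * pder x \<psi> (nths w ({..<?n} - I))"
    if I: "I \<subseteq> {..<?n}" for I
  proof -
    have J: "{..<?n} - I \<subseteq> {..<length (map dg w)}" "{..<?n} - I \<subseteq> {..<length w}" by auto
    show ?thesis
      using ukoszul_into[OF J(1), of "dg x", where 'a = 'k] I
      by (simp add: compl_out[OF I] nths_snoc_out[OF I] nths_snoc_into[OF J(2)] double_diff
          twist_def pder_def wdeg_def nths_map mult_ac)
  qed
  have 2: "ukoszul (map dg (w @ [x])) ({..<Suc ?n} - insert ?n I) * \<phi> (nths (w @ [x]) (insert ?n I)) *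
      \<psi> (nths (w @ [x]) ({..<Suc ?n} - insert ?n I)) =
     ukoszul (map dg w) ({..<?n} - I) * pder x \<phi> (nths w I) * \<psi> (nths w ({..<?n} - I))"
    if I: "I \<subseteq> {..<?n}" for I
  proof -
    have J: "{..<?n} - I \<subseteq> {..<length (map dg w)}" "{..<?n} - I \<subseteq> {..<length w}" by auto
    show ?thesis
      using ukoszul_out[OF J(1), of "dg x", where 'a = 'k] I
      by (simp add: compl_into[OF I] nths_snoc_into[OF I] nths_snoc_out[OF J(2)] pder_def)
  qed
  show ?thesis
    unfolding wmul_def length_append_singleton sum_Pow_Suc
    by (subst add.commute, intro arg_cong2[where f = "(+)"] sum.cong refl) (simp_all only: 1 2 Pow_iff)
qed

lemma wmul_cong:
  assumes "\<And>u. set u \<subseteq> set w \<Longrightarrow> length u \<le> length w \<Longrightarrow> \<phi> u = \<phi>' u"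
    and "\<And>u. set u \<subseteq> set w \<Longrightarrow> length u \<le> length w \<Longrightarrow> \<psi> u = \<psi>' u"
  shows "wmul dg \<phi> \<psi> w = wmul dg \<phi>' \<psi>' w"
proof -
  have "\<phi> (nths w I) = \<phi>' (nths w I)" "\<psi> (nths w I) = \<psi>' (nths w I)" for I
    using card_mono[of "{..<length w}" "{i. i < length w \<and> i \<in> I}"]
    by (intro assms set_nths_subset; simp add: length_nths subset_eq)+
  then show ?thesis by (simp add: wmul_def)
qed

text \<open>A left factor without constant term consumes at least one letter. This is what makes inductions
along powers of the ideal of \<open>0\<close> work.\<close>

lemma wmul_cong_ideal:
  assumes "\<phi> [] = 0"
    and "\<And>u. set u \<subseteq> set w \<Longrightarrow> length u < length w \<Longrightarrow> \<psi> u = \<psi>' u"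
  shows "wmul dg \<phi> \<psi> w = wmul dg \<phi> \<psi>' w"
  unfolding wmul_def
proof (rule sum.cong)
  fix I assume I: "I \<in> Pow {..<length w}"
  show "ukoszul (map dg w) ({..<length w} - I) * \<phi> (nths w I) * \<psi> (nths w ({..<length w} - I)) =
    ukoszul (map dg w) ({..<length w} - I) * \<phi> (nths w I) * \<psi>' (nths w ({..<length w} - I))"
  proof (cases "I = {}")
    case False
    have f: "finite I" using I finite_subset by auto
    have "card ({..<length w} - I) < length w"
      using False f I card_gt_0_iff[of I] unshuffle_list(3)[of I "length w"] by auto
    then have "\<psi> (nths w ({..<length w} - I)) = \<psi>' (nths w ({..<length w} - I))"
      by (intro assms set_nths_subset) (subst length_nths_sub; auto)
    then show ?thesis by simp
  qed (use assms(1) in simp)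
qed simp

lemma wmul_add_left: "wmul dg (\<phi> + \<phi>') \<psi> = wmul dg \<phi> \<psi> + wmul dg \<phi>' \<psi>"
  by (simp add: wmul_def fun_eq_iff algebra_simps sum.distrib)

lemma wmul_add_right: "wmul dg \<phi> (\<psi> + \<psi>') = wmul dg \<phi> \<psi> + wmul dg \<phi> \<psi>'"
  by (simp add: wmul_def fun_eq_iff algebra_simps sum.distrib)

lemma wmul_scale_left: "wmul dg (fscale c \<phi>) \<psi> = fscale c (wmul dg \<phi> \<psi>)"
  by (simp add: wmul_def fscale_def fun_eq_iff sum_distrib_left mult_ac)

lemma wmul_scale_right: "wmul dg \<phi> (fscale c \<psi>) = fscale c (wmul dg \<phi> \<psi>)"
  by (simp add: wmul_def fscale_def fun_eq_iff sum_distrib_left mult_ac)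

lemma wmul_zero_left [simp]: "wmul dg 0 \<psi> = 0"
  by (simp add: wmul_def fun_eq_iff)

lemma wmul_zero_right [simp]: "wmul dg \<phi> 0 = 0"
  by (simp add: wmul_def fun_eq_iff)

lemma twist_wmul:
  fixes \<phi> \<psi> :: "('k::field_char_0, 'v) fn"
  shows "twist dg x (wmul dg \<phi> \<psi>) = wmul dg (twist dg x \<phi>) (twist dg x \<psi>)"
proof
  fix w
  have "ksgn (dg x * wdeg dg w) = (ksgn (dg x * wdeg dg (nths w I)) *
    ksgn (dg x * wdeg dg (nths w ({..<length w} - I))) :: 'k)" if "I \<subseteq> {..<length w}" for I
    using sum_list_nths_compl[of I "map dg w"] that
    by (simp add: wdeg_def nths_map flip: ksgn_add distrib_left)
  then show "twist dg x (wmul dg \<phi> \<psi>) w = wmul dg (twist dg x \<phi>) (twist dg x \<psi>) w"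
    unfolding twist_def wmul_def sum_distrib_left
    by (intro sum.cong) (simp_all add: mult_ac)
qed

lemma pder_wmul: "pder x (wmul dg \<phi> \<psi>) = wmul dg (pder x \<phi>) \<psi> + wmul dg (twist dg x \<phi>) (pder x \<psi>)"
  by (simp add: pder_def wmul_snoc fun_eq_iff)

lemma pder_twist: "pder y (twist dg x \<phi>) = fscale (ksgn (dg x * dg y)) (twist dg x (pder y \<phi>))"
  by (simp add: pder_def twist_def fscale_def fun_eq_iff distrib_left ksgn_add mult_ac)

lemma wmul_assoc: "wmul dg (wmul dg \<phi> \<psi>) \<chi> w = wmul dg \<phi> (wmul dg \<psi> \<chi>) w"
proof (induction w arbitrary: \<phi> \<psi> \<chi> rule: rev_induct)
  case (snoc x w)
  show ?case
    by (simp add: wmul_snoc pder_wmul twist_wmul wmul_add_left wmul_add_right snoc add.assoc)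
qed simp

lemma wmul_one_left [simp]:
  fixes \<psi> :: "('k::field_char_0, 'v) fn"
  shows "wmul dg fone \<psi> = \<psi>"
proof
  show "wmul dg fone \<psi> w = \<psi> w" for w
  proof (induction w arbitrary: \<psi> rule: rev_induct)
    case (snoc x w)
    have "pder x fone = (0 :: ('k, 'v) fn)" "twist dg x fone = (fone :: ('k, 'v) fn)"
      by (auto simp: pder_def twist_def fone_def fun_eq_iff)
    then show ?case by (simp add: wmul_snoc snoc pder_def)
  qed (simp add: fone_def)
qed

lemma wmul_one_right [simp]:
  fixes \<phi> :: "('k::field_char_0, 'v) fn"
  shows "wmul dg \<phi> fone = \<phi>"
proof
  show "wmul dg \<phi> fone w = \<phi> w" for w
  proof (induction w arbitrary: \<phi> rule: rev_induct)
    case (snoc x w)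
    have "pder x fone = (0 :: ('k, 'v) fn)"
      by (auto simp: pder_def fone_def fun_eq_iff)
    then show ?case by (simp add: wmul_snoc snoc pder_def)
  qed (simp add: fone_def)
qed

text \<open>Interchanging the two blocks of each splitting changes the sign as in \<open>ukoszul_compl\<close>. Stating the
total sign as a hypothesis covers both homogeneous factors and an even left factor with an
arbitrary, possibly inhomogeneous right factor.\<close>

lemma wmul_commute:
  fixes \<phi> \<psi> :: "('k::field_char_0, 'v) fn"
  assumes "\<And>u v. set u \<subseteq> set w \<Longrightarrow> set v \<subseteq> set w \<Longrightarrow> \<phi> u \<noteq> 0 \<Longrightarrow> \<psi> v \<noteq> 0 \<Longrightarrow>
     ksgn (wdeg dg u * wdeg dg v) = c"
  shows "wmul dg \<phi> \<psi> w = c * wmul dg \<psi> \<phi> w"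
proof -
  let ?n = "length w"
  have "wmul dg \<psi> \<phi> w = (\<Sum>I \<in> Pow {..<?n}.
     ukoszul (map dg w) ({..<?n} - ({..<?n} - I)) * \<psi> (nths w ({..<?n} - I)) *
       \<phi> (nths w ({..<?n} - ({..<?n} - I))))"
    unfolding wmul_def
    by (rule sum_Pow_compl[of "\<lambda>I. ukoszul (map dg w) ({..<?n} - I) * \<psi> (nths w I) *
       \<phi> (nths w ({..<?n} - I))", symmetric])
  also have "\<dots> = (\<Sum>I \<in> Pow {..<?n}. ukoszul (map dg w) I * \<psi> (nths w ({..<?n} - I)) * \<phi> (nths w I))"
    by (rule sum.cong) (auto simp: double_diff)
  finally have "c * wmul dg \<psi> \<phi> w =
    (\<Sum>I \<in> Pow {..<?n}. c * (ukoszul (map dg w) I * \<psi> (nths w ({..<?n} - I)) * \<phi> (nths w I)))"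
    by (simp add: sum_distrib_left)
  also have "\<dots> = wmul dg \<phi> \<psi> w" unfolding wmul_def
  proof (rule sum.cong)
    fix I assume "I \<in> Pow {..<?n}"
    then have I: "I \<subseteq> {..<length (map dg w)}" by simp
    show "c * (ukoszul (map dg w) I * \<psi> (nths w ({..<?n} - I)) * \<phi> (nths w I)) =
      ukoszul (map dg w) ({..<?n} - I) * \<phi> (nths w I) * \<psi> (nths w ({..<?n} - I))"
    proof (cases "\<phi> (nths w I) = 0 \<or> \<psi> (nths w ({..<?n} - I)) = 0")
      case False
      then have "c = ksgn (wdeg dg (nths w I) * wdeg dg (nths w ({..<?n} - I)))"
        using assms set_nths_subset by metis
      then show ?thesis using ukoszul_compl[OF I, where 'k = 'k]
        by (simp add: wdeg_def nths_map)
    qed auto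
  qed simp
  finally show ?thesis by simp
qed

definition wsym :: "('v \<Rightarrow> int) \<Rightarrow> 'v set \<Rightarrow> ('k::field_char_0, 'v) fn \<Rightarrow> bool" where
  "wsym dg B \<phi> \<longleftrightarrow> (\<forall>us ws x y. us \<in> lists B \<longrightarrow> ws \<in> lists B \<longrightarrow> x \<in> B \<longrightarrow> y \<in> B \<longrightarrow>
     \<phi> (us @ [x, y] @ ws) = ksgn (dg x * dg y) * \<phi> (us @ [y, x] @ ws))"

lemma wsym_pder:
  assumes "wsym dg B \<phi>" "x \<in> B" shows "wsym dg B (pder x \<phi>)"
  unfolding wsym_def pder_def
proof (intro allI impI)
  fix us ws a b assume "us \<in> lists B" "ws \<in> lists B" "a \<in> B" "b \<in> B"
  then show "\<phi> ((us @ [a, b] @ ws) @ [x]) = ksgn (dg a * dg b) * \<phi> ((us @ [b, a] @ ws) @ [x])"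
    using assms(1)[unfolded wsym_def, rule_format, of us "ws @ [x]" a b] assms(2) by simp
qed

lemma wsym_twist:
  assumes "wsym dg B \<phi>" shows "wsym dg B (twist dg x \<phi>)"
  unfolding wsym_def twist_def
proof (intro allI impI)
  fix us ws a b assume "us \<in> lists B" "ws \<in> lists B" "a \<in> B" "b \<in> B"
  then have "\<phi> (us @ [a, b] @ ws) = ksgn (dg a * dg b) * \<phi> (us @ [b, a] @ ws)"
    using assms(1)[unfolded wsym_def] by blast
  moreover have "wdeg dg (us @ [a, b] @ ws) = wdeg dg (us @ [b, a] @ ws)" by simp
  ultimately show "ksgn (dg x * wdeg dg (us @ [a, b] @ ws)) * \<phi> (us @ [a, b] @ ws) =
    ksgn (dg a * dg b) * (ksgn (dg x * wdeg dg (us @ [b, a] @ ws)) * \<phi> (us @ [b, a] @ ws))"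
    by (simp only: mult_ac)
qed

lemma pder_pder_wsym:
  assumes "wsym dg B \<phi>" "x \<in> B" "y \<in> B" "us \<in> lists B"
  shows "pder x (pder y \<phi>) us = ksgn (dg x * dg y) * pder y (pder x \<phi>) us"
  using assms(1)[unfolded wsym_def, rule_format, of us "[]" x y] assms(2-) by (simp add: pder_def)

text \<open>Letters to the right of the transposed pair are stripped off by the Leibniz rule. For a pair at
the end, the two mixed second derivatives are interchanged, and the pure ones are symmetric
because the factors are.\<close>

lemma wsym_wmul:
  assumes "wsym dg B \<phi>" "wsym dg B \<psi>" shows "wsym dg B (wmul dg \<phi> \<psi>)"
  unfolding wsym_def
proof (intro allI impI)
  fix us ws x y assume us: "us \<in> lists B" and "ws \<in> lists B" and x: "x \<in> B" and y: "y \<in> B"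
  from this(2) show "wmul dg \<phi> \<psi> (us @ [x, y] @ ws) = ksgn (dg x * dg y) * wmul dg \<phi> \<psi> (us @ [y, x] @ ws)"
    using assms
  proof (induction ws arbitrary: \<phi> \<psi> rule: rev_induct)
    case Nil
    have sub: "u \<in> lists B" if "set u \<subseteq> set us" for u using us that by auto
    have "wmul dg (pder x (pder y \<phi>)) \<psi> us = wmul dg (fscale (ksgn (dg x * dg y)) (pder y (pder x \<phi>))) \<psi> us"
      by (rule wmul_cong) (auto simp: fscale_def pder_pder_wsym[OF Nil(2) x y] sub)
    moreover have "wmul dg (twist dg x (twist dg y \<phi>)) (pder x (pder y \<psi>)) us =
      wmul dg (twist dg y (twist dg x \<phi>)) (fscale (ksgn (dg x * dg y)) (pder y (pder x \<psi>))) us"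
      by (rule wmul_cong) (auto simp: fscale_def pder_pder_wsym[OF Nil(3) x y] sub twist_def)
    moreover have E: "wmul dg \<phi> \<psi> (us @ [x, y]) =
      wmul dg (pder x (pder y \<phi>)) \<psi> us + wmul dg (twist dg x (pder y \<phi>)) (pder x \<psi>) us +
      (ksgn (dg y * dg x) * wmul dg (twist dg y (pder x \<phi>)) (pder y \<psi>) us +
       wmul dg (twist dg x (twist dg y \<phi>)) (pder x (pder y \<psi>)) us)" for x y
      using wmul_snoc[of dg \<phi> \<psi> "us @ [x]" y]
      by (simp add: wmul_snoc pder_twist wmul_scale_left fscale_def)
    ultimately show ?case
      using E[of x y] E[of y x]
      by (simp add: wmul_scale_left wmul_scale_right fscale_def distrib_left mult.commute[of "dg y"])
  next
    case (snoc z ws)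
    then have z: "z \<in> B" "ws \<in> lists B" by auto
    note IH = snoc.IH[OF z(2)]
    have "wmul dg \<phi> \<psi> (us @ [a, b] @ ws @ [z]) = wmul dg (pder z \<phi>) \<psi> (us @ [a, b] @ ws) +
       wmul dg (twist dg z \<phi>) (pder z \<psi>) (us @ [a, b] @ ws)" for a b
      using wmul_snoc[of dg \<phi> \<psi> "us @ [a, b] @ ws" z] by simp
    then show ?case
      using IH[OF wsym_pder[OF snoc(3) z(1)] snoc(4)] IH[OF wsym_twist[OF snoc(3)] wsym_pder[OF snoc(4) z(1)]]
      by (simp add: distrib_left)
  qed
qed

definition letter :: "'v \<Rightarrow> ('k::field_char_0, 'v) fn" where
  "letter b w = (if w = [b] then 1 else 0)"

lemma wmul_letter_cong:
  assumes "\<And>u. set u \<subseteq> set w \<Longrightarrow> Suc (length u) = length w \<Longrightarrow> \<psi> u = \<psi>' u"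
  shows "wmul dg (letter b) \<psi> w = wmul dg (letter b) \<psi>' w"
  unfolding wmul_def
proof (rule sum.cong)
  fix I assume "I \<in> Pow {..<length w}"
  then have I: "I \<subseteq> {..<length w}" by simp
  show "ukoszul (map dg w) ({..<length w} - I) * letter b (nths w I) * \<psi> (nths w ({..<length w} - I)) =
    ukoszul (map dg w) ({..<length w} - I) * letter b (nths w I) * \<psi>' (nths w ({..<length w} - I))"
  proof (cases "nths w I = [b]")
    case True
    then have "card I = 1" using length_nths_sub[OF I] by simp
    then have "Suc (card ({..<length w} - I)) = length w" using unshuffle_list(3)[OF I] by simp
    then have "\<psi> (nths w ({..<length w} - I)) = \<psi>' (nths w ({..<length w} - I))"
      by (intro assms set_nths_subset) (subst length_nths_sub; auto)
    then show ?thesis by simp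
  qed (simp add: letter_def)
qed simp

lemma pder_letter: "pder y (letter b) = (if y = b then fone else 0)"
  by (auto simp: pder_def letter_def fone_def fun_eq_iff)

lemma twist_letter: "twist dg y (letter b) = fscale (ksgn (dg y * dg b)) (letter b)"
  by (auto simp: twist_def letter_def fscale_def fun_eq_iff)

text \<open>The Euler field acts on words of length \<open>n\<close> as multiplication by \<open>n\<close>: applying \<open>pder y\<close> to it
yields \<open>pder y\<close> once more from the coordinate of \<open>y\<close>, and otherwise commutes with it up to signs
that cancel.\<close>

lemma euler_words:
  assumes "finite B" "wsym dg B \<phi>" "w \<in> lists B"
  shows "(\<Sum>b \<in> B. wmul dg (letter b) (pder b \<phi>) w) = of_nat (length w) * \<phi> w"
  using assms(2,3)
proof (induction w arbitrary: \<phi> rule: rev_induct)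
  case Nil
  then show ?case by (simp add: letter_def)
next
  case (snoc y w)
  then have y: "y \<in> B" "w \<in> lists B" by auto
  have sub: "u \<in> lists B" if "set u \<subseteq> set w" for u using y that by auto
  have "wmul dg (letter b) (pder b \<phi>) (w @ [y]) =
     (if y = b then \<phi> (w @ [b]) else 0) + wmul dg (letter b) (pder b (pder y \<phi>)) w" if b: "b \<in> B" for b
  proof -
    have "wmul dg (letter b) (pder y (pder b \<phi>)) w =
       wmul dg (letter b) (fscale (ksgn (dg y * dg b)) (pder b (pder y \<phi>))) w"
      by (rule wmul_cong) (auto simp: fscale_def pder_pder_wsym[OF snoc(2) y(1) b] sub)
    then have "ksgn (dg y * dg b) * wmul dg (letter b) (pder y (pder b \<phi>)) w =
       wmul dg (letter b) (pder b (pder y \<phi>)) w"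
      by (simp add: wmul_scale_right fscale_def)
    then show ?thesis
      by (simp add: wmul_snoc pder_letter twist_letter wmul_scale_left fscale_def) (simp add: pder_def)
  qed
  then have "(\<Sum>b \<in> B. wmul dg (letter b) (pder b \<phi>) (w @ [y])) =
     (\<Sum>b \<in> B. if y = b then \<phi> (w @ [b]) else 0) + (\<Sum>b \<in> B. wmul dg (letter b) (pder b (pder y \<phi>)) w)"
    by (simp add: sum.distrib)
  also have "\<dots> = \<phi> (w @ [y]) + of_nat (length w) * pder y \<phi> w"
    using assms(1) y snoc.IH[OF wsym_pder[OF snoc(2) y(1)] y(2)] by simp
  finally show ?case unfolding pder_def[of y \<phi>] by (simp add: distrib_right)
qed

section \<open>Multilinear maps and homogeneous bases\<close>

definition lin :: "('k, 'v::ab_group_add) gvs \<Rightarrow> ('k, 'w::ab_group_add) gvs \<Rightarrow> ('v \<Rightarrow> 'w) \<Rightarrow> bool" where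
  "lin X h f \<longleftrightarrow> (\<forall>x y. f (x + y) = f x + f y) \<and> (\<forall>c x. f (smul X c x) = smul h c (f x))"

definition mlin :: "('k, 'v::ab_group_add) gvs \<Rightarrow> ('k, 'w::ab_group_add) gvs \<Rightarrow> ('v list \<Rightarrow> 'w) \<Rightarrow> bool" where
  "mlin X h F \<longleftrightarrow> (\<forall>us vs. lin X h (\<lambda>x. F (us @ x # vs)))"

text \<open>The condition under which \<open>hext\<close> produces a multilinear map: the formula is linear in each argument
when the degrees are kept fixed, although its signs depend on them.\<close>

definition hmlin ::
  "('k, 'v::ab_group_add) gvs \<Rightarrow> ('k, 'w::ab_group_add) gvs \<Rightarrow> (int list \<Rightarrow> 'v list \<Rightarrow> 'w) \<Rightarrow> bool" where
  "hmlin X h \<Phi> \<longleftrightarrow> (\<forall>ds us vs. length ds = Suc (length us + length vs) \<longrightarrow>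
     lin X h (\<lambda>x. \<Phi> ds (us @ x # vs)))"

lemma lin_zero: "lin X h f \<Longrightarrow> f 0 = 0"
  unfolding lin_def by (metis add_cancel_right_left add_0)

lemma lin_sum:
  assumes "lin X h f"
  shows "f (\<Sum>b \<in> A. smul X (c b) (v b)) = (\<Sum>b \<in> A. smul h (c b) (f (v b)))"
proof (cases "finite A")
  case True
  then show ?thesis
    by induction (use assms lin_zero[OF assms] in \<open>auto simp: lin_def\<close>)
qed (use lin_zero[OF assms] in simp)

lemma vs_ground: "vector_space (smul (ground :: ('k::field_char_0, 'k) gvs))"
  by unfold_locales (auto simp: ground_def algebra_simps)

lemma smul_ground [simp]: "smul ground c x = c * x"
  by (simp add: ground_def)

lemma gr_ground: "x \<in> gr ground i \<longleftrightarrow> (i \<noteq> 0 \<longrightarrow> x = 0)"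
  by (simp add: ground_def)

lemma multilinear_iff:
  assumes "vector_space (smul X)" "vector_space (smul h)"
  shows "multilinear X h (F :: 'v::ab_group_add list \<Rightarrow> 'w::ab_group_add) \<longleftrightarrow> mlin X h F"
proof
  assume m: "multilinear X h F"
  show "mlin X h F"
    unfolding mlin_def
  proof (intro allI)
    fix us vs :: "'v list"
    have "Vector_Spaces.linear (smul X) (smul h) (\<lambda>x. F ((us @ 0 # vs)[length us := x]))"
      using m unfolding multilinear_def by (metis add_Suc_right length_Cons length_append less_add_Suc1)
    from Vector_Spaces.linear_iff[THEN iffD1, OF this] show "lin X h (\<lambda>x. F (us @ x # vs))"
      unfolding lin_def by simp
  qed
next
  assume m: "mlin X h F"
  show "multilinear X h F"
    unfolding multilinear_def
  proof (intro allI impI)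
    fix xs :: "'v list" and i assume "i < length xs"
    then have "F (xs[i := x]) = F (take i xs @ x # drop (Suc i) xs)" for x
      by (simp add: upd_conv_take_nth_drop)
    then show "Vector_Spaces.linear (smul X) (smul h) (\<lambda>x. F (xs[i := x]))"
      using m assms unfolding Vector_Spaces.linear_iff lin_def mlin_def by simp
  qed
qed

lemma mlin_prefix: "mlin X h F \<Longrightarrow> mlin X h (\<lambda>vs. F (us @ vs))"
  unfolding mlin_def by (simp add: append_assoc[symmetric] del: append_assoc)

lemma mlin_suffix: "mlin X h F \<Longrightarrow> mlin X h (\<lambda>vs. F (vs @ ws))"
  unfolding mlin_def by simp

lemma mlin_zero: "mlin X h F \<Longrightarrow> 0 \<in> set xs \<Longrightarrow> F xs = 0"
  unfolding mlin_def by (metis lin_zero split_list)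

lemma lin_diff_scale:
  assumes "vector_space (smul h)" "lin X h f" "lin X h f'"
  shows "lin X h (\<lambda>x. f x - smul h c (f' x))"
proof -
  interpret h: vector_space "smul h" by fact
  show ?thesis using assms(2,3)
    by (simp add: lin_def h.scale_right_distrib h.scale_right_diff_distrib h.scale_left_commute)
qed

lemma lin_scale:
  assumes "vector_space (smul h)" "lin X h f"
  shows "lin X h (\<lambda>x. smul h c (f x))"
proof -
  interpret h: vector_space "smul h" by fact
  show ?thesis using assms(2)
    by (simp add: lin_def h.scale_right_distrib h.scale_left_commute)
qed

lemma lin_sum_fun:
  assumes "vector_space (smul h)" "\<And>i. i \<in> A \<Longrightarrow> lin X h (f i)"
  shows "lin X h (\<lambda>x. \<Sum>i \<in> A. f i x)"
proof -
  interpret h: vector_space "smul h" by fact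
  show ?thesis using assms(2)
    by (simp add: lin_def h.scale_sum_right flip: sum.distrib)
qed

lemma mlin_diff_scale:
  "vector_space (smul h) \<Longrightarrow> mlin X h F \<Longrightarrow> mlin X h F' \<Longrightarrow> mlin X h (\<lambda>x. F x - smul h c (F' x))"
  unfolding mlin_def by (intro allI lin_diff_scale) auto

locale gspace =
  fixes X :: "('k::field_char_0, 'v::ab_group_add) gvs" and es :: "'v list"
  assumes gs: "graded_space X" and hb: "homogeneous_basis X es"
begin

sublocale vs: vector_space "smul X"
  using gs by (simp add: graded_space_def)

abbreviation "B \<equiv> set es"
abbreviation "dg \<equiv> hdeg X"
abbreviation "rep \<equiv> vs.representation B"

lemma indep: "vs.independent B" and span_B: "vs.span B = UNIV"
  using hb by (auto simp: homogeneous_basis_def)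

lemma rep_sum: "(\<Sum>b \<in> B. smul X (rep v b) b) = v"
  by (rule vs.sum_representation_eq) (use indep span_B in auto)

lemma rep_add: "rep (u + v) b = rep u b + rep v b"
  using vs.representation_add[OF indep] span_B by simp

lemma rep_scale: "rep (smul X c v) b = c * rep v b"
  using vs.representation_scale[OF indep] span_B by simp

lemma rep_basis: "a \<in> B \<Longrightarrow> rep a b = (if b = a then 1 else 0)"
  using vs.representation_basis[OF indep] by simp

lemma rep_zero [simp]: "rep 0 b = 0"
  by (simp add: vs.representation_zero)

lemma rep_sum_fun: "rep (\<Sum>i \<in> A. f i) b = (\<Sum>i \<in> A. rep (f i) b)"
  by (simp add: vs.representation_sum[OF indep] span_B)

lemma rep_eqI: "(\<And>b. b \<in> B \<Longrightarrow> rep u b = rep v b) \<Longrightarrow> u = v"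
  using rep_sum by (metis (no_types, lifting) sum.cong)

lemma rep_comb: "b \<in> B \<Longrightarrow> rep (\<Sum>a \<in> B. smul X (c a) a) b = c b"
  by (simp add: rep_sum_fun rep_scale rep_basis if_distrib[of "(*) _"] cong: if_cong sum.cong)

lemma lin_rep: "lin X ground (\<lambda>v. rep v b)"
  by (simp add: lin_def rep_add rep_scale)

lemma lin_expand: "lin X h f \<Longrightarrow> f v = (\<Sum>b \<in> B. smul h (rep v b) (f b))"
  using lin_sum[of X h f "rep v" "\<lambda>b. b" B] rep_sum[of v] by simp

lemma gr_subspace: "vs.subspace (gr X i)"
  using gs by (simp add: graded_space_def)

lemmas gr_zero [simp] = vs.subspace_0[OF gr_subspace]
  and gr_add = vs.subspace_add[OF gr_subspace]
  and gr_scale = vs.subspace_scale[OF gr_subspace]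
  and gr_neg = vs.subspace_neg[OF gr_subspace]
  and gr_sum = vs.subspace_sum[OF gr_subspace]

lemma component_unique: "decomposition X v c \<Longrightarrow> component X i v = c i"
  unfolding component_def using gs
  by (metis (no_types, lifting) graded_space_def the1_equality)

lemma component_homog:
  assumes "x \<in> gr X i" shows "component X j x = (if j = i then x else 0)"
proof (rule component_unique)
  have "{ia. ia = i \<and> x \<noteq> 0} = (if x = 0 then {} else {i})" by auto
  then show "decomposition X x (\<lambda>j. if j = i then x else 0)"
    using assms by (auto simp: decomposition_def)
qed

lemma gr_unique: "x \<in> gr X i \<Longrightarrow> x \<in> gr X j \<Longrightarrow> x \<noteq> 0 \<Longrightarrow> i = j"
  using component_homog by metis

lemma hdeg_eq: "x \<in> gr X i \<Longrightarrow> x \<noteq> 0 \<Longrightarrow> hdeg X x = i"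
  unfolding hdeg_def using gr_unique by blast

lemma basis_nonzero: "b \<in> B \<Longrightarrow> b \<noteq> 0"
  using indep vs.dependent_zero by auto

lemma basis_gr: "b \<in> B \<Longrightarrow> b \<in> gr X (dg b)"
  using hb basis_nonzero hdeg_eq unfolding homogeneous_basis_def by metis

lemma component_eq: "component X i v = (\<Sum>b \<in> B. if dg b = i then smul X (rep v b) b else 0)"
proof (rule component_unique)
  let ?c = "\<lambda>i. \<Sum>b \<in> B. if dg b = i then smul X (rep v b) b else 0"
  have sub: "{i. ?c i \<noteq> 0} \<subseteq> dg ` B"
  proof (rule subsetI, rule ccontr)
    fix i assume "i \<in> {i. ?c i \<noteq> 0}" "i \<notin> dg ` B"
    moreover from this(2) have "?c i = 0" by (intro sum.neutral) auto
    ultimately show False by simp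
  qed
  have "(\<Sum>i | ?c i \<noteq> 0. ?c i) = (\<Sum>i \<in> dg ` B. ?c i)"
    by (rule sum.mono_neutral_left) (use sub in auto)
  also have "\<dots> = (\<Sum>b \<in> B. \<Sum>i \<in> dg ` B. if dg b = i then smul X (rep v b) b else 0)"
    by (rule sum.swap)
  also have "\<dots> = v" by (simp add: rep_sum cong: sum.cong)
  finally have "v = (\<Sum>i | ?c i \<noteq> 0. ?c i)" by simp
  moreover have "?c i \<in> gr X i" for i
    by (rule gr_sum) (auto intro!: gr_scale basis_gr)
  moreover have "finite {i. ?c i \<noteq> 0}" using finite_subset[OF sub] by simp
  ultimately show "decomposition X v ?c" unfolding decomposition_def by blast
qed

lemma component_gr: "component X i v \<in> gr X i"
  unfolding component_eq by (rule gr_sum) (auto intro!: gr_scale basis_gr)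

lemma lin_component: "lin X X (component X i)"
  unfolding component_eq lin_def
  by (auto simp: rep_add rep_scale vs.scale_left_distrib vs.scale_sum_right
      simp flip: sum.distrib intro!: sum.cong)

lemma component_support: "i \<notin> dg ` B \<Longrightarrow> component X i v = 0"
  unfolding component_eq by (rule sum.neutral) auto

lemma rep_homog:
  assumes "x \<in> gr X i" "b \<in> B" "rep x b \<noteq> 0" shows "dg b = i"
proof -
  have "rep (component X i x) b = (\<Sum>a \<in> B. if dg a = i then rep x a * rep a b else 0)"
    unfolding component_eq rep_sum_fun
    by (intro sum.cong) (auto simp: rep_scale)
  also have "\<dots> = (\<Sum>a \<in> B. if a = b then (if dg b = i then rep x b else 0) else 0)"
    by (intro sum.cong) (auto simp: rep_basis)
  also have "\<dots> = (if dg b = i then rep x b else 0)" using assms(2) by simp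
  finally show ?thesis using component_homog[OF assms(1), of i] assms(3) by (auto split: if_splits)
qed

lemma homog_Nil [simp]: "homog X [] []" by (simp add: homog_def)

lemma homog_basis: "w \<in> lists B \<Longrightarrow> homog X (map dg w) w"
  unfolding homog_def using basis_gr by (auto simp: list_all2_conv_all_nth)

text \<open>The arguments are expanded in the basis one after the other, from left to right.\<close>

lemma mlin_ext:
  assumes "mlin X h F" "mlin X h G" "\<And>w. w \<in> lists B \<Longrightarrow> F w = G w"
  shows "F = G"
proof
  have "F (us @ vs) = G (us @ vs)" if "us \<in> lists B" for us vs
    using that
  proof (induction vs arbitrary: us)
    case Nil
    then show ?case using assms(3) by simp
  next
    case (Cons x vs)
    have "F (us @ b # vs) = G (us @ b # vs)" if "b \<in> B" for b
      using Cons.IH[of "us @ [b]"] Cons.prems that by simp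
    then show ?case
      using lin_expand[of h "\<lambda>x. F (us @ x # vs)" x] lin_expand[of h "\<lambda>x. G (us @ x # vs)" x]
        assms(1,2) by (simp add: mlin_def)
  qed
  from this[of "[]"] show "F xs = G xs" for xs by simp
qed

lemma mlin_ext0:
  assumes "vector_space (smul h)" "mlin X h F" "\<And>w. w \<in> lists B \<Longrightarrow> F w = 0"
  shows "F xs = 0"
proof -
  interpret h: vector_space "smul h" by fact
  have "mlin X h (\<lambda>_. 0)" by (simp add: mlin_def lin_def)
  then show ?thesis using mlin_ext[OF assms(2) _ assms(3)] by meson
qed

text \<open>Graded symmetry, for whatever sign rule \<open>\<kappa>\<close>, needs to be checked on basis words only. A homogeneous
vector expands into basis vectors of the same degree, so the sign is constant in the expansion,
and the remaining arguments enter multilinearly on both sides.\<close>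

lemma sym_ext:
  assumes h: "vector_space (smul h)" and m: "mlin X h F"
    and s: "\<And>us ws x y. us \<in> lists B \<Longrightarrow> ws \<in> lists B \<Longrightarrow> x \<in> B \<Longrightarrow> y \<in> B \<Longrightarrow>
       F (us @ [x, y] @ ws) = smul h (\<kappa> (dg x) (dg y)) (F (us @ [y, x] @ ws))"
    and x: "x \<in> gr X a" and y: "y \<in> gr X b"
  shows "F (us @ [x, y] @ ws) = smul h (\<kappa> a b) (F (us @ [y, x] @ ws))"
proof -
  interpret h: vector_space "smul h" by fact
  have l: "lin X h (\<lambda>x. F (us @ [x, y] @ ws))" "lin X h (\<lambda>y. F (us @ [x, y] @ ws))" for us x y ws
    using m[unfolded mlin_def, rule_format, of us "y # ws"]
      m[unfolded mlin_def, rule_format, of "us @ [x]" ws] by simp_all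
  have e1: "F (us @ [z, v] @ ws) = (\<Sum>c \<in> B. smul h (rep z c) (F (us @ [c, v] @ ws)))" for us z v ws
    by (rule lin_expand[OF l(1)])
  have e2: "F (us @ [z, v] @ ws) = (\<Sum>c \<in> B. smul h (rep v c) (F (us @ [z, c] @ ws)))" for us z v ws
    by (rule lin_expand[OF l(2)])
  have 1: "F (us @ [x, y] @ ws) = smul h (\<kappa> a b) (F (us @ [y, x] @ ws))"
    if us: "us \<in> lists B" and ws: "ws \<in> lists B" for us ws
  proof -
    have "F (us @ [x, y] @ ws) =
      (\<Sum>c \<in> B. \<Sum>d \<in> B. smul h (rep x c * rep y d) (F (us @ [c, d] @ ws)))"
      by (subst e1[of us x y ws]) (simp only: e2[of us _ y ws] h.scale_sum_right h.scale_scale)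
    also have "\<dots> = (\<Sum>c \<in> B. \<Sum>d \<in> B. smul h (\<kappa> a b)
       (smul h (rep y d * rep x c) (F (us @ [d, c] @ ws))))"
    proof (intro sum.cong refl)
      fix c d assume cd: "c \<in> B" "d \<in> B"
      show "smul h (rep x c * rep y d) (F (us @ [c, d] @ ws)) =
        smul h (\<kappa> a b) (smul h (rep y d * rep x c) (F (us @ [d, c] @ ws)))"
      proof (cases "rep x c = 0 \<or> rep y d = 0")
        case True
        then show ?thesis by (elim disjE) (simp_all only: mult_zero_left mult_zero_right h.scale_zero_left h.scale_zero_right)
      next
        case False
        then have "dg c = a" "dg d = b" using rep_homog x y cd by blast+
        then show ?thesis using s[OF us ws cd] by (simp add: mult_ac)
      qed
    qed
    also have "\<dots> = smul h (\<kappa> a b) (\<Sum>d \<in> B. \<Sum>c \<in> B. smul h (rep y d * rep x c) (F (us @ [d, c] @ ws)))"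
      unfolding h.scale_sum_right by (rule sum.swap)
    also have "(\<Sum>d \<in> B. \<Sum>c \<in> B. smul h (rep y d * rep x c) (F (us @ [d, c] @ ws))) = F (us @ [y, x] @ ws)"
      by (subst e1[of us y x ws]) (simp only: e2[of us _ x ws] h.scale_sum_right h.scale_scale)
    finally show ?thesis .
  qed
  have 2: "F (us @ [x, y] @ ws) - smul h (\<kappa> a b) (F (us @ [y, x] @ ws)) = 0"
    if us: "us \<in> lists B" for us ws
  proof (rule mlin_ext0[OF h, of "\<lambda>ws. F (us @ [x, y] @ ws) - smul h (\<kappa> a b) (F (us @ [y, x] @ ws))"])
    show "mlin X h (\<lambda>ws. F (us @ [x, y] @ ws) - smul h (\<kappa> a b) (F (us @ [y, x] @ ws)))"
      using mlin_prefix[OF m, of "us @ [x, y]"] mlin_prefix[OF m, of "us @ [y, x]"]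
      by (intro mlin_diff_scale h) simp_all
  qed (use 1 us in simp)
  have "F (us @ [x, y] @ ws) - smul h (\<kappa> a b) (F (us @ [y, x] @ ws)) = 0"
  proof (rule mlin_ext0[OF h, of "\<lambda>us. F (us @ [x, y] @ ws) - smul h (\<kappa> a b) (F (us @ [y, x] @ ws))"])
    show "mlin X h (\<lambda>us. F (us @ [x, y] @ ws) - smul h (\<kappa> a b) (F (us @ [y, x] @ ws)))"
      using mlin_suffix[OF m, of "[x, y] @ ws"] mlin_suffix[OF m, of "[y, x] @ ws"]
      by (intro mlin_diff_scale h) simp_all
  qed (use 2 in simp)
  then show ?thesis by simp
qed

lemma hmlin_zero:
  assumes "hmlin X h \<Phi>" "length ds = length xs" "0 \<in> set xs" shows "\<Phi> ds xs = 0"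
proof -
  obtain us vs where xs: "xs = us @ 0 # vs" using split_list[OF assms(3)] by blast
  then show ?thesis using assms(1,2) lin_zero[of X h "\<lambda>x. \<Phi> ds (us @ x # vs)"]
    by (simp add: hmlin_def)
qed

lemma finite_words: "finite {ds. set ds \<subseteq> dg ` B \<and> length ds = n}"
  by (rule finite_lists_length_eq) simp

text \<open>Summands with a vanishing component vanish, so the sum may run over all words of degrees that
occur in the basis; this index set no longer depends on the arguments.\<close>

lemma hext_expand:
  assumes "hmlin X h \<Phi>"
  shows "hext X \<Phi> xs = (\<Sum>ds | set ds \<subseteq> dg ` B \<and> length ds = length xs. \<Phi> ds (map2 (component X) ds xs))"
  unfolding hext_def
proof (rule sum.mono_neutral_left[OF finite_words])
  show "{ds. length ds = length xs \<and> (\<forall>i<length xs. component X (ds ! i) (xs ! i) \<noteq> 0)}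
    \<subseteq> {ds. set ds \<subseteq> dg ` B \<and> length ds = length xs}"
    using component_support by (auto simp: in_set_conv_nth) metis
  show "\<forall>ds\<in>{ds. set ds \<subseteq> dg ` B \<and> length ds = length xs} -
     {ds. length ds = length xs \<and> (\<forall>i<length xs. component X (ds ! i) (xs ! i) \<noteq> 0)}.
       \<Phi> ds (map2 (component X) ds xs) = 0"
  proof
    fix ds assume "ds \<in> {ds. set ds \<subseteq> dg ` B \<and> length ds = length xs} -
     {ds. length ds = length xs \<and> (\<forall>i<length xs. component X (ds ! i) (xs ! i) \<noteq> 0)}"
    then obtain i where l: "length ds = length xs" "i < length xs" "component X (ds ! i) (xs ! i) = 0"
      by auto
    then have "map2 (component X) ds xs ! i = 0" "i < length (map2 (component X) ds xs)" by simp_all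
    then have "0 \<in> set (map2 (component X) ds xs)" by (metis nth_mem)
    then show "\<Phi> ds (map2 (component X) ds xs) = 0"
      using l(1) by (intro hmlin_zero[OF assms]) simp_all
  qed
qed

lemma hext_homog:
  assumes m: "hmlin X h \<Phi>" and hom: "homog X ds xs"
  shows "hext X \<Phi> xs = \<Phi> ds xs"
proof (cases "0 \<in> set xs")
  case True
  then obtain i where i: "i < length xs" "xs ! i = 0" by (auto simp: in_set_conv_nth)
  have "component X j 0 = 0" for j using lin_zero[OF lin_component] .
  then have "{ds. length ds = length xs \<and> (\<forall>i<length xs. component X (ds ! i) (xs ! i) \<noteq> 0)} = {}"
    using i by auto
  then have "hext X \<Phi> xs = 0" unfolding hext_def by (simp only: sum.empty)
  moreover have "\<Phi> ds xs = 0"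
    using hmlin_zero[OF m _ True] hom by (simp add: homog_def list_all2_lengthD)
  ultimately show ?thesis by simp
next
  case False
  have l: "length ds = length xs" and g: "\<And>i. i < length xs \<Longrightarrow> xs ! i \<in> gr X (ds ! i)"
    using hom by (auto simp: homog_def list_all2_conv_all_nth)
  have "{es. length es = length xs \<and> (\<forall>i<length xs. component X (es ! i) (xs ! i) \<noteq> 0)} = {ds}"
  proof (intro equalityI subsetI; clarsimp)
    show "length ds = length xs \<and> (\<forall>i<length xs. component X (ds ! i) (xs ! i) \<noteq> 0)"
      using l g False component_homog by (metis nth_mem)
  next
    fix es' assume "length es' = length xs" "\<forall>i<length xs. component X (es' ! i) (xs ! i) \<noteq> 0"
    then show "es' = ds"
      using l g component_homog by (intro nth_equalityI) (simp, metis)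
  qed
  moreover have "map2 (component X) ds xs = xs"
    using l by (intro nth_equalityI) (auto simp: component_homog[OF g])
  ultimately show ?thesis unfolding hext_def by simp
qed

lemma lin_comp: "lin X h f \<Longrightarrow> lin X X g \<Longrightarrow> lin X h (\<lambda>x. f (g x))"
  by (simp add: lin_def)

lemma hext_mlin:
  assumes h: "vector_space (smul h)" and m: "hmlin X h \<Phi>"
  shows "mlin X h (hext X \<Phi>)"
  unfolding mlin_def
proof (intro allI)
  fix us vs
  have "lin X h (\<lambda>x. \<Sum>ds | set ds \<subseteq> dg ` B \<and> length ds = Suc (length us + length vs).
     \<Phi> ds (map2 (component X) ds (us @ x # vs)))"
  proof (rule lin_sum_fun[OF h])
    fix ds assume "ds \<in> {ds. set ds \<subseteq> dg ` B \<and> length ds = Suc (length us + length vs)}"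
    then have l: "length ds = Suc (length us + length vs)" by simp
    define ds1 a ds2 where d: "ds1 = take (length us) ds" "a = ds ! length us"
      "ds2 = drop (Suc (length us)) ds"
    have ds: "ds = ds1 @ a # ds2" "length ds1 = length us" "length ds2 = length vs"
      using l by (simp_all add: d id_take_nth_drop)
    have "map2 (component X) ds (us @ x # vs) =
       map2 (component X) ds1 us @ component X a x # map2 (component X) ds2 vs" for x
      using ds by simp
    moreover have "lin X h (\<lambda>x. \<Phi> ds (map2 (component X) ds1 us @ component X a x # map2 (component X) ds2 vs))"
      by (rule lin_comp[OF _ lin_component])
        (use m l ds in \<open>auto simp: hmlin_def\<close>)
    ultimately show "lin X h (\<lambda>x. \<Phi> ds (map2 (component X) ds (us @ x # vs)))" by simp
  qed
  then show "lin X h (\<lambda>x. hext X \<Phi> (us @ x # vs))"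
    by (simp add: hext_expand[OF m])
qed

end

section \<open>The algebra of functions\<close>

lemma sum_apply: "(\<Sum>a \<in> A. f a) x = (\<Sum>a \<in> A. (f a :: 'a \<Rightarrow> 'b::comm_monoid_add) x)"
  by (induction A rule: infinite_finite_induct) auto

context gspace begin

lemma fns_iff: "\<phi> \<in> fns X \<longleftrightarrow> mlin X ground \<phi> \<and> gsym X ground \<phi>"
  by (simp add: fns_def multilinear_iff vs.vector_space_axioms vs_ground)

lemma fns_mlin: "\<phi> \<in> fns X \<Longrightarrow> mlin X ground \<phi>"
  by (simp add: fns_iff)

lemma fnsI:
  assumes "mlin X ground \<phi>" "wsym dg B \<phi>" shows "\<phi> \<in> fns X"
proof -
  have "\<phi> (us @ [x, y] @ ws) = smul ground (ksgn (a * b)) (\<phi> (us @ [y, x] @ ws))"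
    if "x \<in> gr X a" "y \<in> gr X b" for us ws x y a b
    by (rule sym_ext[OF vs_ground assms(1), where \<kappa> = "\<lambda>a b. ksgn (a * b)"])
      (use assms(2) that in \<open>unfold wsym_def smul_ground, blast+\<close>)
  then show ?thesis using assms(1) unfolding fns_iff gsym_def by blast
qed

lemma fns_wsym: "\<phi> \<in> fns X \<Longrightarrow> wsym dg B \<phi>"
  unfolding wsym_def fns_iff gsym_def using basis_gr by (metis smul_ground)

lemma fns_eqI:
  assumes "\<phi> \<in> fns X" "\<psi> \<in> fns X" "\<And>w. w \<in> lists B \<Longrightarrow> \<phi> w = \<psi> w"
  shows "\<phi> = \<psi>"
  using mlin_ext[of ground] assms fns_mlin by blast

lemma fns_zero [simp]: "0 \<in> fns X"
  by (simp add: fns_iff mlin_def lin_def gsym_def)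

lemma fns_one [simp]: "fone \<in> fns X"
  by (simp add: fns_iff mlin_def lin_def gsym_def fone_def)

lemma gsymD:
  assumes "gsym X ground \<phi>" "x \<in> gr X a" "y \<in> gr X b"
  shows "\<phi> (us @ [x, y] @ ws) = ksgn (a * b) * \<phi> (us @ [y, x] @ ws)"
  using assms unfolding gsym_def smul_ground by blast

lemma fns_combine:
  assumes "\<phi> \<in> fns X" "\<psi> \<in> fns X"
  shows "(\<lambda>w. c (length w) * \<phi> w + d (length w) * \<psi> w) \<in> fns X"
proof -
  have "mlin X ground (\<lambda>w. c (length w) * \<phi> w + d (length w) * \<psi> w)"
    using assms unfolding fns_iff mlin_def lin_def by (simp add: algebra_simps)
  moreover have "gsym X ground (\<lambda>w. c (length w) * \<phi> w + d (length w) * \<psi> w)"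
    unfolding gsym_def smul_ground
  proof (intro allI impI)
    fix us ws x y a b assume "x \<in> gr X a" "y \<in> gr X b"
    then have "\<phi> (us @ [x, y] @ ws) = ksgn (a * b) * \<phi> (us @ [y, x] @ ws)"
      "\<psi> (us @ [x, y] @ ws) = ksgn (a * b) * \<psi> (us @ [y, x] @ ws)"
      using assms unfolding fns_iff by (blast intro: gsymD)+
    then show "c (length (us @ [x, y] @ ws)) * \<phi> (us @ [x, y] @ ws) +
        d (length (us @ [x, y] @ ws)) * \<psi> (us @ [x, y] @ ws) =
      ksgn (a * b) * (c (length (us @ [y, x] @ ws)) * \<phi> (us @ [y, x] @ ws) +
        d (length (us @ [y, x] @ ws)) * \<psi> (us @ [y, x] @ ws))"
      by (simp only: length_append list.size distrib_left mult.left_commute)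
  qed
  ultimately show ?thesis by (simp add: fns_iff)
qed

lemma fns_add [simp]: "\<phi> \<in> fns X \<Longrightarrow> \<psi> \<in> fns X \<Longrightarrow> \<phi> + \<psi> \<in> fns X"
  using fns_combine[of \<phi> \<psi> "\<lambda>_. 1" "\<lambda>_. 1"] by (simp add: plus_fun_def)

lemma fns_scale [simp]: "\<phi> \<in> fns X \<Longrightarrow> fscale c \<phi> \<in> fns X"
  using fns_combine[of \<phi> \<phi> "\<lambda>_. c" "\<lambda>_. 0"] by (simp add: fscale_def[abs_def])

lemma fns_sum: "(\<And>a. a \<in> A \<Longrightarrow> f a \<in> fns X) \<Longrightarrow> (\<Sum>a \<in> A. f a) \<in> fns X"
  by (induction A rule: infinite_finite_induct) auto

lemma fns_pder [simp]:
  assumes "\<phi> \<in> fns X" shows "pder x \<phi> \<in> fns X"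
proof -
  have "mlin X ground (pder x \<phi>)"
    using mlin_suffix[OF fns_mlin[OF assms], of "[x]"] by (simp add: pder_def[abs_def])
  moreover have "gsym X ground (pder x \<phi>)"
    unfolding gsym_def
  proof (intro allI impI)
    fix us ws a b i j assume "a \<in> gr X i" "b \<in> gr X j"
    then have "\<phi> (us @ [a, b] @ (ws @ [x])) = smul ground (ksgn (i * j)) (\<phi> (us @ [b, a] @ (ws @ [x])))"
      using assms unfolding fns_iff gsym_def by blast
    then show "pder x \<phi> (us @ [a, b] @ ws) = smul ground (ksgn (i * j)) (pder x \<phi> (us @ [b, a] @ ws))"
      by (simp add: pder_def)
  qed
  ultimately show ?thesis by (simp add: fns_iff)
qed

lemma nths_middle:
  "nths (us @ x # vs) I = nths us I @ (if length us \<in> I then [x] else []) @ nths vs {j. Suc (j + length us) \<in> I}"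
  by (simp add: nths_append nths_Cons)

lemma lin_ground_mult:
  assumes "lin X ground f" shows "lin X ground (\<lambda>x. c * f x * d)" "lin X ground (\<lambda>x. c * f x)"
  using assms by (simp_all add: lin_def algebra_simps)

lemma hmlin_mul:
  assumes "mlin X ground \<phi>" "mlin X ground \<psi>"
  shows "hmlin X ground (\<lambda>ds xs. \<Sum>I \<in> Pow {..<length xs}.
     c ds (length xs) I * \<phi> (nths xs I) * \<psi> (nths xs ({..<length xs} - I)))"
  unfolding hmlin_def
proof (intro allI impI lin_sum_fun[OF vs_ground] lin_sum_fun)
  fix ds us vs
  have "lin X ground (\<lambda>x. \<Sum>I \<in> Pow {..<Suc (length us + length vs)}.
    c ds (Suc (length us + length vs)) I * \<phi> (nths (us @ x # vs) I) *
     \<psi> (nths (us @ x # vs) ({..<Suc (length us + length vs)} - I)))"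
  proof (rule lin_sum_fun[OF vs_ground])
    fix I
    show "lin X ground (\<lambda>x. c ds (Suc (length us + length vs)) I * \<phi> (nths (us @ x # vs) I) *
     \<psi> (nths (us @ x # vs) ({..<Suc (length us + length vs)} - I)))"
      using assms
      by (cases "length us \<in> I") (auto simp: nths_middle mlin_def intro!: lin_ground_mult)
  qed
  then show "lin X ground (\<lambda>x. \<Sum>I \<in> Pow {..<length (us @ x # vs)}.
    c ds (length (us @ x # vs)) I * \<phi> (nths (us @ x # vs) I) *
     \<psi> (nths (us @ x # vs) ({..<length (us @ x # vs)} - I)))"
    by simp
qed

lemma fmul_sign:
  assumes "I \<subseteq> {..<length ds}"
  shows "koszul (unshuffle I ({..<length ds} - I)) ds *
     ksgn (sum_list (nths ds I) * sum_list (nths ds ({..<length ds} - I))) =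
    (ukoszul ds ({..<length ds} - I) :: 'k)"
  using ukoszul_compl[OF assms, where 'k = 'k] by (simp add: ukoszul_def)

lemma fmul_hmlin:
  assumes "mlin X ground \<phi>" "mlin X ground \<psi>"
  shows "hmlin X ground (\<lambda>ds xs.
     \<Sum>I \<in> Pow {..<length xs}. let J = {..<length xs} - I in
       koszul (unshuffle I J) ds * ksgn (sum_list (nths ds I) * sum_list (nths ds J)) *
       \<phi> (nths xs I) * \<psi> (nths xs J))"
  unfolding Let_def
  using hmlin_mul[OF assms, of "\<lambda>ds n I. koszul (unshuffle I ({..<n} - I)) ds *
    ksgn (sum_list (nths ds I) * sum_list (nths ds ({..<n} - I)))"] .

lemma fmul_mlin: "mlin X ground \<phi> \<Longrightarrow> mlin X ground \<psi> \<Longrightarrow> mlin X ground (fmul X \<phi> \<psi>)"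
  unfolding fmul_def by (intro hext_mlin vs_ground fmul_hmlin)

lemma fmul_homog:
  assumes "mlin X ground \<phi>" "mlin X ground \<psi>" "homog X ds xs"
  shows "fmul X \<phi> \<psi> xs = (\<Sum>I \<in> Pow {..<length xs}.
     ukoszul ds ({..<length xs} - I) * \<phi> (nths xs I) * \<psi> (nths xs ({..<length xs} - I)))"
proof -
  have l: "length xs = length ds" using assms(3) by (simp add: homog_def list_all2_lengthD)
  show ?thesis unfolding fmul_def
    by (subst hext_homog[OF fmul_hmlin[OF assms(1,2)] assms(3)])
      (auto simp: Let_def l fmul_sign intro!: sum.cong)
qed

lemma fmul_words:
  assumes "mlin X ground \<phi>" "mlin X ground \<psi>" "w \<in> lists B"
  shows "fmul X \<phi> \<psi> w = wmul dg \<phi> \<psi> w"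
  using fmul_homog[OF assms(1,2) homog_basis[OF assms(3)]] by (simp add: wmul_def)

lemma words_sub: "w \<in> lists B \<Longrightarrow> set u \<subseteq> set w \<Longrightarrow> u \<in> lists B"
  by auto

lemma fmul_fns [simp]:
  assumes "\<phi> \<in> fns X" "\<psi> \<in> fns X" shows "fmul X \<phi> \<psi> \<in> fns X"
proof (rule fnsI)
  note m = fns_mlin[OF assms(1)] fns_mlin[OF assms(2)]
  show "mlin X ground (fmul X \<phi> \<psi>)" using m by (rule fmul_mlin)
  show "wsym dg B (fmul X \<phi> \<psi>)"
    using wsym_wmul[OF fns_wsym[OF assms(1)] fns_wsym[OF assms(2)]]
    unfolding wsym_def
  proof (intro allI impI)
    fix us ws x y assume a: "us \<in> lists B" "ws \<in> lists B" "x \<in> B" "y \<in> B"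
    then have "us @ [x, y] @ ws \<in> lists B" "us @ [y, x] @ ws \<in> lists B" by auto
    note e = this[THEN fmul_words[OF m]]
    show "fmul X \<phi> \<psi> (us @ [x, y] @ ws) = ksgn (dg x * dg y) * fmul X \<phi> \<psi> (us @ [y, x] @ ws)"
      unfolding e
      using wsym_wmul[OF fns_wsym[OF assms(1)] fns_wsym[OF assms(2)]] a unfolding wsym_def by blast
  qed
qed

lemma fmul_eqI:
  assumes "\<phi> \<in> fns X" "\<psi> \<in> fns X" "\<chi> \<in> fns X" "\<And>w. w \<in> lists B \<Longrightarrow> wmul dg \<phi> \<psi> w = \<chi> w"
  shows "fmul X \<phi> \<psi> = \<chi>"
  by (rule fns_eqI) (use assms in \<open>auto simp: fmul_words fns_mlin\<close>)

lemma fmul_assoc: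
  assumes "\<phi> \<in> fns X" "\<psi> \<in> fns X" "\<chi> \<in> fns X"
  shows "fmul X (fmul X \<phi> \<psi>) \<chi> = fmul X \<phi> (fmul X \<psi> \<chi>)"
proof (rule fmul_eqI)
  fix w assume w: "w \<in> lists B"
  have "wmul dg (fmul X \<phi> \<psi>) \<chi> w = wmul dg (wmul dg \<phi> \<psi>) \<chi> w"
    by (rule wmul_cong) (use assms words_sub[OF w] in \<open>auto simp: fmul_words fns_mlin\<close>)
  also have "\<dots> = wmul dg \<phi> (wmul dg \<psi> \<chi>) w" by (rule wmul_assoc)
  also have "\<dots> = wmul dg \<phi> (fmul X \<psi> \<chi>) w"
    by (rule wmul_cong) (use assms words_sub[OF w] in \<open>auto simp: fmul_words fns_mlin\<close>)
  finally show "wmul dg (fmul X \<phi> \<psi>) \<chi> w = fmul X \<phi> (fmul X \<psi> \<chi>) w"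
    using w assms by (simp add: fmul_words fns_mlin)
qed (use assms in auto)

lemma fmul_one_left [simp]: "\<phi> \<in> fns X \<Longrightarrow> fmul X fone \<phi> = \<phi>"
  by (rule fmul_eqI) auto

lemma fmul_one_right [simp]: "\<phi> \<in> fns X \<Longrightarrow> fmul X \<phi> fone = \<phi>"
  by (rule fmul_eqI) auto

lemma fmul_add_left:
  "\<phi> \<in> fns X \<Longrightarrow> \<phi>' \<in> fns X \<Longrightarrow> \<psi> \<in> fns X \<Longrightarrow> fmul X (\<phi> + \<phi>') \<psi> = fmul X \<phi> \<psi> + fmul X \<phi>' \<psi>"
  by (rule fmul_eqI) (auto simp: fmul_words fns_mlin wmul_add_left)

lemma fmul_add_right:
  "\<phi> \<in> fns X \<Longrightarrow> \<psi> \<in> fns X \<Longrightarrow> \<psi>' \<in> fns X \<Longrightarrow> fmul X \<phi> (\<psi> + \<psi>') = fmul X \<phi> \<psi> + fmul X \<phi> \<psi>'"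
  by (rule fmul_eqI) (auto simp: fmul_words fns_mlin wmul_add_right)

lemma fmul_scale_left:
  "\<phi> \<in> fns X \<Longrightarrow> \<psi> \<in> fns X \<Longrightarrow> fmul X (fscale c \<phi>) \<psi> = fscale c (fmul X \<phi> \<psi>)"
  by (rule fmul_eqI) (auto simp: fmul_words fns_mlin wmul_scale_left fscale_def)

lemma fmul_scale_right:
  "\<phi> \<in> fns X \<Longrightarrow> \<psi> \<in> fns X \<Longrightarrow> fmul X \<phi> (fscale c \<psi>) = fscale c (fmul X \<phi> \<psi>)"
  by (rule fmul_eqI) (auto simp: fmul_words fns_mlin wmul_scale_right fscale_def)

lemma fmul_zero_left [simp]: "\<phi> \<in> fns X \<Longrightarrow> fmul X 0 \<phi> = 0"
  by (rule fmul_eqI) auto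

lemma fmul_zero_right [simp]: "\<phi> \<in> fns X \<Longrightarrow> fmul X \<phi> 0 = 0"
  by (rule fmul_eqI) auto

lemma fmul_sum_left:
  assumes "\<And>a. a \<in> A \<Longrightarrow> f a \<in> fns X" "\<psi> \<in> fns X"
  shows "fmul X (\<Sum>a \<in> A. f a) \<psi> = (\<Sum>a \<in> A. fmul X (f a) \<psi>)"
  using assms(1)
  by (induction A rule: infinite_finite_induct) (use assms(2) in \<open>auto simp: fmul_add_left fns_sum\<close>)

lemma fmul_sum_right:
  assumes "\<And>a. a \<in> A \<Longrightarrow> f a \<in> fns X" "\<psi> \<in> fns X"
  shows "fmul X \<psi> (\<Sum>a \<in> A. f a) = (\<Sum>a \<in> A. fmul X \<psi> (f a))"
  using assms(1)
  by (induction A rule: infinite_finite_induct) (use assms(2) in \<open>auto simp: fmul_add_right fns_sum\<close>)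

lemma fscale_simps [simp]: "fscale c (fscale d \<phi>) = fscale (c * d) \<phi>" "fscale 1 \<phi> = \<phi>"
  "fscale c (0 :: ('k, 'v) fn) = 0"
  by (auto simp: fscale_def fun_eq_iff)

lemma fscale_add: "fscale c (\<phi> + \<psi>) = fscale c \<phi> + fscale c (\<psi> :: ('k, 'v) fn)"
  by (simp add: fscale_def fun_eq_iff algebra_simps)

lemma fscale_sum: "fscale c (\<Sum>a \<in> A. f a) = (\<Sum>a \<in> A. fscale c (f a :: ('k, 'v) fn))"
  by (simp add: fun_eq_iff fscale_def sum_apply sum_distrib_left)

lemma of_degree_ground:
  "of_degree X ground (\<lambda>_. i) \<phi> \<longleftrightarrow> (\<forall>ds xs. homog X ds xs \<longrightarrow> \<phi> xs \<noteq> 0 \<longrightarrow> sum_list ds = - i)"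
  unfolding of_degree_def gr_ground by (auto simp: eq_neg_iff_add_eq_0)

text \<open>Cutting \<open>\<phi>\<close> down to words of total degree \<open>-i\<close> gives a multilinear function that agrees with \<open>\<phi>\<close> on
basis words, hence equals \<open>\<phi>\<close>.\<close>

lemma fns_degI:
  assumes "\<phi> \<in> fns X" "\<And>w. w \<in> lists B \<Longrightarrow> \<phi> w \<noteq> 0 \<Longrightarrow> wdeg dg w = - i"
  shows "\<phi> \<in> fns_deg X i"
proof -
  let ?\<Phi> = "\<lambda>ds xs. if sum_list ds = - i then \<phi> xs else 0"
  have h: "hmlin X ground ?\<Phi>"
    using fns_mlin[OF assms(1)] by (auto simp: hmlin_def mlin_def lin_def)
  have "\<phi> = hext X ?\<Phi>"
    by (rule mlin_ext[OF fns_mlin[OF assms(1)] hext_mlin[OF vs_ground h]])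
      (use assms(2) in \<open>auto simp: hext_homog[OF h homog_basis] wdeg_def\<close>)
  then have e: "\<phi> xs = hext X ?\<Phi> xs" for xs by (rule fun_cong)
  have "sum_list ds = - i" if "homog X ds xs" "\<phi> xs \<noteq> 0" for ds xs
  proof (rule ccontr)
    assume "sum_list ds \<noteq> - i"
    then have "hext X ?\<Phi> xs = 0" using hext_homog[OF h that(1)] by simp
    then show False using e[of xs] that(2) by metis
  qed
  then show ?thesis using assms(1) unfolding fns_deg_def of_degree_ground by blast
qed

lemma fns_deg_fns: "\<phi> \<in> fns_deg X i \<Longrightarrow> \<phi> \<in> fns X"
  by (simp add: fns_deg_def)

lemma fns_deg_homog: "\<phi> \<in> fns_deg X i \<Longrightarrow> homog X ds xs \<Longrightarrow> \<phi> xs \<noteq> 0 \<Longrightarrow> sum_list ds = - i"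
  by (simp add: fns_deg_def of_degree_ground)

lemma fns_deg_word: "\<phi> \<in> fns_deg X i \<Longrightarrow> w \<in> lists B \<Longrightarrow> \<phi> w \<noteq> 0 \<Longrightarrow> wdeg dg w = - i"
  unfolding wdeg_def by (rule fns_deg_homog[OF _ homog_basis])

lemma fns_deg_zero [simp]: "0 \<in> fns_deg X i"
  by (rule fns_degI) auto

lemma fns_deg_one [simp]: "fone \<in> fns_deg X 0"
  by (rule fns_degI) (auto simp: fone_def split: if_splits)

lemma fns_deg_add: "\<phi> \<in> fns_deg X i \<Longrightarrow> \<psi> \<in> fns_deg X i \<Longrightarrow> \<phi> + \<psi> \<in> fns_deg X i"
proof (rule fns_degI)
  fix w assume "\<phi> \<in> fns_deg X i" "\<psi> \<in> fns_deg X i" "w \<in> lists B" "(\<phi> + \<psi>) w \<noteq> 0"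
  then show "wdeg dg w = - i" by (cases "\<phi> w = 0") (auto intro: fns_deg_word)
qed (simp add: fns_deg_fns)

lemma fns_deg_scale: "\<phi> \<in> fns_deg X i \<Longrightarrow> fscale c \<phi> \<in> fns_deg X i"
  by (rule fns_degI) (auto simp: fns_deg_fns fscale_def fns_deg_word)

lemma fns_deg_sum: "(\<And>a. a \<in> A \<Longrightarrow> f a \<in> fns_deg X i) \<Longrightarrow> (\<Sum>a \<in> A. f a) \<in> fns_deg X i"
  by (induction A rule: infinite_finite_induct) (auto intro: fns_deg_add)

lemma fns_deg_pder: "\<phi> \<in> fns_deg X i \<Longrightarrow> b \<in> B \<Longrightarrow> pder b \<phi> \<in> fns_deg X (i + dg b)"
proof (rule fns_degI)
  fix w assume "\<phi> \<in> fns_deg X i" "b \<in> B" "w \<in> lists B" "pder b \<phi> w \<noteq> 0"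
  then have "wdeg dg (w @ [b]) = - i" by (intro fns_deg_word) (auto simp: pder_def)
  then show "wdeg dg w = - (i + dg b)" by simp
qed (simp add: fns_deg_fns)

lemma fns_deg_fmul:
  assumes "\<phi> \<in> fns_deg X i" "\<psi> \<in> fns_deg X j" shows "fmul X \<phi> \<psi> \<in> fns_deg X (i + j)"
proof (rule fns_degI)
  fix w assume w: "w \<in> lists B" and "fmul X \<phi> \<psi> w \<noteq> 0"
  then have "wmul dg \<phi> \<psi> w \<noteq> 0" using assms by (simp add: fmul_words fns_mlin fns_deg_fns)
  then obtain I where I: "I \<subseteq> {..<length w}" "\<phi> (nths w I) \<noteq> 0" "\<psi> (nths w ({..<length w} - I)) \<noteq> 0"
    unfolding wmul_def by (elim sum.not_neutral_contains_not_neutral) auto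
  have "wdeg dg (nths w I) = - i" "wdeg dg (nths w ({..<length w} - I)) = - j"
    using I assms words_sub[OF w set_nths_subset] by (auto intro: fns_deg_word)
  then show "wdeg dg w = - (i + j)"
    using sum_list_nths_compl[of I "map dg w"] I(1) by (simp add: wdeg_def nths_map)
qed (use assms in \<open>simp add: fns_deg_fns\<close>)

lemma fmul_commute:
  assumes "\<phi> \<in> fns_deg X i" "\<psi> \<in> fns_deg X j"
  shows "fmul X \<phi> \<psi> = fscale (ksgn (i * j)) (fmul X \<psi> \<phi>)"
proof (rule fmul_eqI)
  fix w assume w: "w \<in> lists B"
  have "wmul dg \<phi> \<psi> w = ksgn (i * j) * wmul dg \<psi> \<phi> w"
    by (rule wmul_commute) (use assms words_sub[OF w] in \<open>auto simp: fns_deg_word\<close>)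
  then show "wmul dg \<phi> \<psi> w = fscale (ksgn (i * j)) (fmul X \<psi> \<phi>) w"
    using w assms by (simp add: fmul_words fns_mlin fns_deg_fns fscale_def)
qed (use assms in \<open>auto simp: fns_deg_fns\<close>)

lemma fmul_commute0:
  assumes "\<phi> \<in> fns_deg X 0" "\<psi> \<in> fns X"
  shows "fmul X \<phi> \<psi> = fmul X \<psi> \<phi>"
proof (rule fmul_eqI)
  fix w assume w: "w \<in> lists B"
  have "wmul dg \<phi> \<psi> w = 1 * wmul dg \<psi> \<phi> w"
    by (rule wmul_commute) (use assms words_sub[OF w] in \<open>auto simp: fns_deg_word\<close>)
  then show "wmul dg \<phi> \<psi> w = fmul X \<psi> \<phi> w"
    using w assms by (simp add: fmul_words fns_mlin fns_deg_fns)
qed (use assms in \<open>auto simp: fns_deg_fns\<close>)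

lemma pder_fmul:
  assumes "\<phi> \<in> fns_deg X i" "\<psi> \<in> fns X" "b \<in> B"
  shows "pder b (fmul X \<phi> \<psi>) = fmul X (pder b \<phi>) \<psi> + fscale (ksgn (i * dg b)) (fmul X \<phi> (pder b \<psi>))"
proof (rule fns_eqI)
  note f = fns_deg_fns[OF assms(1)]
  fix w assume w: "w \<in> lists B"
  have "wmul dg (twist dg b \<phi>) (pder b \<psi>) w = wmul dg (fscale (ksgn (i * dg b)) \<phi>) (pder b \<psi>) w"
  proof (rule wmul_cong)
    fix u assume "set u \<subseteq> set w"
    then have u: "u \<in> lists B" using w by auto
    show "twist dg b \<phi> u = fscale (ksgn (i * dg b)) \<phi> u"
    proof (cases "\<phi> u = 0")
      case False
      then show ?thesis using fns_deg_word[OF assms(1) u] by (simp add: twist_def fscale_def mult.commute ksgn_def)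
    qed (simp add: twist_def fscale_def)
  qed simp
  moreover have "pder b (fmul X \<phi> \<psi>) w = wmul dg \<phi> \<psi> (w @ [b])"
    using w assms f by (simp add: pder_def fmul_words fns_mlin)
  ultimately show "pder b (fmul X \<phi> \<psi>) w =
     (fmul X (pder b \<phi>) \<psi> + fscale (ksgn (i * dg b)) (fmul X \<phi> (pder b \<psi>))) w"
    using w assms f by (simp add: wmul_snoc fmul_words fns_mlin wmul_scale_left fscale_def)
qed (use assms in \<open>auto simp: fns_deg_fns\<close>)

definition xcoord :: "'v \<Rightarrow> ('k, 'v) fn" where
  "xcoord b xs = (if length xs = 1 then rep (hd xs) b else 0)"

lemma coord_xcoord: "coord X es i = xcoord (es ! i)"
  by (simp add: coord_def xcoord_def fun_eq_iff)

lemma xcoord_word: "w \<in> lists B \<Longrightarrow> b \<in> B \<Longrightarrow> xcoord b w = letter b w"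
  by (cases w rule: list.exhaust; cases "tl w") (auto simp: xcoord_def letter_def rep_basis)

lemma pder_xcoord: "a \<in> B \<Longrightarrow> pder a (xcoord b) = (if a = b then fone else 0)"
  by (auto simp: pder_def xcoord_def fone_def rep_basis fun_eq_iff)

lemma xcoord_Nil [simp]: "xcoord b [] = 0"
  by (simp add: xcoord_def)

lemma xcoord_fns_deg: "b \<in> B \<Longrightarrow> xcoord b \<in> fns_deg X (- dg b)"
proof (rule fns_degI)
  have "mlin X ground (xcoord b)"
    unfolding mlin_def
  proof (intro allI)
    fix us vs
    show "lin X ground (\<lambda>x. xcoord b (us @ x # vs))"
      using lin_rep by (cases "us = [] \<and> vs = []") (auto simp: xcoord_def lin_def neq_Nil_conv)
  qed
  then show "xcoord b \<in> fns X" by (simp add: fns_iff gsym_def xcoord_def)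
  show "wdeg dg w = - (- dg b)" if "w \<in> lists B" "xcoord b w \<noteq> 0" "b \<in> B" for w
    using that by (auto simp: xcoord_word letter_def split: if_splits)
qed

lemma xcoord_fns [simp]: "b \<in> B \<Longrightarrow> xcoord b \<in> fns X"
  using xcoord_fns_deg fns_deg_fns by blast

text \<open>The Euler identity, divided by the length of the word; characteristic zero enters here.\<close>

lemma hadamard:
  assumes "\<phi> \<in> fns X"
  obtains h where "\<And>b. h b \<in> fns X" "\<phi> = fscale (\<phi> []) fone + (\<Sum>b \<in> B. fmul X (xcoord b) (h b))"
proof -
  \<comment> \<open>The coefficient \<open>h b\<close> is evaluated at words that are one letter shorter than those of \<open>\<phi>\<close>.\<close>
  define h where "h b w = pder b \<phi> w / of_nat (length w + 1)" for b w
  have h: "h b \<in> fns X" for b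
    using fns_combine[OF fns_pder[OF assms, of b] fns_zero, of "\<lambda>n. 1 / of_nat (n + 1)" "\<lambda>_. 0"]
    by (simp add: h_def[abs_def])
  have "\<phi> = fscale (\<phi> []) fone + (\<Sum>b \<in> B. fmul X (xcoord b) (h b))"
  proof (rule fns_eqI)
    fix w assume w: "w \<in> lists B"
    have "fmul X (xcoord b) (h b) w = wmul dg (letter b) (pder b \<phi>) w / of_nat (length w)" if b: "b \<in> B" for b
    proof -
      have "fmul X (xcoord b) (h b) w = wmul dg (xcoord b) (h b) w"
        using w b h by (simp add: fmul_words fns_mlin)
      also have "\<dots> = wmul dg (letter b) (h b) w"
        by (rule wmul_cong) (use xcoord_word words_sub[OF w] b in auto)
      also have "\<dots> = wmul dg (letter b) (fscale (1 / of_nat (length w)) (pder b \<phi>)) w"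
        by (rule wmul_letter_cong) (simp add: h_def fscale_def flip: of_nat_Suc)
      finally show ?thesis by (simp add: wmul_scale_right fscale_def)
    qed
    then show "\<phi> w = (fscale (\<phi> []) fone + (\<Sum>b \<in> B. fmul X (xcoord b) (h b))) w"
      using euler_words[OF _ fns_wsym[OF assms] w]
      by (cases "w = []") (simp_all add: fscale_def fone_def sum_apply flip: sum_divide_distrib)
  qed (use assms h in \<open>auto intro!: fns_add fns_sum\<close>)
  with h show ?thesis using that by blast
qed

end

section \<open>Vector fields in coordinates\<close>

text \<open>From here on, functions are mostly treated as elements of an algebra; evaluating their sums
pointwise would break the ring identities apart.\<close>

declare plus_fun_apply [simp del] zero_fun_apply [simp del]
lemmas fun_apply = plus_fun_apply zero_fun_apply sum_apply

context gspace begin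

definition vfield :: "('v \<Rightarrow> ('k, 'v) fn) \<Rightarrow> ('k, 'v) vf" where
  "vfield G \<phi> = (if \<phi> \<in> fns X then \<Sum>b \<in> B. fmul X (G b) (pder b \<phi>) else 0)"

lemma
  assumes "vector_field X j V"
  shows vf_out: "\<phi> \<notin> fns X \<Longrightarrow> V \<phi> = 0"
    and vf_fns: "\<phi> \<in> fns X \<Longrightarrow> V \<phi> \<in> fns X"
    and vf_add: "\<phi> \<in> fns X \<Longrightarrow> \<psi> \<in> fns X \<Longrightarrow> V (\<phi> + \<psi>) = V \<phi> + V \<psi>"
    and vf_scale: "\<phi> \<in> fns X \<Longrightarrow> V (fscale c \<phi>) = fscale c (V \<phi>)"
    and vf_deg: "\<phi> \<in> fns_deg X i \<Longrightarrow> V \<phi> \<in> fns_deg X (i + j)"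
    and vf_mul: "\<phi> \<in> fns_deg X i \<Longrightarrow> \<psi> \<in> fns X \<Longrightarrow>
       V (fmul X \<phi> \<psi>) = fmul X (V \<phi>) \<psi> + fscale (ksgn (i * j)) (fmul X \<phi> (V \<psi>))"
  using assms unfolding vector_field_def by blast+

lemma vf_zero: "vector_field X j V \<Longrightarrow> V 0 = 0"
  using vf_add[of j V 0 0] by simp

lemma vf_one: assumes "vector_field X j V" shows "V fone = 0"
proof -
  have "V fone = V fone + V fone"
    using vf_mul[OF assms fns_deg_one fns_one] vf_fns[OF assms fns_one] by simp
  then show ?thesis by simp
qed

lemma vf_sum:
  assumes "vector_field X j V" "\<And>a. a \<in> A \<Longrightarrow> f a \<in> fns X"
  shows "V (\<Sum>a \<in> A. f a) = (\<Sum>a \<in> A. V (f a))"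
  using assms(2)
  by (induction A rule: infinite_finite_induct)
    (auto simp: vf_add[OF assms(1)] fns_sum vf_zero[OF assms(1)])

text \<open>By \<open>hadamard\<close> and the Leibniz rule, the value of a vector field at a word reduces to its values on
coordinates and to values at shorter words.\<close>

lemma vf_eqI:
  assumes V: "vector_field X j V" and W: "vector_field X j W"
    and e: "\<And>b. b \<in> B \<Longrightarrow> V (xcoord b) = W (xcoord b)"
  shows "V = W"
proof
  have "V \<phi> w = W \<phi> w" if "\<phi> \<in> fns X" "w \<in> lists B" for \<phi> w
    using that
  proof (induction w arbitrary: \<phi> rule: length_induct)
    case (1 w)
    obtain h where h: "\<And>b. h b \<in> fns X"
      and phi: "\<phi> = fscale (\<phi> []) fone + (\<Sum>b \<in> B. fmul X (xcoord b) (h b))"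
      using hadamard[OF 1(2)] by metis
    have s: "(\<Sum>b \<in> B. fmul X (xcoord b) (h b)) \<in> fns X" using h by (intro fns_sum) simp
    have E: "U \<phi> w = (\<Sum>b \<in> B. (fmul X (U (xcoord b)) (h b) +
         fscale (ksgn (- dg b * j)) (fmul X (xcoord b) (U (h b)))) w)"
      if U: "vector_field X j U" for U
    proof -
      have "U \<phi> = fscale (\<phi> []) (U fone) + (\<Sum>b \<in> B. U (fmul X (xcoord b) (h b)))"
        using s h by (subst phi) (simp add: vf_add[OF U] vf_scale[OF U] vf_sum[OF U])
      also have "\<dots> = (\<Sum>b \<in> B. fmul X (U (xcoord b)) (h b) +
         fscale (ksgn (- dg b * j)) (fmul X (xcoord b) (U (h b))))"
        using vf_mul[OF U xcoord_fns_deg h] by (simp add: vf_one[OF U])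
      finally show ?thesis by (simp add: fun_apply)
    qed
    have "fmul X (xcoord b) (V (h b)) w = fmul X (xcoord b) (W (h b)) w" if b: "b \<in> B" for b
    proof -
      have "wmul dg (xcoord b) (V (h b)) w = wmul dg (xcoord b) (W (h b)) w"
        by (rule wmul_cong_ideal) (use 1(1) h words_sub[OF 1(3)] in auto)
      then show ?thesis
        using b 1(3) vf_fns[OF V h] vf_fns[OF W h] by (simp add: fmul_words fns_mlin)
    qed
    then show ?case
      unfolding E[OF V] E[OF W] by (intro sum.cong) (simp_all add: e fscale_def fun_apply)
  qed
  then show "V \<phi> = W \<phi>" for \<phi>
    using vf_out[OF V] vf_out[OF W] vf_fns[OF V] vf_fns[OF W] fns_eqI by metis
qed

lemma pder_simps: "pder b (fscale c \<phi>) = fscale c (pder b \<phi>)"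
  "pder b (\<phi> + \<psi>) = pder b \<phi> + pder b (\<psi> :: ('k, 'v) fn)"
  by (auto simp: pder_def fscale_def fun_eq_iff fun_apply)

text \<open>Moving \<open>\<phi>\<close> past the coefficient \<open>G b\<close> and past \<open>\<partial>\<^sub>b\<close> costs the exponents \<open>(j - |b|) |\<phi>|\<close> and \<open>|b| |\<phi>|\<close>, which
add up to the \<open>j |\<phi>|\<close> of the Leibniz rule.\<close>

lemma vf_vector_field:
  assumes G: "\<And>b. b \<in> B \<Longrightarrow> G b \<in> fns_deg X (j - dg b)"
  shows "vector_field X j (vfield G)"
  unfolding vector_field_def
proof (intro conjI allI ballI impI)
  note Gf = fns_deg_fns[OF G]
  fix \<phi> assume phi: "\<phi> \<in> fns X"
  show "vfield G \<phi> \<in> fns X" using phi Gf by (auto simp: vfield_def intro!: fns_sum)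
  show "vfield G (fscale c \<phi>) = fscale c (vfield G \<phi>)" for c
    using phi Gf by (simp add: vfield_def pder_simps fscale_sum fmul_scale_right cong: sum.cong)
  fix \<psi> assume psi: "\<psi> \<in> fns X"
  show "vfield G (\<phi> + \<psi>) = vfield G \<phi> + vfield G \<psi>"
    using phi psi Gf by (simp add: vfield_def pder_simps fmul_add_right sum.distrib cong: sum.cong)
next
  note Gf = fns_deg_fns[OF G]
  fix i \<phi> assume phi: "\<phi> \<in> fns_deg X i"
  note phif = fns_deg_fns[OF phi]
  have "fmul X (G b) (pder b \<phi>) \<in> fns_deg X (i + j)" if "b \<in> B" for b
    using fns_deg_fmul[OF G[OF that] fns_deg_pder[OF phi that]] by (simp add: algebra_simps)
  then show "vfield G \<phi> \<in> fns_deg X (i + j)"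
    using phif by (auto simp: vfield_def intro!: fns_deg_sum)
  fix \<psi> assume psi: "\<psi> \<in> fns X"
  have "fmul X (G b) (pder b (fmul X \<phi> \<psi>)) = fmul X (fmul X (G b) (pder b \<phi>)) \<psi> +
      fscale (ksgn (i * j)) (fmul X \<phi> (fmul X (G b) (pder b \<psi>)))" if b: "b \<in> B" for b
  proof -
    have "fmul X (G b) (pder b (fmul X \<phi> \<psi>)) = fmul X (G b) (fmul X (pder b \<phi>) \<psi>) +
      fscale (ksgn (i * dg b)) (fmul X (G b) (fmul X \<phi> (pder b \<psi>)))"
      using b phif psi Gf by (simp add: pder_fmul[OF phi psi b] fmul_add_right fmul_scale_right)
    also have "fmul X (G b) (fmul X \<phi> (pder b \<psi>)) =
      fscale (ksgn ((j - dg b) * i)) (fmul X \<phi> (fmul X (G b) (pder b \<psi>)))"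
      using b phif psi Gf fmul_commute[OF G[OF b] phi]
      by (simp add: fmul_scale_left flip: fmul_assoc)
    also have "fscale (ksgn (i * dg b)) (fscale (ksgn ((j - dg b) * i)) (fmul X \<phi> (fmul X (G b) (pder b \<psi>)))) =
      fscale (ksgn (i * j)) (fmul X \<phi> (fmul X (G b) (pder b \<psi>)))"
    proof -
      have "ksgn (i * dg b) * ksgn ((j - dg b) * i) = (ksgn (i * j) :: 'k)"
        unfolding ksgn_add[symmetric] by (rule ksgn_cong) (auto simp: algebra_simps)
      then show ?thesis by simp
    qed
    finally show ?thesis using b phif psi Gf by (simp add: fmul_assoc)
  qed
  then show "vfield G (fmul X \<phi> \<psi>) = fmul X (vfield G \<phi>) \<psi> + fscale (ksgn (i * j)) (fmul X \<phi> (vfield G \<psi>))"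
    using phif psi Gf
    by (simp add: vfield_def fmul_sum_left fmul_sum_right sum.distrib fscale_sum cong: sum.cong)
qed (simp add: vfield_def)

lemma vf_xcoord:
  assumes "\<And>b. b \<in> B \<Longrightarrow> G b \<in> fns X" "b \<in> B" shows "vfield G (xcoord b) = G b"
proof -
  have "(\<Sum>a \<in> B. fmul X (G a) (pder a (xcoord b))) = (\<Sum>a \<in> B. if a = b then G b else 0)"
    by (intro sum.cong refl) (auto simp: pder_xcoord assms)
  then show ?thesis using assms(2) by (simp add: vfield_def)
qed

lemma vector_field_formula:
  assumes "vector_field X j V" shows "V = vfield (\<lambda>b. V (xcoord b))"
proof -
  have G: "V (xcoord b) \<in> fns_deg X (j - dg b)" if "b \<in> B" for b
    using vf_deg[OF assms xcoord_fns_deg[OF that]] by simp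
  show ?thesis
    by (rule vf_eqI[OF assms vf_vector_field]) (use G fns_deg_fns in \<open>auto intro!: vf_xcoord[symmetric]\<close>)
qed

lemma ex1_vector_field:
  assumes "\<And>b. b \<in> B \<Longrightarrow> G b \<in> fns_deg X (j - dg b)"
  shows "(THE V. vector_field X j V \<and> (\<forall>b \<in> B. V (xcoord b) = G b)) = vfield G"
proof (rule the_equality)
  show "vector_field X j (vfield G) \<and> (\<forall>b \<in> B. vfield G (xcoord b) = G b)"
    using vf_vector_field[OF assms] vf_xcoord[OF fns_deg_fns[OF assms]] by auto
  show "V = vfield G" if "vector_field X j V \<and> (\<forall>b \<in> B. V (xcoord b) = G b)" for V
    by (rule vf_eqI[OF _ vf_vector_field]) (use that assms vf_xcoord[OF fns_deg_fns[OF assms]] in auto)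
qed

definition partial :: "'v \<Rightarrow> ('k, 'v) vf" where
  "partial b \<phi> = (if \<phi> \<in> fns X then pder b \<phi> else 0)"

lemma partial_vf: "b \<in> B \<Longrightarrow> partial b = vfield (\<lambda>a. if a = b then fone else 0)"
proof
  fix \<phi> assume b: "b \<in> B"
  have "(\<Sum>a \<in> B. fmul X (if a = b then fone else 0) (pder a \<phi>)) = (\<Sum>a \<in> B. if a = b then pder b \<phi> else 0)"
    if "\<phi> \<in> fns X" using that by (intro sum.cong) auto
  then show "partial b \<phi> = vfield (\<lambda>a. if a = b then fone else 0) \<phi>"
    using b by (simp add: partial_def vfield_def)
qed

lemma partial_vector_field: "b \<in> B \<Longrightarrow> vector_field X (dg b) (partial b)"
  unfolding partial_vf by (rule vf_vector_field) auto

lemma es_bij: "bij_betw ((!) es) {..<length es} B"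
  using hb by (auto simp: homogeneous_basis_def intro!: bij_betw_nth)

lemma sum_es: "(\<Sum>i < length es. f (es ! i)) = (\<Sum>b \<in> B. f b)"
  by (rule sum.reindex_bij_betw[OF es_bij])

lemma dcoord_eq: assumes "i < length es" shows "dcoord X es i = partial (es ! i)"
proof -
  have d: "distinct es" using hb by (simp add: homogeneous_basis_def)
  have "(\<forall>j < length es. V (coord X es j) = (if j = i then fone else 0)) \<longleftrightarrow>
     (\<forall>b \<in> B. V (xcoord b) = (if b = es ! i then fone else 0))" for V :: "('k, 'v) vf"
    using assms d unfolding coord_xcoord by (auto simp: all_set_conv_all_nth nth_eq_iff_index_eq)
  then have "dcoord X es i = (THE V. vector_field X (dg (es ! i)) V \<and>
     (\<forall>b \<in> B. V (xcoord b) = (if b = es ! i then fone else 0)))"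
    unfolding dcoord_def by (simp only:)
  also have "\<dots> = vfield (\<lambda>b. if b = es ! i then fone else 0)"
    by (rule ex1_vector_field) auto
  finally show ?thesis using assms by (simp add: partial_vf)
qed

lemma vf_vmul:
  assumes "\<And>b. b \<in> B \<Longrightarrow> G b \<in> fns X"
  shows "vfield G = (\<Sum>b \<in> B. vmul X (G b) (partial b))"
proof
  fix \<phi>
  have "(\<Sum>b \<in> B. vmul X (G b) (partial b)) \<phi> = (\<Sum>b \<in> B. vmul X (G b) (partial b) \<phi>)"
    by (rule sum_apply)
  also have "\<dots> = vfield G \<phi>"
    using assms by (auto simp: vfield_def vmul_def partial_def intro!: sum.neutral)
  finally show "vfield G \<phi> = (\<Sum>b \<in> B. vmul X (G b) (partial b)) \<phi>" ..
qed

text \<open>The constant volume form is the basis element of the Berezinian attached to the coordinate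
frame, so the freeness of the Berezinian can be used for it once this is known.\<close>

lemma frame_dcoord: "frame X es (dcoord X es)"
  unfolding frame_def
proof (intro conjI allI impI)
  show "vector_field X (dg (es ! i)) (dcoord X es i)" if "i < length es" for i
    using partial_vector_field that by (simp add: dcoord_eq)
  fix j V assume V: "vector_field X j V"
  have comb: "(\<Sum>i < length es. vmul X (g i) (dcoord X es i)) = vfield G"
    if "\<And>i. i < length es \<Longrightarrow> g i = G (es ! i)" "\<And>b. b \<in> B \<Longrightarrow> G b \<in> fns X" for g G
  proof -
    have "(\<Sum>i < length es. vmul X (g i) (dcoord X es i)) =
      (\<Sum>i < length es. vmul X (G (es ! i)) (partial (es ! i)))"
      using that by (intro sum.cong) (auto simp: dcoord_eq)
    also have "\<dots> = vfield G" unfolding sum_es[of "\<lambda>b. vmul X (G b) (partial b)"] using vf_vmul[OF that(2)] by simp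
    finally show ?thesis .
  qed
  let ?g = "\<lambda>i. if i < length es then V (xcoord (es ! i)) else 0"
  have deg: "V (xcoord b) \<in> fns_deg X (j - dg b)" if "b \<in> B" for b
    using vf_deg[OF V xcoord_fns_deg[OF that]] by simp
  show "\<exists>!g. (\<forall>i<length es. g i \<in> fns_deg X (j - dg (es ! i))) \<and> (\<forall>i\<ge>length es. g i = 0) \<and>
     V = (\<Sum>i<length es. vmul X (g i) (dcoord X es i))"
  proof (rule ex1I[of _ ?g])
    show "(\<forall>i<length es. ?g i \<in> fns_deg X (j - dg (es ! i))) \<and> (\<forall>i\<ge>length es. ?g i = 0) \<and>
     V = (\<Sum>i<length es. vmul X (?g i) (dcoord X es i))"
      using comb[of ?g "\<lambda>b. V (xcoord b)"] deg fns_deg_fns[OF deg] vector_field_formula[OF V] by simp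
  next
    fix g assume g: "(\<forall>i<length es. g i \<in> fns_deg X (j - dg (es ! i))) \<and> (\<forall>i\<ge>length es. g i = 0) \<and>
     V = (\<Sum>i<length es. vmul X (g i) (dcoord X es i))"
    define G where "G b = g (inv_into {..<length es} ((!) es) b)" for b
    have gG: "g i = G (es ! i)" if "i < length es" for i
      using that es_bij by (simp add: G_def bij_betw_def inv_into_f_f)
    have G: "G b \<in> fns X" if "b \<in> B" for b
      using that g gG fns_deg_fns by (metis in_set_conv_nth)
    have "V = vfield G" using g comb[of g G, OF gG G] by simp
    then have "V (xcoord b) = G b" if "b \<in> B" for b using vf_xcoord[OF G that] by simp
    then show "g = ?g" using g gG by (intro ext) (simp add: not_less)
  qed
qed

text \<open>The square of an odd derivation is half its bracket with itself, hence again a derivation, and it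
suffices to test it on coordinates.\<close>

lemma vf_square_zero:
  assumes Q: "vector_field X 1 Q" and q: "\<And>b. b \<in> B \<Longrightarrow> Q (Q (xcoord b)) = 0" and phi: "\<phi> \<in> fns X"
  shows "Q (Q \<phi>) = 0"
proof -
  let ?V = "\<lambda>\<phi>. Q (Q \<phi>)"
  have V: "vector_field X 2 ?V"
    unfolding vector_field_def
  proof (intro conjI allI ballI impI)
    show "\<phi> \<notin> fns X \<Longrightarrow> ?V \<phi> = 0" for \<phi> using vf_out[OF Q] vf_zero[OF Q] by simp
    show "\<phi> \<in> fns X \<Longrightarrow> ?V \<phi> \<in> fns X" for \<phi> using vf_fns[OF Q] by simp
    show "\<phi> \<in> fns X \<Longrightarrow> \<psi> \<in> fns X \<Longrightarrow> ?V (\<phi> + \<psi>) = ?V \<phi> + ?V \<psi>" for \<phi> \<psi>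
      using vf_fns[OF Q] vf_add[OF Q] by simp
    show "\<phi> \<in> fns X \<Longrightarrow> ?V (fscale c \<phi>) = fscale c (?V \<phi>)" for \<phi> c
      using vf_fns[OF Q] vf_scale[OF Q] by simp
    fix i \<phi> assume p: "\<phi> \<in> fns_deg X i"
    note Qp = vf_deg[OF Q p] and pf = fns_deg_fns[OF p]
    show "?V \<phi> \<in> fns_deg X (i + 2)" using vf_deg[OF Q Qp] by (simp add: add.assoc)
    fix \<psi> assume s: "\<psi> \<in> fns X"
    have "ksgn ((i + 1) * 1) = - (ksgn (i * 1) :: 'k)" by (simp add: ksgn_def)
    then show "?V (fmul X \<phi> \<psi>) = fmul X (?V \<phi>) \<psi> + fscale (ksgn (i * 2)) (fmul X \<phi> (?V \<psi>))"
      using vf_mul[OF Q p s] vf_mul[OF Q Qp s] vf_mul[OF Q p vf_fns[OF Q s]] vf_fns[OF Q] pf s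
      by (simp add: vf_add[OF Q] vf_scale[OF Q] fscale_add)
        (simp add: fscale_def fun_eq_iff ksgn_def fun_apply)
  qed
  have Z: "vector_field X 2 (\<lambda>_. 0)"
    unfolding vector_field_def by (simp add: fns_deg_fns fscale_def fun_eq_iff fun_apply)
  show ?thesis using vf_eqI[OF V Z] q by metis
qed

end

section \<open>Coderivations as vector fields of degree one\<close>

context gspace begin

lemma homog_components:
  assumes "length ds = length xs" shows "homog X ds (map2 (component X) ds xs)"
  using assms component_gr by (auto simp: homog_def list_all2_conv_all_nth)

lemma hext_cong:
  assumes "\<And>ds xs. homog X ds xs \<Longrightarrow> \<Phi> ds xs = \<Phi>' ds xs"
  shows "hext X \<Phi> = hext X \<Phi>'"
  unfolding hext_def fun_eq_iff by (intro allI sum.cong refl assms homog_components) auto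

lemma hext_sum: "(\<Sum>a \<in> A. hext X (\<Phi> a)) = hext X (\<lambda>ds xs. \<Sum>a \<in> A. \<Phi> a ds xs)"
  unfolding fun_eq_iff sum_apply hext_def by (intro allI sum.swap)

lemma hext_fscale: "fscale c (hext X \<Phi>) = hext X (\<lambda>ds xs. c * \<Phi> ds xs)"
  by (simp add: fun_eq_iff fscale_def hext_def sum_distrib_left)

lemma homog_length: "homog X ds xs \<Longrightarrow> length ds = length xs"
  by (simp add: homog_def list_all2_lengthD)

lemma homog_nths: "homog X ds xs \<Longrightarrow> homog X (nths ds I) (nths xs I)"
  unfolding homog_def
proof (induction arbitrary: I rule: list_all2_induct)
  case (Cons d ds x xs)
  then show ?case by (simp add: nths_Cons)
qed simp

lemma homog_append: "homog X ds xs \<Longrightarrow> homog X ds' xs' \<Longrightarrow> homog X (ds @ ds') (xs @ xs')"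
  unfolding homog_def by (rule list_all2_appendI)

lemma homog_single [simp]: "homog X [d] [x] \<longleftrightarrow> x \<in> gr X d"
  by (simp add: homog_def)

text \<open>Stated for a general sign rule \<open>\<kappa>\<close>, because it serves symmetric functions on the shifted space as
well as skew brackets on the original one.\<close>

lemma move_last:
  assumes h: "vector_space (smul h)"
    and s: "\<And>us ws x y a b. x \<in> gr X a \<Longrightarrow> y \<in> gr X b \<Longrightarrow>
       F (us @ [x, y] @ ws) = smul h (\<kappa> a b) (F (us @ [y, x] @ ws))"
    and y: "y \<in> gr X b" and ws: "homog X ds ws"
  shows "F (us @ y # ws) = smul h (prod_list (map (\<kappa> b) ds)) (F (us @ ws @ [y]))"
proof -
  interpret h: vector_space "smul h" by fact
  show ?thesis using ws unfolding homog_def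
  proof (induction arbitrary: us rule: list_all2_induct)
    case (Cons d ds x ws)
    have "F (us @ y # x # ws) = smul h (\<kappa> b d) (F ((us @ [x]) @ y # ws))"
      using s[OF y Cons(1), of us ws] by simp
    then show ?case using Cons(3)[of "us @ [x]"] by simp
  qed simp
qed

lemma prod_list_ksgn: "prod_list (map (\<lambda>d. ksgn (b * d)) ds) = (ksgn (b * sum_list ds) :: 'k)"
  by (induction ds) (simp_all add: distrib_left ksgn_add)

lemma prod_list_neg_ksgn:
  "prod_list (map (\<lambda>d. - ksgn (b * d)) ds) = (ksgn (int (length ds) + b * sum_list ds) :: 'k)"
  by (induction ds) (simp_all add: distrib_left ksgn_add)

lemma fns_move_last:
  assumes "\<phi> \<in> fns X" "y \<in> gr X b" "homog X ds ws"
  shows "\<phi> (y # ws) = ksgn (b * sum_list ds) * \<phi> (ws @ [y])"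
proof -
  have "\<phi> ([] @ y # ws) = smul ground (prod_list (map (\<lambda>d. ksgn (b * d)) ds)) (\<phi> ([] @ ws @ [y]))"
    by (rule move_last[OF vs_ground _ assms(2,3), where \<kappa> = "\<lambda>a b. ksgn (a * b)"])
      (use assms(1) gsymD in \<open>unfold fns_iff smul_ground, blast\<close>)
  then show ?thesis by (simp add: prod_list_ksgn)
qed

text \<open>The components of a coderivation of degree \<open>1\<close> of the reduced symmetric coalgebra.\<close>

definition coder_data :: "('v list \<Rightarrow> 'v) \<Rightarrow> bool" where
  "coder_data T \<longleftrightarrow> mlin X X T \<and> gsym X X T \<and> of_degree X X (\<lambda>_. 1) T \<and> T [] = 0"

text \<open>The sign is that of \<open>Q(x\<^sup>a) = (-1)\<^bsup>|x\<^sup>a|\<^esup> x\<^sup>a \<circ> D\<close>.\<close>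

definition Qcoeff :: "('v list \<Rightarrow> 'v) \<Rightarrow> 'v \<Rightarrow> ('k, 'v) fn" where
  "Qcoeff T a w = ksgn (dg a) * rep (T w) a"

lemma coder_dataD:
  assumes "coder_data T"
  shows "mlin X X T" "gsym X X T" "homog X ds xs \<Longrightarrow> T xs \<in> gr X (sum_list ds + 1)" "T [] = 0"
  using assms unfolding coder_data_def of_degree_def by auto

lemma Qcoeff_fns_deg:
  assumes "coder_data T" "a \<in> B" shows "Qcoeff T a \<in> fns_deg X (1 - dg a)"
proof -
  note T = coder_dataD[OF assms(1)]
  have "mlin X ground (Qcoeff T a)"
    using T(1) unfolding mlin_def lin_def Qcoeff_def by (auto simp: rep_add rep_scale algebra_simps)
  moreover have "gsym X ground (Qcoeff T a)"
    unfolding gsym_def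
  proof (intro allI impI)
    fix us ws x y i j assume "x \<in> gr X i" "y \<in> gr X j"
    then have "T (us @ [x, y] @ ws) = smul X (ksgn (i * j)) (T (us @ [y, x] @ ws))"
      using T(2) unfolding gsym_def by blast
    then show "Qcoeff T a (us @ [x, y] @ ws) = smul ground (ksgn (i * j)) (Qcoeff T a (us @ [y, x] @ ws))"
      unfolding Qcoeff_def smul_ground by (simp only: rep_scale mult.left_commute)
  qed
  ultimately have "Qcoeff T a \<in> fns X" by (simp add: fns_iff)
  moreover have "sum_list ds = - (1 - dg a)" if "homog X ds xs" "Qcoeff T a xs \<noteq> 0" for ds xs
    using rep_homog[OF T(3)[OF that(1)] assms(2)] that(2) by (simp add: Qcoeff_def)
  ultimately show ?thesis unfolding fns_deg_def of_degree_ground by blast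
qed

lemma Qcoeff_fns: "coder_data T \<Longrightarrow> a \<in> B \<Longrightarrow> Qcoeff T a \<in> fns X"
  using Qcoeff_fns_deg fns_deg_fns by blast

text \<open>Only basis vectors of the degree of \<open>y\<close> contribute, so the sign may be taken out.\<close>

lemma contract_last:
  assumes "mlin X ground \<phi>" "y \<in> gr X i"
  shows "(\<Sum>a \<in> B. ksgn (dg a) * rep y a * \<phi> (us @ [a])) = ksgn i * \<phi> (us @ [y])"
proof -
  have "\<phi> (us @ [y]) = (\<Sum>a \<in> B. rep y a * \<phi> (us @ [a]))"
    using lin_expand[of ground "\<lambda>x. \<phi> (us @ [x])" y] assms(1) unfolding mlin_def by simp
  moreover have "ksgn (dg a) * rep y a = (ksgn i * rep y a :: 'k)" if "a \<in> B" for a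
    using rep_homog[OF assms(2) that] by (cases "rep y a = 0") auto
  ultimately show ?thesis
    by (simp only: sum_distrib_left mult.assoc[symmetric]) (rule sum.cong, simp_all)
qed

lemma vf_Qcoeff_terms:
  assumes T: "coder_data T" and phi: "\<phi> \<in> fns X" and hom: "homog X ds xs"
  shows "(\<Sum>a \<in> B. \<Sum>K \<in> Pow {..<length xs}. ukoszul ds ({..<length xs} - K) * Qcoeff T a (nths xs K) *
      pder a \<phi> (nths xs ({..<length xs} - K))) =
    (\<Sum>K \<in> Pow {..<length xs}. ukoszul ds ({..<length xs} - K) * ksgn (sum_list (nths ds K) + 1) *
      \<phi> (nths xs ({..<length xs} - K) @ [T (nths xs K)]))"
proof (subst sum.swap, intro sum.cong refl)
  fix K
  have "(\<Sum>a \<in> B. ukoszul ds ({..<length xs} - K) * Qcoeff T a (nths xs K) *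
      pder a \<phi> (nths xs ({..<length xs} - K))) =
    ukoszul ds ({..<length xs} - K) * (\<Sum>a \<in> B. ksgn (dg a) * rep (T (nths xs K)) a *
      \<phi> (nths xs ({..<length xs} - K) @ [a]))"
    by (simp add: sum_distrib_left Qcoeff_def pder_def mult.assoc)
  also have "\<dots> = ukoszul ds ({..<length xs} - K) * ksgn (sum_list (nths ds K) + 1) *
      \<phi> (nths xs ({..<length xs} - K) @ [T (nths xs K)])"
    using contract_last[OF fns_mlin[OF phi] coder_dataD(3)[OF T homog_nths[OF hom]]]
    by (simp add: mult.assoc)
  finally show "(\<Sum>a \<in> B. ukoszul ds ({..<length xs} - K) * Qcoeff T a (nths xs K) *
      pder a \<phi> (nths xs ({..<length xs} - K))) = ukoszul ds ({..<length xs} - K) *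
      ksgn (sum_list (nths ds K) + 1) * \<phi> (nths xs ({..<length xs} - K) @ [T (nths xs K)])" .
qed

lemma vf_Qcoeff_homog:
  assumes T: "coder_data T" and phi: "\<phi> \<in> fns X" and hom: "homog X ds xs"
  shows "vfield (Qcoeff T) \<phi> xs =
    (\<Sum>K \<in> Pow {..<length xs}. ukoszul ds ({..<length xs} - K) * ksgn (sum_list (nths ds K) + 1) *
      \<phi> (nths xs ({..<length xs} - K) @ [T (nths xs K)]))"
  unfolding vf_Qcoeff_terms[OF assms, symmetric]
  using phi Qcoeff_fns[OF T]
  by (auto simp: vfield_def sum_apply fmul_homog[OF fns_mlin fns_mlin hom] intro!: sum.cong)

text \<open>The inner value \<open>T(x\<^sub>J)\<close> stands first in \<open>\<phi> \<circ> D\<close> and last in \<open>\<Sum>\<^sub>a Q\<^sup>a \<partial>\<^sub>a \<phi>\<close>. Moving it costs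
\<open>(|x\<^sub>J| + 1) |x\<^sub>I|\<close>, and the total degree \<open>|x\<^sub>I| + |x\<^sub>J| + 1 = -i\<close> of a nonzero term absorbs the rest of
the sign into the factor \<open>(-1)\<^sup>i\<close>.\<close>

lemma vf_Qcoeff_comp_coder:
  assumes T: "coder_data T" and phi: "\<phi> \<in> fns_deg X i"
  shows "vfield (Qcoeff T) \<phi> = fscale (ksgn i) (comp_coder X T \<phi>)"
proof -
  note phif = fns_deg_fns[OF phi]
  have "vfield (Qcoeff T) \<phi> = hext X (\<lambda>ds xs. \<Sum>a \<in> B. \<Sum>K \<in> Pow {..<length xs}. let J = {..<length xs} - K in
       koszul (unshuffle K J) ds * ksgn (sum_list (nths ds K) * sum_list (nths ds J)) *
       Qcoeff T a (nths xs K) * pder a \<phi> (nths xs J))"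
    using phif by (simp add: vfield_def fmul_def hext_sum)
  also have "\<dots> = hext X (\<lambda>ds xs. ksgn i * (\<Sum>J \<in> Pow {..<length xs} - {{}}.
     let I = {..<length xs} - J in koszul (unshuffle J I) ds * \<phi> (T (nths xs J) # nths xs I)))"
  proof (rule hext_cong)
    fix ds xs assume hom: "homog X ds xs"
    note l = homog_length[OF hom]
    have "(\<Sum>a \<in> B. \<Sum>K \<in> Pow {..<length xs}. let J = {..<length xs} - K in
       koszul (unshuffle K J) ds * ksgn (sum_list (nths ds K) * sum_list (nths ds J)) *
       Qcoeff T a (nths xs K) * pder a \<phi> (nths xs J)) =
      (\<Sum>a \<in> B. \<Sum>K \<in> Pow {..<length xs}. ukoszul ds ({..<length xs} - K) * Qcoeff T a (nths xs K) *
      pder a \<phi> (nths xs ({..<length xs} - K)))"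
      by (intro sum.cong refl) (auto simp: Let_def l[symmetric] fmul_sign)
    also have "\<dots> = (\<Sum>K \<in> Pow {..<length xs}. ukoszul ds ({..<length xs} - K) * ksgn (sum_list (nths ds K) + 1) *
      \<phi> (nths xs ({..<length xs} - K) @ [T (nths xs K)]))"
      by (rule vf_Qcoeff_terms[OF T phif hom])
    also have "\<dots> = (\<Sum>K \<in> Pow {..<length xs} - {{}}. ukoszul ds ({..<length xs} - K) *
       ksgn (sum_list (nths ds K) + 1) * \<phi> (nths xs ({..<length xs} - K) @ [T (nths xs K)]))"
      by (rule sum.mono_neutral_right)
        (use mlin_zero[OF fns_mlin[OF phif]] in \<open>auto simp: coder_dataD(4)[OF T]\<close>)
    also have "\<dots> = (\<Sum>K \<in> Pow {..<length xs} - {{}}. ksgn i *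
       (ukoszul ds K * \<phi> (T (nths xs K) # nths xs ({..<length xs} - K))))"
    proof (intro sum.cong refl)
      fix K assume "K \<in> Pow {..<length xs} - {{}}"
      then have K: "K \<subseteq> {..<length ds}" using l by auto
      let ?R = "{..<length xs} - K"
      let ?k = "sum_list (nths ds K)" and ?r = "sum_list (nths ds ?R)"
      have TK: "T (nths xs K) \<in> gr X (?k + 1)" by (rule coder_dataD(3)[OF T homog_nths[OF hom]])
      have m: "\<phi> (T (nths xs K) # nths xs ?R) = ksgn ((?k + 1) * ?r) * \<phi> (nths xs ?R @ [T (nths xs K)])"
        by (rule fns_move_last[OF phif TK homog_nths[OF hom]])
      have c: "ukoszul ds ?R = ukoszul ds K * (ksgn (?k * ?r) :: 'k)" using ukoszul_compl[OF K] l by simp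
      show "ukoszul ds ?R * ksgn (?k + 1) * \<phi> (nths xs ?R @ [T (nths xs K)]) =
        ksgn i * (ukoszul ds K * \<phi> (T (nths xs K) # nths xs ?R))"
      proof (cases "\<phi> (nths xs ?R @ [T (nths xs K)]) = 0")
        case False
        have "homog X (nths ds ?R @ [?k + 1]) (nths xs ?R @ [T (nths xs K)])"
          using TK by (intro homog_append homog_nths hom) simp
        from fns_deg_homog[OF phi this False] have "i = - (?r + ?k + 1)" by simp
        then have "ksgn (?k * ?r) * ksgn (?k + 1) = ksgn i * (ksgn ((?k + 1) * ?r) :: 'k)"
          unfolding ksgn_add[symmetric] by (intro ksgn_cong) auto
        from arg_cong[OF this, of "\<lambda>z. ukoszul ds K * z * \<phi> (nths xs ?R @ [T (nths xs K)])"]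
        show ?thesis unfolding m c by (simp only: mult_ac)
      qed (simp add: m)
    qed
    finally show "(\<Sum>a \<in> B. \<Sum>K \<in> Pow {..<length xs}. let J = {..<length xs} - K in
       koszul (unshuffle K J) ds * ksgn (sum_list (nths ds K) * sum_list (nths ds J)) *
       Qcoeff T a (nths xs K) * pder a \<phi> (nths xs J)) =
      ksgn i * (\<Sum>J \<in> Pow {..<length xs} - {{}}.
     let I = {..<length xs} - J in koszul (unshuffle J I) ds * \<phi> (T (nths xs J) # nths xs I))"
      by (simp add: ukoszul_def l sum_distrib_left Let_def)
  qed
  finally show ?thesis by (simp add: comp_coder_def hext_fscale)
qed

lemma Qcoeff_vector_field: "coder_data T \<Longrightarrow> vector_field X 1 (vfield (Qcoeff T))"
  by (intro vf_vector_field Qcoeff_fns_deg)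

lemma Qcoeff_xcoord: "coder_data T \<Longrightarrow> b \<in> B \<Longrightarrow> vfield (Qcoeff T) (xcoord b) = Qcoeff T b"
  by (intro vf_xcoord Qcoeff_fns)

lemma the_vf_Qcoeff:
  assumes T: "coder_data T"
  shows "(THE Q. vector_field X 1 Q \<and> (\<forall>i. \<forall>\<phi> \<in> fns_deg X i \<inter> ideal0 X.
     Q \<phi> = fscale (ksgn i) (comp_coder X T \<phi>))) = vfield (Qcoeff T)"
proof (rule the_equality)
  show "vector_field X 1 (vfield (Qcoeff T)) \<and> (\<forall>i. \<forall>\<phi> \<in> fns_deg X i \<inter> ideal0 X.
     vfield (Qcoeff T) \<phi> = fscale (ksgn i) (comp_coder X T \<phi>))"
    using Qcoeff_vector_field[OF T] vf_Qcoeff_comp_coder[OF T] by blast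
  fix Q assume Q: "vector_field X 1 Q \<and> (\<forall>i. \<forall>\<phi> \<in> fns_deg X i \<inter> ideal0 X.
     Q \<phi> = fscale (ksgn i) (comp_coder X T \<phi>))"
  show "Q = vfield (Qcoeff T)"
  proof (rule vf_eqI[OF _ Qcoeff_vector_field[OF T]])
    fix b assume b: "b \<in> B"
    then have "xcoord b \<in> fns_deg X (- dg b) \<inter> ideal0 X" using xcoord_fns_deg by (simp add: ideal0_def)
    then show "Q (xcoord b) = vfield (Qcoeff T) (xcoord b)" using Q vf_Qcoeff_comp_coder[OF T xcoord_fns_deg[OF b]] by metis
  qed (use Q in blast)
qed

lemma Qcoeff_inject:
  assumes "coder_data T" "coder_data T'" "vfield (Qcoeff T) = vfield (Qcoeff T')" shows "T = T'"
proof
  fix w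
  have "Qcoeff T b w = Qcoeff T' b w" if "b \<in> B" for b using assms Qcoeff_xcoord[OF _ that] by metis
  then show "T w = T' w" by (intro rep_eqI) (simp add: Qcoeff_def)
qed

text \<open>The values on coordinates are, up to sign, the coordinates of the map \<open>T\<close>. That \<open>Q\<close> vanishes at \<open>0\<close>
makes \<open>T\<close> vanish on the empty word.\<close>

lemma Qcoeff_surject:
  assumes Q: "vector_field X 1 Q" and Q0: "\<And>\<phi>. \<phi> \<in> fns X \<Longrightarrow> Q \<phi> [] = 0"
  obtains T where "coder_data T" "Q = vfield (Qcoeff T)"
proof
  define T where "T w = (\<Sum>b \<in> B. smul X (ksgn (dg b) * Q (xcoord b) w) b)" for w
  have G: "Q (xcoord b) \<in> fns_deg X (1 - dg b)" if "b \<in> B" for b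
    using vf_deg[OF Q xcoord_fns_deg[OF that]] by simp
  note Gf = fns_deg_fns[OF G]
  have rT: "rep (T w) b = ksgn (dg b) * Q (xcoord b) w" if "b \<in> B" for b w
    unfolding T_def by (rule rep_comb[OF that])
  show "coder_data T"
    unfolding coder_data_def
  proof (intro conjI)
    show "mlin X X T"
      unfolding mlin_def lin_def
    proof (intro allI conjI rep_eqI)
      fix us vs x y c b assume b: "b \<in> B"
      have "lin X ground (\<lambda>x. Q (xcoord b) (us @ x # vs))"
        using fns_mlin[OF Gf[OF b]] by (simp add: mlin_def)
      then show "rep (T (us @ (x + y) # vs)) b = rep (T (us @ x # vs) + T (us @ y # vs)) b"
        "rep (T (us @ smul X c x # vs)) b = rep (smul X c (T (us @ x # vs))) b"
        by (simp_all add: b rT rep_add rep_scale lin_def distrib_left mult_ac)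
    qed
    show "gsym X X T"
      unfolding gsym_def
    proof (intro allI impI rep_eqI)
      fix us ws x y i j b assume "x \<in> gr X i" "y \<in> gr X j" and b: "b \<in> B"
      then have "Q (xcoord b) (us @ [x, y] @ ws) = ksgn (i * j) * Q (xcoord b) (us @ [y, x] @ ws)"
        using Gf[OF b] gsymD unfolding fns_iff by blast
      then show "rep (T (us @ [x, y] @ ws)) b = rep (smul X (ksgn (i * j)) (T (us @ [y, x] @ ws))) b"
        by (simp only: rT[OF b] rep_scale mult.left_commute)
    qed
    show "of_degree X X (\<lambda>_. 1) T"
      unfolding of_degree_def
    proof (intro allI impI)
      fix ds xs assume h: "homog X ds xs"
      show "T xs \<in> gr X (sum_list ds + 1)"
        unfolding T_def
      proof (rule gr_sum)
        fix b assume b: "b \<in> B"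
        show "smul X (ksgn (dg b) * Q (xcoord b) xs) b \<in> gr X (sum_list ds + 1)"
        proof (cases "Q (xcoord b) xs = 0")
          case False
          then have "sum_list ds + 1 = dg b" using fns_deg_homog[OF G[OF b] h] by simp
          then show ?thesis using basis_gr[OF b] by (simp add: gr_scale)
        qed simp
      qed
    qed
    show "T [] = 0" using Q0 by (simp add: T_def)
  qed
  then show "Q = vfield (Qcoeff T)"
    by (intro vf_eqI[OF Q Qcoeff_vector_field]) (auto simp: Qcoeff_xcoord Qcoeff_def rT fun_eq_iff)
qed

text \<open>\<open>Q\<^sup>2\<close> is a derivation, so it vanishes as soon as all \<open>Q(Q\<^sup>b)\<close> do. These are the coordinates of the
quadratic expressions in \<open>T\<close>.\<close>

lemma homological_iff:
  assumes T: "coder_data T"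
  shows "homological X (vfield (Qcoeff T)) \<longleftrightarrow>
    (\<forall>ds xs. homog X ds xs \<longrightarrow>
      (\<Sum>K \<in> Pow {..<length xs}. smul X (ukoszul ds ({..<length xs} - K) * ksgn (sum_list (nths ds K) + 1))
        (T (nths xs ({..<length xs} - K) @ [T (nths xs K)]))) = 0)"
proof -
  let ?Q = "vfield (Qcoeff T)"
  let ?S = "\<lambda>ds xs. \<Sum>K \<in> Pow {..<length xs}.
     smul X (ukoszul ds ({..<length xs} - K) * ksgn (sum_list (nths ds K) + 1))
        (T (nths xs ({..<length xs} - K) @ [T (nths xs K)]))"
  note Q = Qcoeff_vector_field[OF T]
  have Q0: "?Q \<phi> [] = 0" if "\<phi> \<in> fns X" for \<phi>
    using vf_Qcoeff_homog[OF T that, of "[]" "[]"] mlin_zero[OF fns_mlin[OF that], of "[0]"]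
    by (simp add: coder_dataD(4)[OF T])
  have E: "?Q (Qcoeff T b) xs = ksgn (dg b) * rep (?S ds xs) b" if "b \<in> B" "homog X ds xs" for b ds xs
    unfolding vf_Qcoeff_homog[OF T Qcoeff_fns[OF T that(1)] that(2)]
    by (simp add: rep_sum_fun rep_scale sum_distrib_left Qcoeff_def mult_ac)
  show ?thesis
  proof
    assume h: "homological X ?Q"
    show "\<forall>ds xs. homog X ds xs \<longrightarrow> ?S ds xs = 0"
    proof (intro allI impI rep_eqI)
      fix ds xs b assume hom: "homog X ds xs" and b: "b \<in> B"
      have "?Q (Qcoeff T b) = 0" using h b Qcoeff_xcoord[OF T b] xcoord_fns[OF b] unfolding homological_def by metis
      then show "rep (?S ds xs) b = rep 0 b" using E[OF b hom] by (simp add: fun_apply)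
    qed
  next
    assume S: "\<forall>ds xs. homog X ds xs \<longrightarrow> ?S ds xs = 0"
    have "?Q (?Q (xcoord b)) = 0" if b: "b \<in> B" for b
      unfolding Qcoeff_xcoord[OF T b]
    proof (rule fns_eqI)
      fix w assume w: "w \<in> lists B"
      show "?Q (Qcoeff T b) w = 0 w"
        using E[OF b homog_basis[OF w]] S homog_basis[OF w] by (simp add: fun_apply)
    qed (use vf_fns[OF Q Qcoeff_fns[OF T b]] in auto)
    then show "homological X ?Q"
      unfolding homological_def using Q vf_square_zero[OF Q] Q0 by blast
  qed
qed

end

section \<open>Brackets before and after the shift\<close>

lemma smul_shift [simp]: "smul (shift1 g) = smul g"
  by (simp add: shift1_def)

lemma gr_shift [simp]: "gr (shift1 g) i = gr g (i + 1)"
  by (simp add: shift1_def)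

lemma mlin_shift [simp]: "mlin (shift1 g) h = mlin g h" "mlin h (shift1 g) = mlin h g"
  by (simp_all add: mlin_def lin_def fun_eq_iff)

lemma homog_shift: "homog (shift1 g) ds xs \<longleftrightarrow> homog g (map (\<lambda>a. a + 1) ds) xs"
  by (simp add: homog_def list_all2_map1)

lemma homog_unshift: "homog g ds xs \<longleftrightarrow> homog (shift1 g) (map (\<lambda>a. a - 1) ds) xs"
  by (simp add: homog_def list_all2_map1)

lemma gspace_shift:
  assumes "gspace g es" shows "gspace (shift1 g) es"
proof
  interpret gspace g es by fact
  have decal: "decomposition (shift1 g) v c \<longleftrightarrow> decomposition g v (\<lambda>i. c (i - 1))" for v and c :: "int \<Rightarrow> 'b"
  proof -
    have i: "bij_betw (\<lambda>i. i + 1) {i. c i \<noteq> 0} {i. c (i - 1) \<noteq> 0}"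
      by (rule bij_betw_byWitness[where f' = "\<lambda>i. i - 1"]) auto
    have "(\<forall>i. c i \<in> gr g (i + 1)) \<longleftrightarrow> (\<forall>i. c (i - 1) \<in> gr g i)"
      by (metis add_diff_cancel_right' diff_add_cancel)
    moreover have "(\<Sum>i | c i \<noteq> 0. c i) = (\<Sum>i | c (i - 1) \<noteq> 0. c (i - 1))"
      using sum.reindex_bij_betw[OF i, of "\<lambda>i. c (i - 1)"] by simp
    ultimately show ?thesis using bij_betw_finite[OF i] by (simp add: decomposition_def)
  qed
  have "\<exists>!c. decomposition (shift1 g) v c" for v
  proof -
    obtain c where c: "decomposition g v c" "\<And>c'. decomposition g v c' \<Longrightarrow> c' = c"
      using gs unfolding graded_space_def by metis
    show ?thesis
    proof
      show "decomposition (shift1 g) v (\<lambda>i. c (i + 1))" using c(1) by (simp add: decal)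
      fix c' assume "decomposition (shift1 g) v c'"
      then have "(\<lambda>i. c' (i - 1)) = c" using c(2) decal by blast
      then show "c' = (\<lambda>i. c (i + 1))" by auto
    qed
  qed
  then show "graded_space (shift1 g)"
    using gs gr_subspace by (simp add: graded_space_def)
  show "homogeneous_basis (shift1 g) es"
    using hb unfolding homogeneous_basis_def by simp (metis diff_add_cancel)
qed

lemma decal_swap: "decal (us @ [a, b] @ ws) = ksgn (a + b) * (decal (us @ [b, a] @ ws) :: 'k::field_char_0)"
proof (induction ws rule: rev_induct)
  case Nil
  show ?case
    using decal_snoc[of "us @ [a]" b, where 'k = 'k] decal_snoc[of us a, where 'k = 'k]
      decal_snoc[of "us @ [b]" a, where 'k = 'k] decal_snoc[of us b, where 'k = 'k]
    by (simp add: ksgn_add)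
next
  case (snoc c ws)
  then show ?case
    using decal_snoc[of "us @ [a, b] @ ws" c, where 'k = 'k] decal_snoc[of "us @ [b, a] @ ws" c, where 'k = 'k]
    by (simp add: add_ac)
qed

lemma decal_remove: "decal (us @ a # vs) = ksgn (sum_list us + a * int (length vs)) * (decal (us @ vs) :: 'k::field_char_0)"
proof (induction vs rule: rev_induct)
  case Nil
  show ?case using decal_snoc[of us a, where 'k = 'k] by (simp add: mult.commute)
next
  case (snoc c vs)
  then show ?case
    using decal_snoc[of "us @ a # vs" c, where 'k = 'k] decal_snoc[of "us @ vs" c, where 'k = 'k]
    by (simp add: ksgn_add distrib_left mult_ac)
qed

lemma ukoszul_all: "ukoszul ds {..<length ds} = (1 :: 'k::field_char_0)"
proof (induction ds rule: rev_induct)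
  case (snoc a ds)
  then show ?case using ukoszul_into[of "{..<length ds}" ds a, where 'a = 'k] by (simp add: lessThan_Suc)
qed simp

lemma nths_length_empty: "nths us {length us} = []"
  using set_nths[of us "{length us}"] by simp

lemma ukoszul_remove:
  "ukoszul (us @ a # vs) ({..<length (us @ a # vs)} - {length us}) = (ksgn (a * sum_list vs) :: 'k::field_char_0)"
proof (induction vs rule: rev_induct)
  case Nil
  have "{..<Suc (length us)} - {length us} = {..<length us}" by auto
  then show ?case using ukoszul_out[of "{..<length us}" us a, where 'a = 'k] ukoszul_all[of us, where 'k = 'k] by simp
next
  case (snoc c vs)
  let ?w = "us @ a # vs"
  let ?R = "{..<length ?w} - {length us}"
  have 1: "{..<length (us @ a # vs @ [c])} - {length us} = insert (length ?w) ?R" by auto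
  have 2: "{..<length ?w} - ?R = {length us}" by auto
  have "nths ?w {length us} = [a]"
    by (subst nths_append) (simp add: nths_Cons nths_length_empty)
  then have "ukoszul (?w @ [c]) (insert (length ?w) ?R) = ukoszul ?w ?R * (ksgn (c * a) :: 'k)"
    using ukoszul_into[of ?R ?w c, where 'a = 'k] unfolding 2 by simp
  then show ?case using snoc unfolding 1 by (simp add: ksgn_add distrib_left mult_ac)
qed

lemma nths_remove: "nths (us @ x # vs) ({..<length (us @ x # vs)} - {length us}) = us @ vs"
  "nths (us @ x # vs) {length us} = [x]"
proof -
  have "nths vs {j. Suc (j + length us) \<in> {..<length (us @ x # vs)} - {length us}} = vs"
    by (rule nths_all) auto
  moreover have "nths us ({..<length (us @ x # vs)} - {length us}) = us"
    by (rule nths_all) auto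
  ultimately show "nths (us @ x # vs) ({..<length (us @ x # vs)} - {length us}) = us @ vs"
    by (simp add: nths_append nths_Cons)
  have "nths us {length us} = []" "nths vs {j. Suc (j + length us) \<in> {length us}} = []"
    by (simp_all add: nths_length_empty)
  then show "nths (us @ x # vs) {length us} = [x]"
    by (simp add: nths_append nths_Cons)
qed

lemma quad_term_decal:
  fixes h :: "('k::field_char_0, 'w::ab_group_add) gvs"
  assumes "length xs = length ds" "R \<subseteq> {..<length xs}"
  shows "quad_term h F L (map (\<lambda>a. a + 1) ds) xs R =
    smul h (ukoszul ds R * decal ds * decal (nths ds R) * decal (nths ds ({..<length xs} - R)))
      (F (nths xs R @ [L (nths xs ({..<length xs} - R))]))"
proof -
  have R: "R \<subseteq> {..<length ds}" using assms by simp
  show ?thesis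
    unfolding quad_term_def Let_def decalage_sign[OF R, symmetric, where 'k = 'k] assms(1)
    by (simp add: ukoszul_def)
qed

text \<open>The differential becomes the bracket with one argument. The sign is that of \<open>d\<close> on the shifted
space, and it lets \<open>\<partial>\<close> of a bracket appear among the quadratic terms.\<close>

definition full_l :: "('v::ab_group_add \<Rightarrow> 'v) \<Rightarrow> ('v list \<Rightarrow> 'v) \<Rightarrow> 'v list \<Rightarrow> 'v" where
  "full_l d l xs = (if length xs = 1 then - d (hd xs) else l xs)"

locale shifted = g: gspace g es + X: gspace "shift1 g" es
  for g :: "('k::field_char_0, 'v::ab_group_add) gvs" and es :: "'v list"
begin

abbreviation "sg \<equiv> shift1 g"

lemma hdeg_shift: "b \<in> set es \<Longrightarrow> hdeg g b = hdeg sg b + 1"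
  using X.basis_gr[of b] g.hdeg_eq[OF _ g.basis_nonzero] by simp

lemma ps_hmlin:
  assumes h: "vector_space (smul h)" and F: "mlin g h F"
  shows "hmlin sg h (\<lambda>ds xs. smul h (ksgn (\<Sum>j < length xs. sum_list (take j ds))) (F xs))"
  unfolding hmlin_def
proof (intro allI impI)
  fix ds :: "int list" and us vs
  have "lin sg h (\<lambda>x. smul h (ksgn (\<Sum>j < Suc (length us + length vs). sum_list (take j ds))) (F (us @ x # vs)))"
    using F by (intro lin_scale[OF h]) (simp add: mlin_def lin_def)
  then show "lin sg h (\<lambda>x. smul h (ksgn (\<Sum>j < length (us @ x # vs). sum_list (take j ds))) (F (us @ x # vs)))"
    by simp
qed

lemma ps_mlin: "vector_space (smul h) \<Longrightarrow> mlin g h F \<Longrightarrow> mlin g h (precomp_s g h F)"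
  using X.hext_mlin[OF _ ps_hmlin] by (simp add: precomp_s_def)

lemma ps_homog:
  assumes "vector_space (smul h)" "mlin g h F" "homog sg ds xs"
  shows "precomp_s g h F xs = smul h (decal ds) (F xs)"
  unfolding precomp_s_def using X.hext_homog[OF ps_hmlin[OF assms(1,2)] assms(3)]
  by (simp add: decal_def X.homog_length[OF assms(3)])

lemma ps_word:
  "vector_space (smul h) \<Longrightarrow> mlin g h F \<Longrightarrow> w \<in> lists (set es) \<Longrightarrow>
    precomp_s g h F w = smul h (decal (map (hdeg sg) w)) (F w)"
  by (intro ps_homog X.homog_basis)

lemma ps_invol:
  assumes h: "vector_space (smul h)" and F: "mlin g h F"
  shows "precomp_s g h (precomp_s g h F) = F"
proof -
  interpret h: vector_space "smul h" by fact
  show ?thesis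
    by (rule g.mlin_ext[OF ps_mlin[OF h ps_mlin[OF h F]] F])
      (simp add: ps_word[OF h ps_mlin[OF h F]] ps_word[OF h F])
qed

text \<open>Transposing neighbours of shifted degrees \<open>a\<close>, \<open>b\<close> changes \<open>decal\<close> by the exponent \<open>a + b\<close>, and
\<open>(a + 1)(b + 1) + 1 + a + b\<close> is congruent to \<open>a b\<close> modulo \<open>2\<close>.\<close>

lemma ps_gsym:
  assumes h: "vector_space (smul h)" and F: "mlin g h F" and s: "gskew g h F"
  shows "gsym sg h (precomp_s g h F)"
  unfolding gsym_def
proof (intro allI impI)
  interpret h: vector_space "smul h" by fact
  fix us ws x y a b assume "x \<in> gr sg a" "y \<in> gr sg b"
  then show "precomp_s g h F (us @ [x, y] @ ws) = smul h (ksgn (a * b)) (precomp_s g h F (us @ [y, x] @ ws))"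
  proof (rule X.sym_ext[OF h, rotated 2, where \<kappa> = "\<lambda>a b. ksgn (a * b)"])
    show "mlin sg h (precomp_s g h F)" using ps_mlin[OF h F] by simp
    fix us ws x y assume w: "us \<in> lists (set es)" "ws \<in> lists (set es)" "x \<in> set es" "y \<in> set es"
    let ?D = "hdeg sg"
    have w1: "us @ [x, y] @ ws \<in> lists (set es)" "us @ [y, x] @ ws \<in> lists (set es)" using w by auto
    have F': "F (us @ [x, y] @ ws) = - smul h (ksgn ((?D x + 1) * (?D y + 1))) (F (us @ [y, x] @ ws))"
      using s w(3,4)[THEN X.basis_gr] unfolding gskew_def gr_shift by blast
    have d: "decal (map ?D (us @ [x, y] @ ws)) = ksgn (?D x + ?D y) * (decal (map ?D (us @ [y, x] @ ws)) :: 'k)"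
      using decal_swap[of "map ?D us" "?D x" "?D y" "map ?D ws", where 'k = 'k] by simp
    have k: "- (ksgn (?D x + ?D y) * ksgn ((?D x + 1) * (?D y + 1))) = (ksgn (?D x * ?D y) :: 'k)"
      by (simp add: ksgn_def)
    show "precomp_s g h F (us @ [x, y] @ ws) = smul h (ksgn (?D x * ?D y)) (precomp_s g h F (us @ [y, x] @ ws))"
      unfolding ps_word[OF h F w1(1)] ps_word[OF h F w1(2)] F' d k[symmetric]
      by (simp only: h.scale_minus_right h.scale_minus_left h.scale_scale mult_minus_right
          mult_minus_left mult_ac)
  qed
qed

lemma ps_gskew:
  assumes h: "vector_space (smul h)" and F: "mlin g h F" and s: "gsym sg h F"
  shows "gskew g h (precomp_s g h F)"
  unfolding gskew_def
proof (intro allI impI)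
  interpret h: vector_space "smul h" by fact
  fix us ws x y a b assume "x \<in> gr g a" "y \<in> gr g b"
  then have "precomp_s g h F (us @ [x, y] @ ws) = smul h (- ksgn (a * b)) (precomp_s g h F (us @ [y, x] @ ws))"
  proof (rule g.sym_ext[OF h ps_mlin[OF h F], rotated 1, where \<kappa> = "\<lambda>a b. - ksgn (a * b)"])
    fix us ws x y assume w: "us \<in> lists (set es)" "ws \<in> lists (set es)" "x \<in> set es" "y \<in> set es"
    let ?D = "hdeg sg"
    have w1: "us @ [x, y] @ ws \<in> lists (set es)" "us @ [y, x] @ ws \<in> lists (set es)" using w by auto
    have F': "F (us @ [x, y] @ ws) = smul h (ksgn (?D x * ?D y)) (F (us @ [y, x] @ ws))"
      using s w(3,4)[THEN X.basis_gr] unfolding gsym_def by blast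
    have d: "decal (map ?D (us @ [x, y] @ ws)) = ksgn (?D x + ?D y) * (decal (map ?D (us @ [y, x] @ ws)) :: 'k)"
      using decal_swap[of "map ?D us" "?D x" "?D y" "map ?D ws", where 'k = 'k] by simp
    have k: "- ksgn (hdeg g x * hdeg g y) = (ksgn (?D x + ?D y) * ksgn (?D x * ?D y) :: 'k)"
      by (simp add: ksgn_def hdeg_shift w)
    show "precomp_s g h F (us @ [x, y] @ ws) = smul h (- ksgn (hdeg g x * hdeg g y)) (precomp_s g h F (us @ [y, x] @ ws))"
      unfolding ps_word[OF h F w1(1)] ps_word[OF h F w1(2)] F' d k
      by (simp only: h.scale_scale mult_ac)
  qed
  then show "precomp_s g h F (us @ [x, y] @ ws) = - smul h (ksgn (a * b)) (precomp_s g h F (us @ [y, x] @ ws))"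
    by (simp only: h.scale_minus_left)
qed

lemma ps_of_degree:
  assumes h: "vector_space (smul h)" and F: "mlin g h F"
    and gr: "\<And>c x i. x \<in> gr h i \<Longrightarrow> smul h c x \<in> gr h i"
  shows "of_degree g h r F \<Longrightarrow> of_degree sg h (\<lambda>n. r n + int n) (precomp_s g h F)"
    and "of_degree sg h r F \<Longrightarrow> of_degree g h (\<lambda>n. r n - int n) (precomp_s g h F)"
proof -
  assume d: "of_degree g h r F"
  show "of_degree sg h (\<lambda>n. r n + int n) (precomp_s g h F)"
    unfolding of_degree_def
  proof (intro allI impI)
    fix ds xs assume hom: "homog sg ds xs"
    have "F xs \<in> gr h (sum_list (map (\<lambda>a. a + 1) ds) + r (length xs))"
      using d hom unfolding of_degree_def homog_shift by blast
    then show "precomp_s g h F xs \<in> gr h (sum_list ds + (r (length xs) + int (length xs)))"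
      unfolding ps_homog[OF h F hom] sum_list_map_Suc X.homog_length[OF hom]
      by (intro gr) (simp add: add_ac)
  qed
next
  assume d: "of_degree sg h r F"
  show "of_degree g h (\<lambda>n. r n - int n) (precomp_s g h F)"
    unfolding of_degree_def
  proof (intro allI impI)
    fix ds xs assume "homog g ds xs"
    then have hom: "homog sg (map (\<lambda>a. a - 1) ds) xs" by (rule homog_unshift[THEN iffD1])
    then have "F xs \<in> gr h (sum_list (map (\<lambda>a. a - 1) ds) + r (length xs))"
      using d unfolding of_degree_def by blast
    moreover have "sum_list (map (\<lambda>a. a - 1) ds) = sum_list ds - int (length ds)"
      by (induction ds) simp_all
    ultimately show "precomp_s g h F xs \<in> gr h (sum_list ds + (r (length xs) - int (length xs)))"
      unfolding ps_homog[OF h F hom] using X.homog_length[OF hom]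
      by (intro gr) (simp add: algebra_simps)
  qed
qed

text \<open>A whole family of brackets, including the one with a single argument, as it corresponds to the
components of a coderivation under the shift.\<close>

definition skew_data :: "('v list \<Rightarrow> 'v) \<Rightarrow> bool" where
  "skew_data L \<longleftrightarrow> mlin g g L \<and> gskew g g L \<and> of_degree g g (\<lambda>n. 2 - int n) L \<and> L [] = 0"

lemmas vsg = g.vs.vector_space_axioms

lemma gsym_shift: "gsym X sg F = gsym X g F"
  by (simp add: gsym_def)

lemma of_degree_shift: "of_degree X sg r F = of_degree X g (\<lambda>n. r n + 1) F"
  by (simp add: of_degree_def add.assoc)

lemma ps_Nil:
  assumes "vector_space (smul h)" "mlin g h F" shows "precomp_s g h F [] = F []"
proof -
  interpret h: vector_space "smul h" by fact
  show ?thesis using ps_homog[OF assms, of "[]" "[]"] by simp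
qed

lemma skew_data_coder_data: "skew_data L \<Longrightarrow> X.coder_data (precomp_s g g L)"
  unfolding skew_data_def X.coder_data_def gsym_shift of_degree_shift
  using ps_mlin[OF vsg] ps_gsym[OF vsg] ps_of_degree(1)[OF vsg _ g.gr_scale, of L "\<lambda>n. 2 - int n"] ps_Nil[OF vsg]
  by auto

lemma coder_data_skew_data: "X.coder_data T \<Longrightarrow> skew_data (precomp_s g g T)"
  unfolding skew_data_def X.coder_data_def gsym_shift of_degree_shift
  using ps_mlin[OF vsg] ps_gskew[OF vsg] ps_of_degree(2)[OF vsg _ g.gr_scale, of T "\<lambda>n. 2"] ps_Nil[OF vsg]
  by auto

text \<open>The factor on the right depends on the whole word only, so sums over all splittings agree before
and after the shift up to a common sign.\<close>

lemma quad_decal: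
  assumes h: "vector_space (smul h)" and F: "mlin g h F" and L: "skew_data L"
    and hom: "homog sg ds xs" and R: "R \<subseteq> {..<length xs}"
  shows "smul h (ukoszul ds R * ksgn (sum_list (nths ds ({..<length xs} - R)) + 1))
      (precomp_s g h F (nths xs R @ [precomp_s g g L (nths xs ({..<length xs} - R))])) =
    smul h (ksgn (sum_list ds + 1) * decal ds) (quad_term h F L (map (\<lambda>a. a + 1) ds) xs R)"
proof -
  interpret h: vector_space "smul h" by fact
  note l = X.homog_length[OF hom]
  let ?K = "{..<length xs} - R"
  let ?k = "sum_list (nths ds ?K)" and ?r = "sum_list (nths ds R)"
  let ?T = "precomp_s g g L"
  have mL: "mlin g g L" using L by (simp add: skew_data_def)
  have TK: "?T (nths xs ?K) \<in> gr sg (?k + 1)"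
    by (rule X.coder_dataD(3)[OF skew_data_coder_data[OF L] X.homog_nths[OF hom]])
  have 1: "precomp_s g h F (nths xs R @ [?T (nths xs ?K)]) =
     smul h (decal (nths ds R) * ksgn ?r) (F (nths xs R @ [?T (nths xs ?K)]))"
    using ps_homog[OF h F X.homog_append[OF X.homog_nths[OF hom] X.homog_single[THEN iffD2, OF TK]]]
    by (simp add: decal_snoc)
  have 2: "?T (nths xs ?K) = smul g (decal (nths ds ?K)) (L (nths xs ?K))"
    by (rule ps_homog[OF vsg mL X.homog_nths[OF hom]])
  have 3: "F (us @ [smul g c x]) = smul h c (F (us @ [x]))" for us c x
    using F by (simp add: mlin_def lin_def)
  have s: "sum_list ds = ?r + ?k" using sum_list_nths_compl[of R ds] R l by simp
  have "(ukoszul ds R * ksgn (?k + 1)) * ((decal (nths ds R) * ksgn ?r) * decal (nths ds ?K)) =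
     (ksgn (sum_list ds + 1) * decal ds) * (ukoszul ds R * decal ds * decal (nths ds R) * decal (nths ds ?K) :: 'k)"
  proof -
    have "ksgn (?k + 1) * ksgn ?r = (ksgn (sum_list ds + 1) :: 'k)"
      unfolding s ksgn_add[symmetric] by (rule ksgn_cong) auto
    from arg_cong[OF this, of "\<lambda>z. z * (ukoszul ds R * decal (nths ds R) * decal (nths ds ?K))"]
    have "(ukoszul ds R * ksgn (?k + 1)) * ((decal (nths ds R) * ksgn ?r) * decal (nths ds ?K)) =
      ksgn (sum_list ds + 1) * (ukoszul ds R * decal (nths ds R) * decal (nths ds ?K) :: 'k)"
      by (simp only: mult_ac)
    also have "\<dots> = ksgn (sum_list ds + 1) * ((decal ds * decal ds) * (ukoszul ds R * decal (nths ds R) * decal (nths ds ?K)))"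
      by simp
    finally show ?thesis by (simp only: mult_ac)
  qed
  then show ?thesis
    unfolding 1 unfolding 2 3 quad_term_decal[OF l[symmetric] R] h.scale_scale by (simp only: mult_ac)
qed

text \<open>For a single inner letter, the sign of moving \<open>d x\<^sub>i\<close> back from the last place to the place \<open>i\<close>
cancels everything but the sign of moving \<open>d\<close> past the preceding arguments and a global sign.\<close>

lemma quad_single:
  assumes h: "vector_space (smul h)" and F: "mlin g h F" "gskew g h F"
    and d: "\<And>x i. x \<in> gr g i \<Longrightarrow> d x \<in> gr g (i + 1)" and Ld: "\<And>x. L [x] = - d x"
    and hom: "homog sg ds xs" and i: "i < length xs"
  shows "quad_term h F L (map (\<lambda>a. a + 1) ds) xs ({..<length xs} - {i}) =
    smul h (ksgn (int (length xs)))
      (smul h (ksgn (sum_list (take i (map (\<lambda>a. a + 1) ds)))) (F (xs[i := d (xs ! i)])))"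
proof -
  interpret h: vector_space "smul h" by fact
  note l = X.homog_length[OF hom]
  define us x vs where xs': "us = take i xs" "x = xs ! i" "vs = drop (Suc i) xs"
  define du a dv where ds': "du = take i ds" "a = ds ! i" "dv = drop (Suc i) ds"
  have xs: "xs = us @ x # vs" and ds: "ds = du @ a # dv" and i': "i = length us" "length du = length us" "length dv = length vs"
    using i l by (simp_all add: xs' ds' id_take_nth_drop)
  have x: "x \<in> gr g (a + 1)" and vs: "homog g (map (\<lambda>a. a + 1) dv) vs"
    using hom i' unfolding xs ds homog_def by (auto simp: list_all2_append list_all2_map1)
  let ?R = "{..<length xs} - {i}"
  have K: "{..<length xs} - ?R = {i}" using i by auto
  have R: "?R = {..<length (us @ x # vs)} - {length us}" "?R = {..<length (du @ a # dv)} - {length du}"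
    using i' by (auto simp: xs)
  have F0: "F (us @ [d x] @ vs) = smul h (prod_list (map (\<lambda>e. - ksgn ((a + 1 + 1) * e)) (map (\<lambda>a. a + 1) dv))) (F (us @ vs @ [d x]))"
  proof -
    have "F (us @ d x # vs) = smul h (prod_list (map (\<lambda>e. - ksgn ((a + 1 + 1) * e)) (map (\<lambda>a. a + 1) dv))) (F (us @ vs @ [d x]))"
      by (rule g.move_last[OF h _ d[OF x] vs, where \<kappa> = "\<lambda>a b. - ksgn (a * b)"])
        (use F(2) in \<open>unfold gskew_def h.scale_minus_left, blast\<close>)
    then show ?thesis by simp
  qed
  have neg: "F (us @ vs @ [- d x]) = - F (us @ vs @ [d x])"
  proof -
    have "lin g h (\<lambda>x. F ((us @ vs) @ x # []))" using F(1) unfolding mlin_def by blast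
    then have "F ((us @ vs) @ [smul g (- 1) (d x)]) = smul h (- 1) (F ((us @ vs) @ [d x]))"
      unfolding lin_def by blast
    then show ?thesis by simp
  qed
  have n1: "nths ds {i} = [a]" "nths ds ?R = du @ dv" "nths xs {i} = [x]" "nths xs ?R = us @ vs"
    using nths_remove[of du a dv] nths_remove[of us x vs] i' unfolding ds xs by auto
  have c1: "ukoszul ds ?R = (ksgn (a * sum_list dv) :: 'k)"
    unfolding R(2) ds using ukoszul_remove by simp
  have c2: "decal ds = ksgn (sum_list du + a * int (length vs)) * (decal (du @ dv) :: 'k)"
    unfolding ds using decal_remove[of du a dv, where 'k = 'k] i' by simp
  have c3: "ukoszul ds ?R * decal ds * decal (nths ds ?R) * decal (nths ds {i}) =
      (ksgn (a * sum_list dv) * ksgn (sum_list du + a * int (length vs)) :: 'k)"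
    unfolding c1 c2 n1 by (simp add: mult.assoc)
  have upd: "xs[i := d (xs ! i)] = us @ [d x] @ vs" using i' by (simp add: xs)
  have tk: "sum_list (take i (map (\<lambda>a. a + 1) ds)) = sum_list du + int (length us)"
    using i' by (simp add: ds sum_list_map_Suc)
  have sgn: "- (ksgn (a * sum_list dv) * ksgn (sum_list du + a * int (length vs))) =
    ksgn (int (length xs)) * ksgn (sum_list du + int (length us)) *
      (ksgn (int (length (map (\<lambda>a. a + 1) dv)) + (a + 1 + 1) * sum_list (map (\<lambda>a. a + 1) dv)) :: 'k)"
  proof -
    have "- (ksgn (a * sum_list dv) * ksgn (sum_list du + a * int (length vs))) =
      (ksgn (1 + (a * sum_list dv + (sum_list du + a * int (length vs)))) :: 'k)"
      by (simp add: ksgn_add)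
    then show ?thesis
      unfolding sum_list_map_Suc ksgn_add[symmetric]
      by (simp only:, intro ksgn_cong) (use i' in \<open>auto simp: xs\<close>)
  qed
  have "quad_term h F L (map (\<lambda>a. a + 1) ds) xs ?R =
    smul h (- (ksgn (a * sum_list dv) * ksgn (sum_list du + a * int (length vs)))) (F (us @ vs @ [d x]))"
    unfolding quad_term_decal[OF l[symmetric] Diff_subset] K c3
    unfolding n1 Ld append_assoc neg by simp
  also have "\<dots> = smul h (ksgn (int (length xs)))
      (smul h (ksgn (sum_list (take i (map (\<lambda>a. a + 1) ds)))) (F (xs[i := d (xs ! i)])))"
    unfolding upd tk F0 X.prod_list_neg_ksgn sgn h.scale_scale by (simp only: mult_ac)
  finally show ?thesis .
qed

text \<open>The splitting with empty inner block drops out because \<open>L\<close> vanishes on the empty word; those with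
one inner letter form, up to sign, the part of the differential of \<open>F\<close> that acts on the arguments.\<close>

lemma quad_split:
  assumes h: "vector_space (smul h)" and F: "mlin g h F" "gskew g h F"
    and d: "\<And>x i. x \<in> gr g i \<Longrightarrow> d x \<in> gr g (i + 1)" and Ld: "\<And>x. L [x] = - d x" and L0: "L [] = 0"
    and hom: "homog sg ds xs"
  shows "(\<Sum>R \<in> Pow {..<length xs}. quad_term h F L (map (\<lambda>a. a + 1) ds) xs R) =
    (\<Sum>R | R \<subseteq> {..<length xs} \<and> card R + 2 \<le> length xs. quad_term h F L (map (\<lambda>a. a + 1) ds) xs R) +
    smul h (ksgn (int (length xs))) (\<Sum>i < length xs.
      smul h (ksgn (sum_list (take i (map (\<lambda>a. a + 1) ds)))) (F (xs[i := d (xs ! i)])))"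
proof -
  interpret h: vector_space "smul h" by fact
  note l = X.homog_length[OF hom]
  let ?n = "length xs"
  let ?q = "quad_term h F L (map (\<lambda>a. a + 1) ds) xs"
  let ?A = "{R. R \<subseteq> {..<?n} \<and> card R + 2 \<le> ?n}" and ?S = "(\<lambda>i. {..<?n} - {i}) ` {..<?n}"
  have fA: "finite ?A" by (rule finite_subset[of _ "Pow {..<?n}"]) auto
  have P: "Pow {..<?n} = insert {..<?n} (?A \<union> ?S)"
  proof (intro equalityI subsetI)
    fix R assume "R \<in> Pow {..<?n}"
    then have R: "R \<subseteq> {..<?n}" by simp
    then have c: "card R + card ({..<?n} - R) = ?n" using unshuffle_list(3) by blast
    consider "card ({..<?n} - R) = 0" | "card ({..<?n} - R) = 1" | "card R + 2 \<le> ?n" using c by linarith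
    then show "R \<in> insert {..<?n} (?A \<union> ?S)"
    proof cases
      case 1
      then have "R = {..<?n}" using R by auto
      then show ?thesis by simp
    next
      case 2
      then obtain i where "{..<?n} - R = {i}" by (metis card_1_singletonE)
      then have "R = {..<?n} - {i}" "i < ?n" using R by auto
      then show ?thesis by auto
    qed (use R in auto)
  qed auto
  have z: "?q {..<?n} = 0"
    using mlin_zero[OF F(1)] unfolding quad_term_def Let_def by (simp add: L0)
  have dis: "?A \<inter> ?S = {}" "{..<?n} \<notin> ?A \<union> ?S"
    by auto
  have inj: "inj_on (\<lambda>i. {..<?n} - {i}) {..<?n}" by (auto simp: inj_on_def)
  have "(\<Sum>R \<in> Pow {..<?n}. ?q R) = (\<Sum>R \<in> ?A. ?q R) + (\<Sum>R \<in> ?S. ?q R)"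
    unfolding P using fA dis z by (simp add: sum.union_disjoint)
  also have "(\<Sum>R \<in> ?S. ?q R) = (\<Sum>i < ?n. ?q ({..<?n} - {i}))"
    using inj by (simp add: sum.reindex)
  also have "\<dots> = smul h (ksgn (int ?n)) (\<Sum>i < ?n.
      smul h (ksgn (sum_list (take i (map (\<lambda>a. a + 1) ds)))) (F (xs[i := d (xs ! i)])))"
    unfolding h.scale_sum_right by (intro sum.cong refl quad_single[OF h F, where d = d and L = L, OF d Ld hom]) simp_all
  finally show ?thesis .
qed

end

section \<open>Exponentials of functions\<close>

context gspace begin

lemma fns_lengthwise:
  assumes "\<And>n. \<phi> n \<in> fns X" shows "(\<lambda>w. \<phi> (length w) w) \<in> fns X"
proof -
  have "mlin X ground (\<lambda>w. \<phi> (length w) w)"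
    using fns_mlin[OF assms] unfolding mlin_def lin_def by simp
  moreover have "gsym X ground (\<lambda>w. \<phi> (length w) w)"
    unfolding gsym_def smul_ground
  proof (intro allI impI)
    fix us ws x y a b assume xy: "x \<in> gr X a" "y \<in> gr X b"
    have "gsym X ground (\<phi> n)" for n using assms fns_iff by blast
    from gsymD[OF this xy] show "\<phi> (length (us @ [x, y] @ ws)) (us @ [x, y] @ ws) =
      ksgn (a * b) * \<phi> (length (us @ [y, x] @ ws)) (us @ [y, x] @ ws)"
      by (simp only: length_append list.size)
  qed
  ultimately show ?thesis by (simp add: fns_iff)
qed

lemma fpow_0 [simp]: "fpow X f 0 = fone" and fpow_Suc: "fpow X f (Suc k) = fmul X f (fpow X f k)"
  by (simp_all add: fpow_def)

lemma fpow_deg: "f \<in> fns_deg X 0 \<Longrightarrow> fpow X f k \<in> fns_deg X 0"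
  by (induction k) (use fns_deg_fmul[of f 0 _ 0] in \<open>auto simp: fpow_Suc\<close>)

lemma fpow_fns: "f \<in> fns_deg X 0 \<Longrightarrow> fpow X f k \<in> fns X"
  using fpow_deg fns_deg_fns by blast

lemma fpow_short:
  assumes f: "f \<in> fns_deg X 0" "f [] = 0" and w: "w \<in> lists B" "length w < k"
  shows "fpow X f k w = 0"
  using w
proof (induction k arbitrary: w)
  case (Suc k)
  have "wmul dg f (fpow X f k) w = wmul dg f 0 w"
    by (rule wmul_cong_ideal) (use Suc f words_sub[OF Suc.prems(1)] in \<open>auto simp: fun_apply\<close>)
  then show ?case
    using Suc.prems f fpow_fns[OF f(1)] by (simp add: fpow_Suc fmul_words fns_mlin fns_deg_fns fun_apply)
qed simp

text \<open>For \<open>f\<close> in the ideal of \<open>0\<close> this agrees with the exponential on words of length at most \<open>n\<close>;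
unlike the exponential it is a finite sum to which the algebra of functions applies.\<close>

definition texp :: "('k, 'v) fn \<Rightarrow> nat \<Rightarrow> ('k, 'v) fn" where
  "texp f n = (\<Sum>k \<le> n. fscale (1 / fact k) (fpow X f k))"

lemma texp_fns: "f \<in> fns_deg X 0 \<Longrightarrow> texp f n \<in> fns X"
  unfolding texp_def by (intro fns_sum fns_scale fpow_fns)

lemma fexp_texp: "fexp X f w = texp f (length w) w"
  by (simp add: fexp_def texp_def fscale_def fun_apply)

lemma fexp_texp_ge:
  assumes f: "f \<in> fns_deg X 0" "f [] = 0" and w: "w \<in> lists B" "length w \<le> n"
  shows "fexp X f w = texp f n w"
  unfolding fexp_def texp_def fscale_def sum_apply
  by (rule sum.mono_neutral_cong_left) (use w fpow_short[OF f w(1)] in auto)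

lemma fexp_fns: "f \<in> fns_deg X 0 \<Longrightarrow> fexp X f \<in> fns X"
  using fns_lengthwise[of "texp f"] texp_fns by (simp add: fexp_texp[abs_def])

lemma fexp_deg:
  assumes f: "f \<in> fns_deg X 0" shows "fexp X f \<in> fns_deg X 0"
proof (rule fns_degI[OF fexp_fns[OF f]])
  fix w assume w: "w \<in> lists B" "fexp X f w \<noteq> 0"
  have "texp f (length w) \<in> fns_deg X 0"
    unfolding texp_def by (intro fns_deg_sum fns_deg_scale fpow_deg f)
  then show "wdeg dg w = - 0" using w fns_deg_word by (simp add: fexp_texp)
qed

lemma fexp_Nil: "fexp X f [] = 1"
  by (simp add: fexp_def fone_def)

lemma pder_fone [simp]: "pder b fone = (0 :: ('k, 'v) fn)"
  by (auto simp: pder_def fone_def fun_eq_iff fun_apply)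

lemma pder_fpow:
  assumes f: "f \<in> fns_deg X 0" and b: "b \<in> B"
  shows "pder b (fpow X f (Suc k)) = fscale (of_nat (Suc k)) (fmul X (pder b f) (fpow X f k))"
proof (induction k)
  case 0
  then show ?case using f b pder_fmul[OF f fns_one b] by (simp add: fpow_Suc fns_deg_fns)
next
  case (Suc k)
  note ff = fns_deg_fns[OF f] and P = fpow_fns[OF f]
  have "fmul X f (fmul X (pder b f) (fpow X f k)) = fmul X (pder b f) (fpow X f (Suc k))"
    using fmul_commute0[OF f, of "pder b f"] ff P by (simp add: fpow_Suc flip: fmul_assoc)
  then have "pder b (fpow X f (Suc (Suc k))) =
     fmul X (pder b f) (fpow X f (Suc k)) + fscale (of_nat (Suc k)) (fmul X (pder b f) (fpow X f (Suc k)))"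
    using pder_fmul[OF f P b, of "Suc k"] Suc ff P
    by (simp add: fpow_Suc[of f "Suc k"] fmul_scale_right)
  then show ?case by (simp add: fscale_def fun_eq_iff fun_apply algebra_simps)
qed

lemma pder_fexp:
  assumes f: "f \<in> fns_deg X 0" "f [] = 0" and b: "b \<in> B"
  shows "pder b (fexp X f) = fmul X (pder b f) (fexp X f)"
proof (rule fns_eqI)
  note ff = fns_deg_fns[OF f(1)] and P = fpow_fns[OF f(1)]
  fix w assume w: "w \<in> lists B"
  have "pder b (fexp X f) w = (\<Sum>k \<le> Suc (length w). fpow X f k (w @ [b]) / fact k)"
    by (simp add: pder_def fexp_def)
  also have "\<dots> = (\<Sum>k \<le> length w. pder b (fpow X f (Suc k)) w / fact (Suc k))"
    by (subst sum.atMost_Suc_shift) (simp add: pder_def fone_def)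
  also have "\<dots> = (\<Sum>k \<le> length w. fscale (1 / fact k) (fmul X (pder b f) (fpow X f k)) w)"
  proof (intro sum.cong refl)
    fix k
    have "of_nat (Suc k) / fact (Suc k) = (1 / fact k :: 'k)"
      by (simp add: divide_simps del: of_nat_Suc)
    then show "pder b (fpow X f (Suc k)) w / fact (Suc k) =
       fscale (1 / fact k) (fmul X (pder b f) (fpow X f k)) w"
      unfolding pder_fpow[OF f(1) b] fscale_def by (metis times_divide_eq_left)
  qed
  also have "\<dots> = fmul X (pder b f) (texp f (length w)) w"
    using ff P by (simp add: texp_def fmul_sum_right fmul_scale_right fun_apply)
  also have "\<dots> = wmul dg (pder b f) (texp f (length w)) w"
    using w ff texp_fns[OF f(1)] by (simp add: fmul_words fns_mlin)
  also have "\<dots> = wmul dg (pder b f) (fexp X f) w"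
    by (rule wmul_cong) (use fexp_texp_ge[OF f words_sub[OF w]] in auto)
  finally show "pder b (fexp X f) w = fmul X (pder b f) (fexp X f) w"
    using w ff fexp_fns[OF f(1)] by (simp add: fmul_words fns_mlin)
qed (use fexp_fns[OF f(1)] fns_deg_fns[OF f(1)] in auto)

text \<open>The product with a function of constant term \<open>1\<close> is unitriangular with respect to the length of
words.\<close>

lemma fmul_cancel0:
  assumes u: "u \<in> fns X" "u [] = 1" and psi: "\<psi> \<in> fns X" and z: "fmul X u \<psi> = 0"
  shows "\<psi> = 0"
proof (rule fns_eqI[OF psi fns_zero])
  fix w assume "w \<in> lists B"
  then show "\<psi> w = 0 w"
  proof (induction w rule: length_induct)
    case (1 w)
    let ?u = "u + fscale (- 1) fone"
    have "u = fone + ?u" by (simp add: fun_eq_iff fscale_def fun_apply)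
    then have "wmul dg u \<psi> = wmul dg fone \<psi> + wmul dg ?u \<psi>" using wmul_add_left[of dg fone ?u \<psi>] by metis
    then have "wmul dg u \<psi> = \<psi> + wmul dg ?u \<psi>" by (simp only: wmul_one_left)
    moreover have "wmul dg ?u \<psi> w = wmul dg ?u 0 w"
      by (rule wmul_cong_ideal) (use 1 u words_sub[OF 1(2)] in \<open>auto simp: fun_apply fscale_def fone_def\<close>)
    moreover have "wmul dg u \<psi> w = 0"
      using fmul_words[OF fns_mlin fns_mlin, OF u(1) psi 1(2)] z by (simp add: fun_apply)
    ultimately show ?case by (simp add: fun_apply)
  qed
qed

lemma fmul_cancel:
  assumes u: "u \<in> fns X" "u [] = 1" and "\<phi> \<in> fns X" "\<psi> \<in> fns X" "fmul X u \<phi> = fmul X u \<psi>"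
  shows "\<phi> = \<psi>"
proof -
  have "fmul X u (\<phi> + fscale (- 1) \<psi>) = 0"
    using assms by (simp add: fmul_add_right fmul_scale_right) (simp add: fun_eq_iff fun_apply fscale_def)
  then have "\<phi> + fscale (- 1) \<psi> = 0" using fmul_cancel0[OF u] assms by simp
  then show ?thesis by (simp add: fun_eq_iff fun_apply fscale_def)
qed

lemma vf_fexp:
  assumes f: "f \<in> fns_deg X 0" "f [] = 0" and G: "\<And>b. b \<in> B \<Longrightarrow> G b \<in> fns X"
  shows "vfield G (fexp X f) = fmul X (vfield G f) (fexp X f)"
  using fns_deg_fns[OF f(1)] fexp_fns[OF f(1)] G
  by (simp add: vfield_def pder_fexp[OF f] fmul_sum_left fmul_assoc cong: sum.cong)

text \<open>The logarithmic derivatives \<open>\<partial>\<^sub>b f\<close> can be recovered from \<open>e\<^sup>f\<close> by cancellation, and together with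
\<open>f(0) = 0\<close> they determine \<open>f\<close>.\<close>

lemma fexp_inject:
  assumes f: "f \<in> fns_deg X 0" "f [] = 0" and f': "f' \<in> fns_deg X 0" "f' [] = 0"
    and e: "fexp X f = fexp X f'"
  shows "f = f'"
proof (rule fns_eqI)
  fix w assume w: "w \<in> lists B"
  show "f w = f' w"
  proof (cases w rule: rev_cases)
    case (snoc u b)
    then have b: "b \<in> B" using w by simp
    have "fmul X (fexp X f) (pder b f) = fmul X (fexp X f) (pder b f')"
      using pder_fexp[OF f b] pder_fexp[OF f' b] e fmul_commute0[OF fexp_deg[OF f(1)]]
        fns_deg_fns[OF f(1)] fns_deg_fns[OF f'(1)] by (metis fns_pder)
    then have "pder b f = pder b f'"
      using fmul_cancel[OF fexp_fns[OF f(1)] fexp_Nil] fns_deg_fns[OF f(1)] fns_deg_fns[OF f'(1)] by simp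
    then show ?thesis using snoc by (metis pder_def)
  qed (use f f' in simp)
qed (use f f' fns_deg_fns in auto)

end

section \<open>Homotopy Lie structures and unimodularity\<close>

lemma mlin_length1:
  assumes "lin g h f" "mlin g h F"
  shows "mlin g h (\<lambda>xs. if length xs = 1 then f (hd xs) else F xs)"
  unfolding mlin_def
proof (intro allI)
  fix us vs
  show "lin g h (\<lambda>x. if length (us @ x # vs) = 1 then f (hd (us @ x # vs)) else F (us @ x # vs))"
    using assms by (cases "us = [] \<and> vs = []") (auto simp: mlin_def lin_def)
qed

lemma ukoszul_none: "ukoszul ds {} = (1 :: 'k::field_char_0)"
proof (induction ds rule: rev_induct)
  case (snoc a ds)
  then show ?case using ukoszul_out[of "{}" ds a, where 'a = 'k] by simp
qed simp

context shifted begin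

text \<open>The clauses of an L-infinity structure that are linear in the brackets. They make the associated
vector field meaningful before the quadratic relations are known, as the equivalence with
\<open>Q\<^sup>2 = 0\<close> requires.\<close>

definition pre_Linf :: "('v \<Rightarrow> 'v) \<Rightarrow> ('v list \<Rightarrow> 'v) \<Rightarrow> bool" where
  "pre_Linf d l \<longleftrightarrow> lin g g d \<and> (\<forall>i. \<forall>x \<in> gr g i. d x \<in> gr g (i + 1)) \<and>
     (\<forall>xs. length xs < 2 \<longrightarrow> l xs = 0) \<and> skew_family g g (\<lambda>n. 2 - int n) l"

lemma mult_iff: "multilinear g g F \<longleftrightarrow> mlin g g F" "multilinear g ground G \<longleftrightarrow> mlin g ground G"
  using multilinear_iff vsg vs_ground by blast+

lemma L_infinity_iff:
  "L_infinity g d l \<longleftrightarrow> pre_Linf d l \<and> (\<forall>x. d (d x) = 0) \<and>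
     (\<forall>ds xs. homog g ds xs \<longrightarrow> length xs \<ge> 2 \<longrightarrow>
        hom_diff g d d (2 - int (length xs)) l ds xs =
        (\<Sum>I | I \<subseteq> {..<length xs} \<and> 1 \<le> card I \<and> card I + 2 \<le> length xs. quad_term g l l ds xs I))"
proof -
  have "Vector_Spaces.linear (smul g) (smul g) d \<longleftrightarrow> lin g g d"
    using Vector_Spaces.linear_iff[of "smul g" "smul g" d] vsg by (simp add: lin_def)
  then show ?thesis unfolding L_infinity_def dg_space_def pre_Linf_def image_subset_iff using g.gs by blast
qed

lemma pre_LinfD:
  assumes "pre_Linf d l"
  shows "lin g g d" "\<And>x i. x \<in> gr g i \<Longrightarrow> d x \<in> gr g (i + 1)" "\<And>xs. length xs < 2 \<Longrightarrow> l xs = 0"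
    "mlin g g l" "gskew g g l" "of_degree g g (\<lambda>n. 2 - int n) l"
  using assms by (auto simp: pre_Linf_def skew_family_def mult_iff)

lemma lin_neg: "lin g g d \<Longrightarrow> lin g g (\<lambda>x. - d x)"
  by (simp add: lin_def g.vs.scale_minus_right)

lemma full_l_long: "length xs \<noteq> 1 \<Longrightarrow> full_l d l xs = l xs"
  by (simp add: full_l_def)

lemma full_l_single: "full_l d l [x] = - d x"
  by (simp add: full_l_def)

lemma pre_Linf_skew_data:
  assumes P: "pre_Linf d l" shows "skew_data (full_l d l)"
  unfolding skew_data_def
proof (intro conjI)
  note D = pre_LinfD[OF P]
  show "mlin g g (full_l d l)"
    using mlin_length1[OF lin_neg[OF D(1)] D(4)] by (simp add: full_l_def[abs_def])
  show "gskew g g (full_l d l)"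
    unfolding gskew_def
  proof (intro allI impI)
    fix us ws x y a b assume "x \<in> gr g a" "y \<in> gr g b"
    then have "l (us @ [x, y] @ ws) = - smul g (ksgn (a * b)) (l (us @ [y, x] @ ws))"
      using D(5) unfolding gskew_def by blast
    then show "full_l d l (us @ [x, y] @ ws) = - smul g (ksgn (a * b)) (full_l d l (us @ [y, x] @ ws))"
      by (simp add: full_l_def)
  qed
  show "of_degree g g (\<lambda>n. 2 - int n) (full_l d l)"
    unfolding of_degree_def
  proof (intro allI impI)
    fix ds xs assume h: "homog g ds xs"
    show "full_l d l xs \<in> gr g (sum_list ds + (2 - int (length xs)))"
    proof (cases "length xs = 1")
      case True
      then obtain x i where x: "xs = [x]" "ds = [i]"
        using g.homog_length[OF h] by (metis One_nat_def length_0_conv length_Suc_conv)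
      then show ?thesis using D(2) h g.gr_neg by (simp add: full_l_def)
    qed (use D(6) h in \<open>simp add: full_l_def of_degree_def\<close>)
  qed
  show "full_l d l [] = 0" using D(3) by (simp add: full_l_def)
qed

lemma skew_data_pre_Linf:
  assumes S: "skew_data L"
  defines "d \<equiv> \<lambda>x. - L [x]" and "l \<equiv> \<lambda>xs. if length xs < 2 then 0 else L xs"
  shows "pre_Linf d l" "full_l d l = L"
proof -
  have m: "mlin g g L" and s: "gskew g g L" and o: "of_degree g g (\<lambda>n. 2 - int n) L" and z: "L [] = 0"
    using S by (auto simp: skew_data_def)
  have "lin g g (\<lambda>x. L ([] @ x # []))" using m unfolding mlin_def by blast
  then have 1: "lin g g d" unfolding d_def using lin_neg by simp
  have 2: "d x \<in> gr g (i + 1)" if "x \<in> gr g i" for x i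
    using o[unfolded of_degree_def, rule_format, of "[i]" "[x]"] that g.gr_neg by (simp add: d_def)
  have 3: "mlin g g l"
    unfolding mlin_def
  proof (intro allI)
    fix us vs
    show "lin g g (\<lambda>x. l (us @ x # vs))"
    proof (cases "us = [] \<and> vs = []")
      case False
      then have "l (us @ x # vs) = L (us @ x # vs)" for x by (cases us; cases vs) (auto simp: l_def)
      then show ?thesis using m by (simp add: mlin_def)
    qed (simp add: l_def lin_def)
  qed
  have 4: "gskew g g l"
    unfolding gskew_def
  proof (intro allI impI)
    fix us ws x y a b assume "x \<in> gr g a" "y \<in> gr g b"
    then have "L (us @ [x, y] @ ws) = - smul g (ksgn (a * b)) (L (us @ [y, x] @ ws))"
      using s unfolding gskew_def by blast
    then show "l (us @ [x, y] @ ws) = - smul g (ksgn (a * b)) (l (us @ [y, x] @ ws))"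
      by (simp add: l_def)
  qed
  have 5: "of_degree g g (\<lambda>n. 2 - int n) l"
    using o by (simp add: of_degree_def l_def)
  show "pre_Linf d l" unfolding pre_Linf_def skew_family_def mult_iff using 1 2 3 4 5 by (auto simp: l_def)
  show "full_l d l = L"
  proof
    fix xs :: "'v list"
    consider "xs = []" | x where "xs = [x]" | "length xs \<ge> 2" by (cases xs rule: remdups_adj.cases) auto
    then show "full_l d l xs = L xs" by cases (simp_all add: full_l_def d_def l_def z)
  qed
qed

lemma full_l_inject:
  assumes "pre_Linf d l" "pre_Linf d' l'" "full_l d l = full_l d' l'"
  shows "d = d'" "l = l'"
proof -
  show "d = d'" using assms(3) full_l_single by (metis ext neg_equal_iff_equal)
  show "l = l'"
  proof
    fix xs
    show "l xs = l' xs"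
      using pre_LinfD(3)[OF assms(1)] pre_LinfD(3)[OF assms(2)] fun_cong[OF assms(3), of xs]
      by (cases "length xs < 2") (simp_all add: full_l_def)
  qed
qed

lemma tilde_l_eq:
  assumes P: "pre_Linf d l" shows "tilde_l g d l = precomp_s g g (full_l d l)"
proof (rule X.mlin_ext[where h = g])
  note D = pre_LinfD[OF P]
  have m: "mlin g g (full_l d l)" using pre_Linf_skew_data[OF P] by (simp add: skew_data_def)
  show "mlin sg g (tilde_l g d l)"
    using mlin_length1[OF lin_neg[OF D(1)] ps_mlin[OF vsg D(4)]] by (simp add: tilde_l_def[abs_def])
  show "mlin sg g (precomp_s g g (full_l d l))" using ps_mlin[OF vsg m] by simp
  fix w assume w: "w \<in> lists (set es)"
  show "tilde_l g d l w = precomp_s g g (full_l d l) w"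
  proof (cases "length w = 1")
    case True
    then obtain x where "w = [x]" by (metis One_nat_def length_0_conv length_Suc_conv)
    then show ?thesis using ps_word[OF vsg m w] by (simp add: tilde_l_def full_l_def)
  next
    case False
    then show ?thesis
      using ps_word[OF vsg m w] ps_word[OF vsg D(4) w] by (simp add: tilde_l_def full_l_def)
  qed
qed

definition Qfield :: "('v \<Rightarrow> 'v) \<Rightarrow> ('v list \<Rightarrow> 'v) \<Rightarrow> ('k, 'v) vf" where
  "Qfield d l = X.vfield (X.Qcoeff (precomp_s g g (full_l d l)))"

lemma assoc_vf_eq: "pre_Linf d l \<Longrightarrow> assoc_vf g d l = Qfield d l"
  unfolding assoc_vf_def Qfield_def tilde_l_eq
  by (rule X.the_vf_Qcoeff[OF skew_data_coder_data[OF pre_Linf_skew_data]])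

lemma Tsum:
  assumes h: "vector_space (smul h)" and F: "mlin g h F" and L: "skew_data L"
    and hom: "homog sg ds xs"
  shows "(\<Sum>K \<in> Pow {..<length xs}. smul h (ukoszul ds ({..<length xs} - K) * ksgn (sum_list (nths ds K) + 1))
      (precomp_s g h F (nths xs ({..<length xs} - K) @ [precomp_s g g L (nths xs K)]))) =
    smul h (ksgn (sum_list ds + 1) * decal ds)
      (\<Sum>R \<in> Pow {..<length xs}. quad_term h F L (map (\<lambda>a. a + 1) ds) xs R)"
proof -
  interpret h: vector_space "smul h" by fact
  have "(\<Sum>K \<in> Pow {..<length xs}. smul h (ukoszul ds ({..<length xs} - K) * ksgn (sum_list (nths ds K) + 1))
      (precomp_s g h F (nths xs ({..<length xs} - K) @ [precomp_s g g L (nths xs K)]))) =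
    (\<Sum>R \<in> Pow {..<length xs}. smul h (ukoszul ds R * ksgn (sum_list (nths ds ({..<length xs} - R)) + 1))
      (precomp_s g h F (nths xs R @ [precomp_s g g L (nths xs ({..<length xs} - R))])))"
    by (subst sum_Pow_compl[symmetric]) (auto intro!: sum.cong simp: double_diff)
  also have "\<dots> = smul h (ksgn (sum_list ds + 1) * decal ds)
      (\<Sum>R \<in> Pow {..<length xs}. quad_term h F L (map (\<lambda>a. a + 1) ds) xs R)"
    unfolding h.scale_sum_right by (intro sum.cong refl quad_decal[OF h F L hom]) simp
  finally show ?thesis .
qed

lemma quad_term_ext_inner:
  assumes "R \<subseteq> {..<length xs}" "card R + 2 \<le> length xs"
  shows "quad_term h F (full_l d l) ds xs R = quad_term h F l ds xs R"
proof -
  have "length (nths xs ({..<length xs} - R)) = card ({..<length xs} - R)"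
    by (rule length_nths_sub) auto
  then have "length (nths xs ({..<length xs} - R)) \<noteq> 1"
    using unshuffle_list(3)[OF assms(1)] assms(2) by linarith
  then show ?thesis by (simp add: quad_term_def Let_def full_l_long)
qed

lemma quad_term_ext_outer:
  assumes "R \<subseteq> {..<length xs}" "1 \<le> card R"
  shows "quad_term g (full_l d l) L ds xs R = quad_term g l L ds xs R"
  using assms by (simp add: quad_term_def Let_def full_l_long length_nths_sub)

text \<open>The sum over all splittings, sorted by length. The splitting in which the inner block is the whole
word gives \<open>-d(l x)\<close>, the remaining part of the differential of \<open>l\<close>.\<close>

lemma quad_total:
  assumes P: "pre_Linf d l" and hom: "homog sg ds xs"
  defines "L \<equiv> full_l d l" and "dsg \<equiv> map (\<lambda>a. a + 1) ds"
  shows "length xs = 0 \<Longrightarrow> (\<Sum>R \<in> Pow {..<length xs}. quad_term g L L dsg xs R) = 0"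
    and "xs = [x] \<Longrightarrow> (\<Sum>R \<in> Pow {..<length xs}. quad_term g L L dsg xs R) = d (d x)"
    and "length xs \<ge> 2 \<Longrightarrow> (\<Sum>R \<in> Pow {..<length xs}. quad_term g L L dsg xs R) =
      (\<Sum>I | I \<subseteq> {..<length xs} \<and> 1 \<le> card I \<and> card I + 2 \<le> length xs. quad_term g l l dsg xs I)
      - hom_diff g d d (2 - int (length xs)) l dsg xs"
proof -
  note D = pre_LinfD[OF P]
  have S: "skew_data L" unfolding L_def by (rule pre_Linf_skew_data[OF P])
  then have m: "mlin g g L" "gskew g g L" "L [] = 0" by (auto simp: skew_data_def)
  have Ld: "L [x] = - d x" for x by (simp add: L_def full_l_def)
  note sp = quad_split[OF vsg m(1,2), where d = d and L = L, OF D(2) Ld m(3) hom, folded dsg_def]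
  show "(\<Sum>R \<in> Pow {..<length xs}. quad_term g L L dsg xs R) = 0" if "length xs = 0"
    using that mlin_zero[OF m(1)] by (simp add: quad_term_def Let_def m(3))
  show "(\<Sum>R \<in> Pow {..<length xs}. quad_term g L L dsg xs R) = d (d x)" if "xs = [x]"
  proof -
    have "{R. R \<subseteq> {..<length xs} \<and> card R + 2 \<le> length xs} = {}" using that by auto
    then show ?thesis using sp that by (simp add: Ld)
  qed
  assume n: "length xs \<ge> 2"
  have l: "length dsg = length xs" using X.homog_length[OF hom] by (simp add: dsg_def)
  have q0: "quad_term g L L dsg xs {} = - d (l xs)"
    unfolding dsg_def
    by (subst quad_term_decal)
      (use X.homog_length[OF hom] n in \<open>simp_all add: nths_all ukoszul_none Ld\<close>,
        simp add: L_def full_l_def)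
  let ?A = "{R. R \<subseteq> {..<length xs} \<and> card R + 2 \<le> length xs}"
  let ?B = "{R. R \<subseteq> {..<length xs} \<and> 1 \<le> card R \<and> card R + 2 \<le> length xs}"
  have f: "finite ?B" by (rule finite_subset[of _ "Pow {..<length xs}"]) auto
  have A: "?A = insert {} ?B"
  proof (intro equalityI subsetI)
    fix R assume R: "R \<in> ?A"
    then have "finite R" using finite_subset by blast
    then show "R \<in> insert {} ?B" using R by (cases "R = {}") (auto simp: Suc_le_eq card_gt_0_iff)
  qed (use n in auto)
  have "(\<Sum>R \<in> ?A. quad_term g L L dsg xs R) = - d (l xs) + (\<Sum>R \<in> ?B. quad_term g L L dsg xs R)"
    unfolding A using f q0 by simp
  also have "(\<Sum>R \<in> ?B. quad_term g L L dsg xs R) = (\<Sum>R \<in> ?B. quad_term g l l dsg xs R)"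
    unfolding L_def by (intro sum.cong refl) (simp add: quad_term_ext_inner quad_term_ext_outer)
  finally have s: "(\<Sum>R \<in> ?A. quad_term g L L dsg xs R) = - d (l xs) + (\<Sum>R \<in> ?B. quad_term g l l dsg xs R)" .
  have L: "L (xs[i := y]) = l (xs[i := y])" for i y using n by (simp add: L_def full_l_def)
  have k: "ksgn (2 - int (length xs)) = (ksgn (int (length xs)) :: 'k)"
    by (rule ksgn_cong) auto
  show "(\<Sum>R \<in> Pow {..<length xs}. quad_term g L L dsg xs R) =
      (\<Sum>I \<in> ?B. quad_term g l l dsg xs I) - hom_diff g d d (2 - int (length xs)) l dsg xs"
    using sp unfolding s hom_diff_def k L by simp
qed

lemma L_infinity_homological:
  assumes P: "pre_Linf d l" shows "L_infinity g d l \<longleftrightarrow> homological sg (Qfield d l)"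
proof -
  let ?L = "full_l d l"
  note S = pre_Linf_skew_data[OF P]
  have m: "mlin g g ?L" using S by (simp add: skew_data_def)
  let ?q = "\<lambda>ds xs. \<Sum>R \<in> Pow {..<length xs}. quad_term g ?L ?L (map (\<lambda>a. a + 1) ds) xs R"
  have "homological sg (Qfield d l) \<longleftrightarrow> (\<forall>ds xs. homog sg ds xs \<longrightarrow>
     smul g (ksgn (sum_list ds + 1) * decal ds) (?q ds xs) = 0)"
    unfolding Qfield_def X.homological_iff[OF skew_data_coder_data[OF S]] smul_shift
    using Tsum[OF vsg m S] by auto
  also have "\<dots> \<longleftrightarrow> (\<forall>ds xs. homog sg ds xs \<longrightarrow> ?q ds xs = 0)"
    by simp
  also have "\<dots> \<longleftrightarrow> (\<forall>x. d (d x) = 0) \<and>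
     (\<forall>ds xs. homog g ds xs \<longrightarrow> length xs \<ge> 2 \<longrightarrow>
        hom_diff g d d (2 - int (length xs)) l ds xs =
        (\<Sum>I | I \<subseteq> {..<length xs} \<and> 1 \<le> card I \<and> card I + 2 \<le> length xs. quad_term g l l ds xs I))"
    (is "_ \<longleftrightarrow> ?R")
  proof
    assume q: "\<forall>ds xs. homog sg ds xs \<longrightarrow> ?q ds xs = 0"
    have dd: "d (d b) = 0" if "b \<in> set es" for b
    proof -
      have h: "homog sg [hdeg sg b] [b]"
        using X.basis_gr[OF that] by (simp only: X.homog_single)
      show ?thesis by (rule trans[OF sym[OF quad_total(2)[OF P h refl]] q[rule_format, OF h]])
    qed
    have ld: "lin g g (\<lambda>x. d (d x))" using pre_LinfD(1)[OF P] by (simp add: lin_def)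
    have "d (d x) = 0" for x
      using g.lin_expand[OF ld, of x] dd by simp
    moreover have "hom_diff g d d (2 - int (length xs)) l ds xs =
        (\<Sum>I | I \<subseteq> {..<length xs} \<and> 1 \<le> card I \<and> card I + 2 \<le> length xs. quad_term g l l ds xs I)"
      if "homog g ds xs" "length xs \<ge> 2" for ds xs
    proof -
      have h: "homog sg (map (\<lambda>a. a - 1) ds) xs" by (rule homog_unshift[THEN iffD1, OF that(1)])
      have "map (\<lambda>a. a + 1) (map (\<lambda>a. a - 1) ds) = ds" by (simp add: o_def)
      then show ?thesis
        using quad_total(3)[OF P h that(2)] q[rule_format, OF h] by simp
    qed
    ultimately show ?R by blast
  next
    assume R: ?R
    show "\<forall>ds xs. homog sg ds xs \<longrightarrow> ?q ds xs = 0"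
    proof (intro allI impI)
      fix ds xs assume h: "homog sg ds xs"
      consider "length xs = 0" | x where "xs = [x]" | "length xs \<ge> 2" by (cases xs rule: remdups_adj.cases) auto
      then show "?q ds xs = 0"
      proof cases
        case 3
        then show ?thesis using quad_total(3)[OF P h 3] R h unfolding homog_shift by simp
      next
        case (2 x)
        then show ?thesis using quad_total(2)[OF P h 2] R by simp
      qed (use quad_total(1)[OF P h] in simp)
    qed
  qed
  finally show ?thesis using P by (simp only: L_infinity_iff simp_thms)
qed

definition Qdiv :: "('v \<Rightarrow> 'v) \<Rightarrow> ('v list \<Rightarrow> 'v) \<Rightarrow> ('k, 'v) fn" where
  "Qdiv d l = (\<Sum>b \<in> set es. pder b (X.Qcoeff (precomp_s g g (full_l d l)) b))"

lemma q_family_iff: "q_family g q \<longleftrightarrow>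
    q [] = 0 \<and> mlin g ground q \<and> gskew g ground q \<and> of_degree g ground (\<lambda>n. - int n) q"
  by (simp add: q_family_def skew_family_def mult_iff)

lemma gr_ground_scale: "x \<in> gr ground i \<Longrightarrow> smul ground c x \<in> gr ground i"
  by (simp add: gr_ground)

lemma assoc_fn_deg:
  assumes q: "q_family g q"
  shows "assoc_fn g q \<in> fns_deg sg 0 \<inter> ideal0 sg"
proof -
  note q = q[unfolded q_family_iff]
  have "assoc_fn g q \<in> fns sg"
    unfolding X.fns_iff assoc_fn_def using q ps_mlin[OF vs_ground] ps_gsym[OF vs_ground] by simp
  moreover have "of_degree sg ground (\<lambda>_. 0) (assoc_fn g q)"
    using ps_of_degree(1)[OF vs_ground _ gr_ground_scale, of q "\<lambda>n. - int n"] q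
    by (simp add: assoc_fn_def)
  ultimately show ?thesis
    using ps_Nil[OF vs_ground] q by (simp add: fns_deg_def ideal0_def assoc_fn_def)
qed

lemma fn_q_family:
  assumes f: "f \<in> fns_deg sg 0 \<inter> ideal0 sg"
  shows "q_family g (precomp_s g ground f)" "assoc_fn g (precomp_s g ground f) = f"
proof -
  have m: "mlin g ground f" "gsym sg ground f" "of_degree sg ground (\<lambda>_. 0) f" "f [] = 0"
    using f by (auto simp: fns_deg_def ideal0_def X.fns_iff)
  show "q_family g (precomp_s g ground f)"
    unfolding q_family_iff
    using ps_Nil[OF vs_ground m(1)] ps_mlin[OF vs_ground m(1)] ps_gskew[OF vs_ground m(1,2)]
      ps_of_degree(2)[OF vs_ground m(1) gr_ground_scale m(3)] m(4) by simp
  show "assoc_fn g (precomp_s g ground f) = f"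
    unfolding assoc_fn_def by (rule ps_invol[OF vs_ground m(1)])
qed

lemma assoc_fn_inject:
  "q_family g q \<Longrightarrow> q_family g q' \<Longrightarrow> assoc_fn g q = assoc_fn g q' \<Longrightarrow> q = q'"
  unfolding assoc_fn_def q_family_iff using ps_invol[OF vs_ground] by metis

text \<open>The supertrace is formed with the parities of \<open>g\<close>, the divergence with those of the shifted space;
this is the origin of the minus sign.\<close>

lemma divergence_homog:
  assumes P: "pre_Linf d l" and hom: "homog sg ds xs" and n: "xs \<noteq> []"
  shows "Qdiv d l xs = - ksgn (sum_list ds) * decal ds * gtrace g es (\<lambda>y. l (xs @ [y]))"
proof -
  have m: "mlin g g (full_l d l)" using pre_Linf_skew_data[OF P] by (simp add: skew_data_def)
  have "X.Qcoeff (precomp_s g g (full_l d l)) b (xs @ [b]) =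
     - ksgn (sum_list ds) * decal ds * (ksgn (hdeg g b) * g.rep (l (xs @ [b])) b)" if b: "b \<in> set es" for b
  proof -
    have h: "homog sg (ds @ [hdeg sg b]) (xs @ [b])"
      by (intro X.homog_append hom X.homog_single[THEN iffD2] X.basis_gr b)
    have e: "full_l d l (xs @ [b]) = l (xs @ [b])" using n by (simp add: full_l_def)
    show ?thesis
      unfolding X.Qcoeff_def ps_homog[OF vsg m h] e smul_shift decal_snoc g.rep_scale hdeg_shift[OF b] ksgn_add
      by (simp add: mult_ac)
  qed
  then show ?thesis
    unfolding Qdiv_def gtrace_def sum_distrib_left by (simp add: sum_apply pder_def)
qed

lemma unimodular_term:
  assumes P: "pre_Linf d l" and q: "q_family g q" and hom: "homog sg ds xs" and n: "xs \<noteq> []"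
  shows "(Qfield d l (assoc_fn g q) + Qdiv d l) xs = - ksgn (sum_list ds) * decal ds *
    ((\<Sum>I | I \<subseteq> {..<length xs} \<and> card I + 2 \<le> length xs. quad_term ground q l (map (\<lambda>a. a + 1) ds) xs I)
        + gtrace g es (\<lambda>y. l (xs @ [y]))
      - hom_diff ground d (\<lambda>_. 0) (- int (length xs)) q (map (\<lambda>a. a + 1) ds) xs)"
proof -
  let ?L = "full_l d l" and ?dsg = "map (\<lambda>a. a + 1) ds"
  note D = pre_LinfD[OF P] and S = pre_Linf_skew_data[OF P]
  have m: "mlin g ground q" "gskew g ground q" using q by (auto simp: q_family_iff)
  have f: "assoc_fn g q \<in> fns sg" using assoc_fn_deg[OF q] X.fns_deg_fns by blast
  have "Qfield d l (assoc_fn g q) xs = ksgn (sum_list ds + 1) * decal ds *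
      (\<Sum>R \<in> Pow {..<length xs}. quad_term ground q ?L ?dsg xs R)"
    unfolding Qfield_def X.vf_Qcoeff_homog[OF skew_data_coder_data[OF S] f hom]
    using Tsum[OF vs_ground m(1) S hom] by (simp add: assoc_fn_def)
  also have "(\<Sum>R \<in> Pow {..<length xs}. quad_term ground q ?L ?dsg xs R) =
    (\<Sum>R | R \<subseteq> {..<length xs} \<and> card R + 2 \<le> length xs. quad_term ground q ?L ?dsg xs R) +
    smul ground (ksgn (int (length xs))) (\<Sum>i < length xs.
      smul ground (ksgn (sum_list (take i ?dsg))) (q (xs[i := d (xs ! i)])))"
    by (rule quad_split[OF vs_ground m, where d = d and L = ?L, OF D(2) full_l_single _ hom])
      (use S in \<open>simp_all add: skew_data_def\<close>)
  also have "(\<Sum>R | R \<subseteq> {..<length xs} \<and> card R + 2 \<le> length xs. quad_term ground q ?L ?dsg xs R) =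
    (\<Sum>R | R \<subseteq> {..<length xs} \<and> card R + 2 \<le> length xs. quad_term ground q l ?dsg xs R)"
    by (intro sum.cong refl) (simp add: quad_term_ext_inner)
  finally have Q0: "Qfield d l (assoc_fn g q) xs = ksgn (sum_list ds + 1) * decal ds *
    ((\<Sum>R | R \<subseteq> {..<length xs} \<and> card R + 2 \<le> length xs. quad_term ground q l ?dsg xs R) +
    smul ground (ksgn (int (length xs))) (\<Sum>i < length xs.
      smul ground (ksgn (sum_list (take i ?dsg))) (q (xs[i := d (xs ! i)]))))" .
  have Q: "Qfield d l (assoc_fn g q) xs = ksgn (sum_list ds + 1) * decal ds *
    ((\<Sum>R | R \<subseteq> {..<length xs} \<and> card R + 2 \<le> length xs. quad_term ground q l ?dsg xs R) -
     hom_diff ground d (\<lambda>_. 0) (- int (length xs)) q ?dsg xs)"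
  proof -
    have "ksgn (- int (length xs)) = (ksgn (int (length xs)) :: 'k)" by (rule ksgn_cong) simp
    then show ?thesis unfolding Q0 by (simp add: hom_diff_def)
  qed
  show ?thesis
    unfolding plus_fun_apply Q divergence_homog[OF P hom n] ksgn_add by (simp add: algebra_simps)
qed

lemma Qdiv_fns: "pre_Linf d l \<Longrightarrow> Qdiv d l \<in> fns sg"
  unfolding Qdiv_def
  by (intro X.fns_sum X.fns_pder X.Qcoeff_fns skew_data_coder_data pre_Linf_skew_data)

lemma Qfield_vector_field: "pre_Linf d l \<Longrightarrow> vector_field sg 1 (Qfield d l)"
  unfolding Qfield_def by (intro X.Qcoeff_vector_field skew_data_coder_data pre_Linf_skew_data)

text \<open>The equations of a unimodular structure have at least one argument, so the constant term is treated
apart: the divergence has degree \<open>1\<close> and hence none, and \<open>Q f\<close> has none because \<open>Q\<close> vanishes at \<open>0\<close>.\<close>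

lemma unimodular_Nil:
  assumes P: "pre_Linf d l" and f: "f \<in> fns sg"
  shows "(Qfield d l f + Qdiv d l) [] = 0"
proof -
  note T = skew_data_coder_data[OF pre_Linf_skew_data[OF P]]
  have "X.Qcoeff (precomp_s g g (full_l d l)) b [b] = 0" if b: "b \<in> set es" for b
  proof (rule ccontr)
    assume "X.Qcoeff (precomp_s g g (full_l d l)) b [b] \<noteq> 0"
    from X.fns_deg_word[OF X.Qcoeff_fns_deg[OF T b] _ this] b show False by simp
  qed
  then have "Qdiv d l [] = 0" by (simp add: Qdiv_def sum_apply pder_def)
  moreover have "Qfield d l f [] = 0"
    unfolding Qfield_def X.vf_Qcoeff_homog[OF T f X.homog_Nil]
    using mlin_zero[OF X.fns_mlin[OF f], of "[0]"] X.coder_dataD(4)[OF T] by simp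
  ultimately show ?thesis by (simp add: fun_apply)
qed

lemma unimodular_iff:
  assumes Li: "L_infinity g d l" and q: "q_family g q"
  shows "unimodular_L_infinity g es d l q \<longleftrightarrow> Qfield d l (assoc_fn g q) + Qdiv d l = 0"
proof -
  have P: "pre_Linf d l" using Li by (simp add: L_infinity_iff)
  have f: "assoc_fn g q \<in> fns sg" using assoc_fn_deg[OF q] X.fns_deg_fns by blast
  let ?E = "\<lambda>ds xs. (\<Sum>I | I \<subseteq> {..<length xs} \<and> card I + 2 \<le> length xs. quad_term ground q l ds xs I)
        + gtrace g es (\<lambda>y. l (xs @ [y])) - hom_diff ground d (\<lambda>_. 0) (- int (length xs)) q ds xs"
  have "unimodular_L_infinity g es d l q \<longleftrightarrow> (\<forall>ds xs. homog g ds xs \<longrightarrow> length xs \<ge> 1 \<longrightarrow> ?E ds xs = 0)"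
    using Li q unfolding unimodular_L_infinity_def right_minus_eq
      eq_commute[of "hom_diff a b c r F x y" for a b c r F x y] by blast
  also have "\<dots> \<longleftrightarrow> Qfield d l (assoc_fn g q) + Qdiv d l = 0"
  proof
    assume E: "\<forall>ds xs. homog g ds xs \<longrightarrow> length xs \<ge> 1 \<longrightarrow> ?E ds xs = 0"
    show "Qfield d l (assoc_fn g q) + Qdiv d l = 0"
    proof (rule X.fns_eqI)
      show "Qfield d l (assoc_fn g q) + Qdiv d l \<in> fns sg"
        by (intro X.fns_add X.vf_fns[OF Qfield_vector_field[OF P]] f Qdiv_fns P)
      fix w assume "w \<in> lists (set es)"
      then have h: "homog sg (map (hdeg sg) w) w" by (rule X.homog_basis)
      show "(Qfield d l (assoc_fn g q) + Qdiv d l) w = 0 w"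
      proof (cases "w = []")
        case False
        have "?E (map (\<lambda>a. a + 1) (map (hdeg sg) w)) w = 0"
          using E h[unfolded homog_shift] False by (simp add: Suc_le_eq)
        then show ?thesis unfolding unimodular_term[OF P q h False] by (simp add: fun_apply)
      qed (use unimodular_Nil[OF P f] in \<open>simp add: fun_apply\<close>)
    qed simp
  next
    assume Z: "Qfield d l (assoc_fn g q) + Qdiv d l = 0"
    show "\<forall>ds xs. homog g ds xs \<longrightarrow> length xs \<ge> 1 \<longrightarrow> ?E ds xs = 0"
    proof (intro allI impI)
      fix ds xs assume h: "homog g ds xs" and n: "length xs \<ge> 1"
      have h': "homog sg (map (\<lambda>a. a - 1) ds) xs" by (rule homog_unshift[THEN iffD1, OF h])
      have "xs \<noteq> []" using n by auto
      from unimodular_term[OF P q h' this] show "?E ds xs = 0"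
        unfolding Z by (simp add: o_def fun_apply)
    qed
  qed
  finally show ?thesis .
qed

end

section \<open>Lie derivatives of volume forms\<close>

context gspace begin

lemma vector_field_add:
  assumes V: "vector_field X j V" and W: "vector_field X j W"
  shows "vector_field X j (V + W)"
  unfolding vector_field_def
proof (intro conjI allI ballI impI)
  show "\<phi> \<notin> fns X \<Longrightarrow> (V + W) \<phi> = 0" for \<phi>
    using vf_out[OF V] vf_out[OF W] by (simp add: fun_apply)
  show "\<phi> \<in> fns X \<Longrightarrow> (V + W) \<phi> \<in> fns X" for \<phi>
    using vf_fns[OF V] vf_fns[OF W] by (simp add: fun_apply)
  show "\<phi> \<in> fns X \<Longrightarrow> \<psi> \<in> fns X \<Longrightarrow> (V + W) (\<phi> + \<psi>) = (V + W) \<phi> + (V + W) \<psi>" for \<phi> \<psi>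
    using vf_add[OF V] vf_add[OF W] by (simp add: plus_fun_apply[of V W] add_ac)
  show "\<phi> \<in> fns X \<Longrightarrow> (V + W) (fscale c \<phi>) = fscale c ((V + W) \<phi>)" for \<phi> c
    using vf_scale[OF V] vf_scale[OF W] by (simp add: plus_fun_apply[of V W] fscale_add)
  fix i \<phi> assume p: "\<phi> \<in> fns_deg X i"
  show "(V + W) \<phi> \<in> fns_deg X (i + j)"
    using vf_deg[OF V p] vf_deg[OF W p] by (simp add: plus_fun_apply[of V W] fns_deg_add)
  fix \<psi> assume s: "\<psi> \<in> fns X"
  show "(V + W) (fmul X \<phi> \<psi>) = fmul X ((V + W) \<phi>) \<psi> + fscale (ksgn (i * j)) (fmul X \<phi> ((V + W) \<psi>))"
    using vf_mul[OF V p s] vf_mul[OF W p s] fns_deg_fns[OF p] s vf_fns[OF V] vf_fns[OF W]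
    by (simp add: plus_fun_apply[of V W] fmul_add_left fmul_add_right fscale_add add_ac)
qed

lemma vector_field_zero: "vector_field X j 0"
  unfolding vector_field_def by (simp add: fun_apply fns_deg_fns)

lemma vector_field_vmul_partial:
  assumes g: "G \<in> fns_deg X (j - dg b)" and b: "b \<in> B"
  shows "vector_field X j (vmul X G (partial b))"
proof -
  let ?G = "\<lambda>a. if a = b then G else 0"
  have "vfield ?G = (\<Sum>a \<in> B. vmul X (?G a) (partial a))"
    by (rule vf_vmul) (use fns_deg_fns[OF g] in auto)
  also have "\<dots> = (\<Sum>a \<in> B. if a = b then vmul X G (partial b) else 0)"
    by (intro sum.cong refl) (auto simp: vmul_def partial_def fun_eq_iff fun_apply)
  finally have "vmul X G (partial b) = vfield ?G" using b by simp
  moreover have "vector_field X j (vfield ?G)" by (rule vf_vector_field) (use g in auto)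
  ultimately show ?thesis by simp
qed

end

locale lie_volume = gspace X es
  for X :: "('k::field_char_0, 'v::ab_group_add) gvs" and es +
  fixes M :: "'m::ab_group_add set" and act vol L
  assumes ber: "berezinian_module X es M act vol" and lie: "lie_action X es M act vol L"
begin

abbreviation "\<Delta> \<equiv> const_vol X es vol"

lemma ber_clauses:
  shows "0 \<in> M"
    and "\<forall>g \<in> fns X. \<forall>\<rho> \<in> M. act g \<rho> \<in> M"
    and "\<forall>\<rho> \<in> M. act fone \<rho> = \<rho>"
    and "\<forall>g \<in> fns X. \<forall>h \<in> fns X. \<forall>\<rho> \<in> M. act (fmul X g h) \<rho> = act g (act h \<rho>)"
    and "\<forall>g \<in> fns X. \<forall>h \<in> fns X. \<forall>\<rho> \<in> M. act (g + h) \<rho> = act g \<rho> + act h \<rho>"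
    and "\<forall>g \<in> fns X. \<forall>\<rho> \<in> M. \<forall>\<tau> \<in> M. act g (\<rho> + \<tau>) = act g \<rho> + act g \<tau>"
    and "\<forall>b. frame X es b \<longrightarrow> vol b \<in> M \<and> (\<forall>\<rho> \<in> M. \<exists>!g. g \<in> fns X \<and> \<rho> = act g (vol b))"
  by (insert ber, unfold berezinian_module_def, (elim conjE, assumption)+)

lemma M_zero: "0 \<in> M"
  by (rule ber_clauses)

lemma act_mem: "g \<in> fns X \<Longrightarrow> \<rho> \<in> M \<Longrightarrow> act g \<rho> \<in> M"
  using ber_clauses(2) by blast

lemma act_one: "\<rho> \<in> M \<Longrightarrow> act fone \<rho> = \<rho>"
  using ber_clauses(3) by blast

lemma act_mul: "g \<in> fns X \<Longrightarrow> h \<in> fns X \<Longrightarrow> \<rho> \<in> M \<Longrightarrow> act (fmul X g h) \<rho> = act g (act h \<rho>)"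
  using ber_clauses(4) by blast

lemma act_add: "g \<in> fns X \<Longrightarrow> h \<in> fns X \<Longrightarrow> \<rho> \<in> M \<Longrightarrow> act (g + h) \<rho> = act g \<rho> + act h \<rho>"
  using ber_clauses(5) by blast

lemma act_add_right: "g \<in> fns X \<Longrightarrow> \<rho> \<in> M \<Longrightarrow> \<tau> \<in> M \<Longrightarrow> act g (\<rho> + \<tau>) = act g \<rho> + act g \<tau>"
  using ber_clauses(6) by blast

lemma vol_mem: "\<Delta> \<in> M" and vol_free: "\<rho> \<in> M \<Longrightarrow> \<exists>!g. g \<in> fns X \<and> \<rho> = act g \<Delta>"
  using ber_clauses(7)[rule_format, OF frame_dcoord] unfolding const_vol_def by (blast, blast)

lemma act_zero: "\<rho> \<in> M \<Longrightarrow> act 0 \<rho> = 0"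
  using act_add[of 0 0 \<rho>] by simp

lemma act_zero_right: "g \<in> fns X \<Longrightarrow> act g 0 = 0"
  using act_add_right[of g 0 0] M_zero by simp

lemma act_sum:
  assumes "\<And>a. a \<in> A \<Longrightarrow> f a \<in> fns X" "\<rho> \<in> M"
  shows "act (\<Sum>a \<in> A. f a) \<rho> = (\<Sum>a \<in> A. act (f a) \<rho>)"
  using assms(1)
  by (induction A rule: infinite_finite_induct)
    (auto simp: act_zero act_add assms(2) fns_sum)

lemma act_inject:
  assumes "g \<in> fns X" "h \<in> fns X" "act g \<Delta> = act h \<Delta>" shows "g = h"
  using vol_free[OF act_mem[OF assms(1) vol_mem]] assms by metis

lemma lie_clauses:
  shows "\<forall>j V W. vector_field X j V \<longrightarrow> vector_field X j W \<longrightarrow> (\<forall>\<rho> \<in> M. L (V + W) \<rho> = L V \<rho> + L W \<rho>)"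
    and "\<forall>i j V. vector_field X j V \<longrightarrow> (\<forall>g \<in> fns_deg X i. \<forall>\<rho> \<in> M.
        L V (act g \<rho>) = act (V g) \<rho> + act (fscale (ksgn (i * j)) g) (L V \<rho>))"
    and "\<forall>i j V. vector_field X j V \<longrightarrow> (\<forall>g \<in> fns_deg X i. \<forall>\<rho> \<in> M.
        L (vmul X g V) \<rho> = act (fscale (ksgn (i * j)) fone) (L V (act g \<rho>)))"
    and "\<forall>i < length es. L (dcoord X es i) \<Delta> = 0"
  by (insert lie, unfold lie_action_def, (elim conjE, assumption)+)

lemma L_add: "vector_field X j V \<Longrightarrow> vector_field X j W \<Longrightarrow> \<rho> \<in> M \<Longrightarrow> L (V + W) \<rho> = L V \<rho> + L W \<rho>"
  using lie_clauses(1) by blast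

lemma L_act: "vector_field X j V \<Longrightarrow> g \<in> fns_deg X i \<Longrightarrow> \<rho> \<in> M \<Longrightarrow>
     L V (act g \<rho>) = act (V g) \<rho> + act (fscale (ksgn (i * j)) g) (L V \<rho>)"
  using lie_clauses(2) by blast

lemma L_vmul: "vector_field X j V \<Longrightarrow> g \<in> fns_deg X i \<Longrightarrow> \<rho> \<in> M \<Longrightarrow>
     L (vmul X g V) \<rho> = act (fscale (ksgn (i * j)) fone) (L V (act g \<rho>))"
  using lie_clauses(3) by blast

lemma L_partial: assumes "b \<in> B" shows "L (partial b) \<Delta> = 0"
proof -
  obtain i where "i < length es" "b = es ! i" using assms by (auto simp: in_set_conv_nth)
  then show ?thesis using lie_clauses(4) dcoord_eq by simp
qed

lemma L_zero: "\<rho> \<in> M \<Longrightarrow> L 0 \<rho> = 0"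
  using L_add[OF vector_field_zero vector_field_zero, of \<rho>] by simp

lemma L_sum:
  assumes "\<And>a. a \<in> A \<Longrightarrow> vector_field X j (V a)" "\<rho> \<in> M"
  shows "L (\<Sum>a \<in> A. V a) \<rho> = (\<Sum>a \<in> A. L (V a) \<rho>) \<and> vector_field X j (\<Sum>a \<in> A. V a)"
  using assms(1)
proof (induction A rule: infinite_finite_induct)
  case (insert a A)
  then have a: "vector_field X j (V a)" and A: "vector_field X j (\<Sum>a \<in> A. V a)"
    and IH: "L (\<Sum>a \<in> A. V a) \<rho> = (\<Sum>a \<in> A. L (V a) \<rho>)" by auto
  show ?case
    using insert(1,2) L_add[OF a A assms(2)] vector_field_add[OF a A] IH by simp
qed (simp_all add: L_zero assms(2) vector_field_zero)

text \<open>Taking \<open>G b\<close> out of \<open>L\<close> costs the exponent \<open>(1 - |b|) |b|\<close>, which is always even: for a vector field of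
degree \<open>1\<close> the divergence carries no signs.\<close>

lemma L_vol:
  assumes G: "\<And>b. b \<in> B \<Longrightarrow> G b \<in> fns_deg X (1 - dg b)"
  shows "L (vfield G) \<Delta> = act (\<Sum>b \<in> B. pder b (G b)) \<Delta>"
proof -
  note Gf = fns_deg_fns[OF G]
  have "L (vmul X (G b) (partial b)) \<Delta> = act (pder b (G b)) \<Delta>" if b: "b \<in> B" for b
  proof -
    have k: "ksgn ((1 - dg b) * dg b) = (1 :: 'k)" by (simp add: ksgn_def)
    have "L (vmul X (G b) (partial b)) \<Delta> = act fone (L (partial b) (act (G b) \<Delta>))"
      using L_vmul[OF partial_vector_field[OF b] G[OF b] vol_mem] unfolding k by simp
    also have "L (partial b) (act (G b) \<Delta>) = act (pder b (G b)) \<Delta>"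
      using L_act[OF partial_vector_field[OF b] G[OF b] vol_mem] Gf[OF b]
      by (simp add: L_partial[OF b] act_zero_right partial_def)
    also have "act fone \<dots> = \<dots>" by (intro act_one act_mem vol_mem fns_pder Gf b)
    finally show ?thesis .
  qed
  moreover have "L (vfield G) \<Delta> = (\<Sum>b \<in> B. L (vmul X (G b) (partial b)) \<Delta>)"
  proof -
    have e: "vfield G = (\<Sum>b \<in> B. vmul X (G b) (partial b))" by (rule vf_vmul) (rule Gf)
    show ?thesis unfolding e
      by (rule conjunct1[OF L_sum]) (use vector_field_vmul_partial G vol_mem in auto)
  qed
  ultimately show ?thesis using act_sum[of B "\<lambda>b. pder b (G b)"] Gf vol_mem by simp
qed

lemma L_exp_vol:
  assumes G: "\<And>b. b \<in> B \<Longrightarrow> G b \<in> fns_deg X (1 - dg b)"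
    and f: "f \<in> fns_deg X 0" "f [] = 0"
  shows "L (vfield G) (exp_vol X es act vol f) = act (fmul X (fexp X f) (vfield G f + (\<Sum>b \<in> B. pder b (G b)))) \<Delta>"
proof -
  note Gf = fns_deg_fns[OF G] and Q = vf_vector_field[of G 1, OF G]
  let ?e = "fexp X f" and ?D = "\<Sum>b \<in> B. pder b (G b)"
  note e = fexp_fns[OF f(1)] and ff = fns_deg_fns[OF f(1)]
  have D: "?D \<in> fns X" using Gf by (intro fns_sum fns_pder)
  have Qf: "vfield G f \<in> fns X" by (rule vf_fns[OF Q ff])
  have "L (vfield G) (act ?e \<Delta>) = act (vfield G ?e) \<Delta> + act ?e (L (vfield G) \<Delta>)"
    using L_act[OF Q fexp_deg[OF f(1)] vol_mem] by simp
  also have "\<dots> = act (fmul X ?e (vfield G f)) \<Delta> + act (fmul X ?e ?D) \<Delta>"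
    using act_mul[OF e D vol_mem] fmul_commute0[OF fexp_deg[OF f(1)] Qf] L_vol[of G] G
      vf_fexp[OF f, of G] Gf by simp
  also have "\<dots> = act (fmul X ?e (vfield G f + ?D)) \<Delta>"
    using e D Qf act_add[OF _ _ vol_mem] by (simp add: fmul_add_right)
  finally show ?thesis by (simp add: exp_vol_def)
qed

lemma L_exp_vol_zero_iff:
  assumes G: "\<And>b. b \<in> B \<Longrightarrow> G b \<in> fns_deg X (1 - dg b)"
    and f: "f \<in> fns_deg X 0" "f [] = 0"
  shows "L (vfield G) (exp_vol X es act vol f) = 0 \<longleftrightarrow> vfield G f + (\<Sum>b \<in> B. pder b (G b)) = 0"
proof -
  note e = fexp_fns[OF f(1)]
  have D: "vfield G f + (\<Sum>b \<in> B. pder b (G b)) \<in> fns X"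
    using fns_deg_fns[OF G] vf_fns[OF vf_vector_field[of G 1, OF G] fns_deg_fns[OF f(1)]]
    by (intro fns_add fns_sum fns_pder) auto
  let ?D = "vfield G f + (\<Sum>b \<in> B. pder b (G b))"
  have "act (fmul X (fexp X f) ?D) \<Delta> = 0 \<longleftrightarrow> fmul X (fexp X f) ?D = 0"
    using act_inject[OF fmul_fns[OF e D] fns_zero] act_zero[OF vol_mem] by auto
  also have "\<dots> \<longleftrightarrow> ?D = 0"
    using fmul_cancel0[OF e fexp_Nil D] fmul_zero_right[OF e] by auto
  finally show ?thesis by (simp only: L_exp_vol[OF G f])
qed

lemma exp_vol_inject:
  assumes "f \<in> fns_deg X 0 \<inter> ideal0 X" "f' \<in> fns_deg X 0 \<inter> ideal0 X"
    "exp_vol X es act vol f = exp_vol X es act vol f'"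
  shows "f = f'"
proof (rule fexp_inject)
  show "fexp X f = fexp X f'"
    using act_inject fexp_fns assms by (simp add: exp_vol_def)
qed (use assms in \<open>auto simp: ideal0_def\<close>)

end

section \<open>Unimodular structures and invariant volume forms\<close>

theorem mainTheorem5:
  fixes g :: "('k::field_char_0, 'v::ab_group_add) gvs"
    and es :: "'v list"
    and M :: "'m::ab_group_add set"
    and act :: "('k, 'v) fn \<Rightarrow> 'm \<Rightarrow> 'm"
    and vol :: "(nat \<Rightarrow> ('k, 'v) vf) \<Rightarrow> 'm"
    and L :: "('k, 'v) vf \<Rightarrow> 'm \<Rightarrow> 'm"
  assumes "graded_space g"
    and "homogeneous_basis g es"
    and "berezinian_module (shift1 g) es M act vol"
    and "lie_action (shift1 g) es M act vol L"
  shows "(\<forall>d l q. L_infinity g d l \<longrightarrow> q_family g q \<longrightarrow>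
            (unimodular_L_infinity g es d l q \<longleftrightarrow>
             L (assoc_vf g d l) (exp_vol (shift1 g) es act vol (assoc_fn g q)) = 0))
       \<and> bij_betw
           (\<lambda>(d, l, q). (assoc_vf g d l, exp_vol (shift1 g) es act vol (assoc_fn g q)))
           {(d, l, q). unimodular_L_infinity g es d l q}
           {(Q, \<rho>). homological (shift1 g) Q \<and>
              (\<exists>f \<in> fns_deg (shift1 g) 0 \<inter> ideal0 (shift1 g).
                 \<rho> = exp_vol (shift1 g) es act vol f) \<and>
              L Q \<rho> = 0}"
proof -
  interpret g: gspace g es by standard (fact assms)+
  interpret X: gspace "shift1 g" es by (rule gspace_shift) (rule g.gspace_axioms)
  interpret S: shifted g es by unfold_locales
  interpret V: lie_volume "shift1 g" es M act vol L by unfold_locales (fact assms)+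
  let ?v = "exp_vol (shift1 g) es act vol"
  have main: "unimodular_L_infinity g es d l q \<longleftrightarrow> L (assoc_vf g d l) (?v (assoc_fn g q)) = 0"
    if l: "L_infinity g d l" and q: "q_family g q" for d l q
  proof -
    have P: "S.pre_Linf d l" using l by (simp add: S.L_infinity_iff)
    have f: "assoc_fn g q \<in> fns_deg (shift1 g) 0" "assoc_fn g q [] = 0"
      using S.assoc_fn_deg[OF q] by (auto simp: ideal0_def)
    show ?thesis
      unfolding S.unimodular_iff[OF l q] S.assoc_vf_eq[OF P] S.Qfield_def S.Qdiv_def
      by (rule V.L_exp_vol_zero_iff[symmetric, OF X.Qcoeff_fns_deg[OF S.skew_data_coder_data[OF S.pre_Linf_skew_data[OF P]]] f])
  qed
  have uni: "L_infinity g d l" "q_family g q" "S.pre_Linf d l"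
    if "unimodular_L_infinity g es d l q" for d l q
    using that S.L_infinity_iff by (auto simp: unimodular_L_infinity_def)
  let ?\<Phi> = "\<lambda>(d, l, q). (assoc_vf g d l, ?v (assoc_fn g q))"
  let ?A = "{(d, l, q). unimodular_L_infinity g es d l q}"
  let ?C = "{(Q, \<rho>). homological (shift1 g) Q \<and>
     (\<exists>f \<in> fns_deg (shift1 g) 0 \<inter> ideal0 (shift1 g). \<rho> = ?v f) \<and> L Q \<rho> = 0}"
  have "inj_on ?\<Phi> ?A"
  proof (rule inj_onI)
    fix x y assume xy: "x \<in> ?A" "y \<in> ?A" "?\<Phi> x = ?\<Phi> y"
    obtain d l q d' l' q' where x: "x = (d, l, q)" and y: "y = (d', l', q')"
      by (metis prod_cases3)
    have u: "unimodular_L_infinity g es d l q" "unimodular_L_infinity g es d' l' q'"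
      and e: "assoc_vf g d l = assoc_vf g d' l'" "?v (assoc_fn g q) = ?v (assoc_fn g q')"
      using xy unfolding x y by auto
    note U = uni[OF u(1)] and U' = uni[OF u(2)]
    note s = S.pre_Linf_skew_data[OF U(3)] and s' = S.pre_Linf_skew_data[OF U'(3)]
    have "assoc_fn g q = assoc_fn g q'"
      by (rule V.exp_vol_inject[OF S.assoc_fn_deg[OF U(2)] S.assoc_fn_deg[OF U'(2)] e(2)])
    then have q: "q = q'" by (rule S.assoc_fn_inject[OF U(2) U'(2)])
    have i: "precomp_s g g (precomp_s g g (full_l d l)) = full_l d l"
      "precomp_s g g (precomp_s g g (full_l d' l')) = full_l d' l'"
      by (rule S.ps_invol[OF S.vsg], use s s' in \<open>simp add: S.skew_data_def\<close>)+
    have "precomp_s g g (full_l d l) = precomp_s g g (full_l d' l')"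
      by (rule X.Qcoeff_inject[OF S.skew_data_coder_data[OF s] S.skew_data_coder_data[OF s']])
        (use e(1) in \<open>simp add: S.assoc_vf_eq[OF U(3)] S.assoc_vf_eq[OF U'(3)] S.Qfield_def\<close>)
    from arg_cong[OF this, of "precomp_s g g"] have "full_l d l = full_l d' l'" by (simp only: i)
    then show "x = y" unfolding x y using S.full_l_inject[OF U(3) U'(3)] q by blast
  qed
  moreover have "?\<Phi> ` ?A \<subseteq> ?C"
  proof (rule image_subsetI)
    fix x assume "x \<in> ?A"
    then obtain d l q where x: "x = (d, l, q)" and u: "unimodular_L_infinity g es d l q" by auto
    note U = uni[OF u]
    have "homological (shift1 g) (assoc_vf g d l)"
      using S.L_infinity_homological[OF U(3)] S.assoc_vf_eq[OF U(3)] U(1) by simp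
    moreover have "L (assoc_vf g d l) (?v (assoc_fn g q)) = 0" using main[OF U(1,2)] u by simp
    ultimately show "?\<Phi> x \<in> ?C" using S.assoc_fn_deg[OF U(2)] by (auto simp: x)
  qed
  moreover have "?C \<subseteq> ?\<Phi> ` ?A"
  proof clarify
    fix Q f assume Q: "homological (shift1 g) Q" and f: "f \<in> fns_deg (shift1 g) 0" "f \<in> ideal0 (shift1 g)"
      and z: "L Q (?v f) = 0"
    obtain T where T: "X.coder_data T" "Q = X.vfield (X.Qcoeff T)"
    proof (rule X.Qcoeff_surject)
      show "vector_field (shift1 g) 1 Q" using Q by (simp add: homological_def)
      show "\<phi> \<in> fns (shift1 g) \<Longrightarrow> Q \<phi> [] = 0" for \<phi> using Q by (simp add: homological_def)
    qed
    note s = S.coder_data_skew_data[OF T(1)]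
    \<comment> \<open>The shift does not change maps in a single argument, so \<open>d\<close> is read off without a sign twist.\<close>
    define d where "d x = - precomp_s g g T [x]" for x
    define l where "l xs = (if length xs < 2 then 0 else precomp_s g g T xs)" for xs
    have P: "S.pre_Linf d l" and e: "full_l d l = precomp_s g g T"
      using S.skew_data_pre_Linf[OF s] unfolding d_def[abs_def] l_def[abs_def] by auto
    have "precomp_s g g (full_l d l) = T"
      unfolding e using T(1) by (intro S.ps_invol S.vsg) (simp add: X.coder_data_def)
    then have Qe: "assoc_vf g d l = Q" by (simp add: S.assoc_vf_eq[OF P] S.Qfield_def T(2))
    then have li: "L_infinity g d l"
      using S.L_infinity_homological[OF P] S.assoc_vf_eq[OF P] Q by simp
    let ?q = "precomp_s g ground f"
    have q: "q_family g ?q" "assoc_fn g ?q = f" using S.fn_q_family f by blast+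
    have "unimodular_L_infinity g es d l ?q" using main[OF li q(1)] z Qe q(2) by simp
    then show "(Q, ?v f) \<in> ?\<Phi> ` ?A" using Qe q(2) by (intro image_eqI[of _ _ "(d, l, ?q)"]) auto
  qed
  ultimately show ?thesis using main unfolding bij_betw_def by blast
qed

end
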